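(* Let $(\mathcal{P},\omega)$ be a symplectic manifold, $H\in\mathcal{C}^\infty(\mathcal{P})$, and $\mathcal{M}=\mathsf{J}^{-1}(0)$, where $\mathsf{J}\colon\mathcal{P}\to V^*$ is smooth, $V$ is a finite-dimensional real vector space and $0$ is a regular value of $\mathsf{J}$. Suppose that $\mathcal{M}$ is a coisotropic submanifold and that for every $z\in\mathcal{M}$ all critical points of the restriction of $H$ to the fibre $[z]$ are nondegenerate. Let $\varphi_h$ be a smooth method consistent with $\dot z=X_H(z)$. Then the corresponding SHAKE and RATTLE methods $S_h$ and $R_h$ are convergent of order at least $1$. That is: let $\gamma\colon[0,T]\to\mathcal{M}^H$ be a solution of $\nu(\dot\gamma,\cdot)=\mathrm{d}(H|_{\mathcal{M}})(\gamma)$ with $\gamma(0)=z_0\in\mathcal{M}^H$, and let $d$ be a distance on $\mathcal{P}$ induced by a Riemannian metric. Then there exist $C>0$ and $h_1>0$ such that for all $0<h<h_1$ and all integers $k\ge 0$ with $kh\le T$, $$d\big((R_h)^k(z_0),\gamma(kh)\big)\le C h\qquad\text{and}\qquad d\big((S_h)^k(z_0),\gamma(kh)\big)\le C h .$$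
   Context: $X_H$ is the Hamiltonian vector field, $\omega(X_H,\cdot)=\mathrm{d}H$; $\nu$ is the pull-back of $\omega$ to $\mathcal{M}$. $\mathcal{M}$ is coisotropic if $T\mathcal{M}^{\perp}\subset T\mathcal{M}$, $\perp$ being the $\omega$-orthogonal complement. $\ker\nu$ (of constant dimension) is integrable and the fibre $[x]$ is the leaf through $x$. The hidden constraint set is $\mathcal{M}^H=\{z\in\mathcal{M}:\mathrm{d}(H|_{\mathcal{M}})(z)\in\nu(T_z\mathcal{M})\}$, $\nu(T_z\mathcal{M})=\{\nu_z(u,\cdot):u\in T_z\mathcal{M}\}$. A critical point is nondegenerate if its Hessian is nonsingular. A smooth method consistent with $\dot z=X_H(z)$ is a family of maps $\varphi_h\colon\mathcal{P}\to\mathcal{P}$, for $h$ in an open interval around $0$, smooth in $(h,z)$, with $\varphi_0=\mathrm{id}$ and $\frac{\partial}{\partial h}\varphi_h(z)|_{h=0}=X_H(z)$. For $O\subset\mathcal{M}$ open and $z\in O$, the local fibre $[z]_O$ is the connected component (in the leaf topology) of $[z]\cap O$ containing $z$. Throughout, $O\subset\mathcal{M}$ is an open set containing $\mathcal{M}^H$ and $h_0>0$ is such that SHAKE and RATTLE are well defined, meaning: (i) for every $x\in O$, $[x]_O\cap\mathcal{M}^H$ is a single point $\Pi(x)$, and $\Pi$ is smooth; (ii) for every $0<|h|<h_0$ and $z\in O$ there is exactly one $z^+\in[z]_O$ with $\varphi_h(z^+)\in\mathcal{M}$; the map $\Gamma_h\colon O\to O$, $\Gamma_h(z)=z^+$,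 is smooth, and $\varphi_h(\Gamma_h(O))\subset O$. The SHAKE map is $S_h=\varphi_h\circ\Gamma_h\colon O\to O$, and the RATTLE map is $R_h=\Pi\circ S_h$ (restricted to $\mathcal{M}^H\to\mathcal{M}^H$). *)

theory Defs
  imports "HOL-Analysis.Analysis"
begin

section \<open>Smooth maps between normed spaces\<close>

text \<open>For an open set \<open>S\<close>: \<open>f\<close> is of class \<open>C\<^sup>k\<close> iff it is continuous (\<open>k = 0\<close>), respectively
  differentiable with all directional derivatives of class \<open>C\<^sup>k\<^sup>-\<^sup>1\<close>.\<close>

primrec Ck_on :: "nat \<Rightarrow> 'a::real_normed_vector set \<Rightarrow> ('a \<Rightarrow> 'b::real_normed_vector) \<Rightarrow> bool" where
  "Ck_on 0 S f \<longleftrightarrow> continuous_on S f"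
| "Ck_on (Suc k) S f \<longleftrightarrow> (\<forall>x\<in>S. f differentiable (at x)) \<and>
     (\<forall>v. Ck_on k S (\<lambda>x. frechet_derivative f (at x) v))"

definition smooth_on :: "'a::real_normed_vector set \<Rightarrow> ('a \<Rightarrow> 'b::real_normed_vector) \<Rightarrow> bool" where
  "smooth_on S f \<longleftrightarrow> (\<forall>k. Ck_on k S f)"

section \<open>Smooth manifolds\<close>

text \<open>The underlying space of the manifold is a (Hausdorff, second countable) type \<open>'p\<close>, modelled on
  the Euclidean space \<open>'e\<close>. A chart is a pair of its domain and its coordinate map; the values of
  the coordinate map outside the domain are irrelevant.\<close>

type_synonym ('p, 'e) chart = "'p set \<times> ('p \<Rightarrow> 'e)"

abbreviation dom_of :: "('p, 'e) chart \<Rightarrow> 'p set" where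
  "dom_of c \<equiv> fst c"

abbreviation img_of :: "('p, 'e) chart \<Rightarrow> 'e set" where
  "img_of c \<equiv> snd c ` fst c"

abbreviation chart_inv :: "('p, 'e) chart \<Rightarrow> 'e \<Rightarrow> 'p" where
  "chart_inv c \<equiv> inv_into (fst c) (snd c)"

definition is_chart :: "('p::topological_space, 'e::euclidean_space) chart \<Rightarrow> bool" where
  "is_chart c \<longleftrightarrow> open (dom_of c) \<and> open (img_of c) \<and>
     homeomorphism (dom_of c) (img_of c) (snd c) (chart_inv c)"

definition compatible ::
    "('p::topological_space, 'e::euclidean_space) chart \<Rightarrow> ('p, 'e) chart \<Rightarrow> bool" where
  "compatible c d \<longleftrightarrow>
     smooth_on (snd c ` (dom_of c \<inter> dom_of d)) (snd d \<circ> chart_inv c) \<and>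
     smooth_on (snd d ` (dom_of c \<inter> dom_of d)) (snd c \<circ> chart_inv d)"

definition smooth_atlas :: "('p::topological_space, 'e::euclidean_space) chart set \<Rightarrow> bool" where
  "smooth_atlas A \<longleftrightarrow> (\<Union>c\<in>A. dom_of c) = UNIV \<and> (\<forall>c\<in>A. is_chart c) \<and>
     (\<forall>c\<in>A. \<forall>d\<in>A. compatible c d)"

text \<open>Membership in the maximal atlas generated by \<open>A\<close>.\<close>

definition smooth_chart ::
    "('p::topological_space, 'e::euclidean_space) chart set \<Rightarrow> ('p, 'e) chart \<Rightarrow> bool" where
  "smooth_chart A c \<longleftrightarrow> is_chart c \<and> (\<forall>d\<in>A. compatible c d)"

text \<open>As is common in formal libraries, the tangent space at \<open>p\<close> is the model space \<open>'e\<close> itself: a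
  tangent vector at \<open>p\<close> is given by its coordinates in the reference chart \<open>chart_at A p\<close>. The map
  \<open>to_ref A c x\<close> converts the coordinates in the chart \<open>c\<close> of a tangent vector at the point with
  coordinates \<open>x\<close> into this reference form.\<close>

definition chart_at :: "('p, 'e) chart set \<Rightarrow> 'p \<Rightarrow> ('p, 'e) chart" where
  "chart_at A p = (SOME c. c \<in> A \<and> p \<in> dom_of c)"

definition to_ref ::
    "('p, 'e::euclidean_space) chart set \<Rightarrow> ('p, 'e) chart \<Rightarrow> 'e \<Rightarrow> 'e \<Rightarrow> 'e" where
  "to_ref A c x u =
     frechet_derivative (snd (chart_at A (chart_inv c x)) \<circ> chart_inv c) (at x) u"

definition smooth_fun ::
    "('p, 'e::euclidean_space) chart set \<Rightarrow> ('p \<Rightarrow> 'b::real_normed_vector) \<Rightarrow> bool" where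
  "smooth_fun A f \<longleftrightarrow> (\<forall>c\<in>A. smooth_on (img_of c) (f \<circ> chart_inv c))"

text \<open>\<open>mderiv A f p\<close> is the differential of \<open>f\<close> at \<open>p\<close>, as a linear form on the tangent space at \<open>p\<close>.\<close>

definition mderiv ::
    "('p, 'e::euclidean_space) chart set \<Rightarrow> ('p \<Rightarrow> 'b::real_normed_vector) \<Rightarrow> 'p \<Rightarrow> 'e \<Rightarrow> 'b" where
  "mderiv A f p =
     frechet_derivative (f \<circ> chart_inv (chart_at A p)) (at (snd (chart_at A p) p))"

definition smooth_map ::
    "('p::topological_space, 'e::euclidean_space) chart set \<Rightarrow> 'p set \<Rightarrow> ('p \<Rightarrow> 'p) \<Rightarrow> bool" where
  "smooth_map A U f \<longleftrightarrow> continuous_on U f \<and>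
     (\<forall>c\<in>A. \<forall>d\<in>A. smooth_on (snd c ` {p \<in> dom_of c \<inter> U. f p \<in> dom_of d})
                              (snd d \<circ> f \<circ> chart_inv c))"

text \<open>Smoothness on a subset that need not be open (below: an open subset of a submanifold):
  local existence of smooth extensions.\<close>

definition smooth_map_on_subset ::
    "('p::topological_space, 'e::euclidean_space) chart set \<Rightarrow> 'p set \<Rightarrow> ('p \<Rightarrow> 'p) \<Rightarrow> bool" where
  "smooth_map_on_subset A N f \<longleftrightarrow>
     (\<forall>p\<in>N. \<exists>U F. open U \<and> p \<in> U \<and> smooth_map A U F \<and> (\<forall>q\<in>N \<inter> U. F q = f q))"

text \<open>Joint smoothness in \<open>(h, z)\<close> of a family of maps defined for parameters \<open>h\<close> in an open set \<open>I\<close>.\<close>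

definition smooth_family ::
    "('p::topological_space, 'e::euclidean_space) chart set \<Rightarrow> real set \<Rightarrow> (real \<Rightarrow> 'p \<Rightarrow> 'p) \<Rightarrow> bool" where
  "smooth_family A I \<phi> \<longleftrightarrow> continuous_on (I \<times> UNIV) (\<lambda>(h, z). \<phi> h z) \<and>
     (\<forall>c\<in>A. \<forall>d\<in>A.
        smooth_on {(h, x). h \<in> I \<and> x \<in> img_of c \<and> \<phi> h (chart_inv c x) \<in> dom_of d}
                  (\<lambda>(h, x). snd d (\<phi> h (chart_inv c x))))"

definition smooth_curve ::
    "('p::topological_space, 'e::euclidean_space) chart set \<Rightarrow> real set \<Rightarrow> (real \<Rightarrow> 'p) \<Rightarrow> bool" where
  "smooth_curve A I \<gamma> \<longleftrightarrow> continuous_on I \<gamma> \<and>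
     (\<forall>d\<in>A. smooth_on {t \<in> I. \<gamma> t \<in> dom_of d} (snd d \<circ> \<gamma>))"

definition has_velocity ::
    "('p::topological_space, 'e::euclidean_space) chart set \<Rightarrow> (real \<Rightarrow> 'p) \<Rightarrow> 'e \<Rightarrow> real \<Rightarrow> real set \<Rightarrow> bool" where
  "has_velocity A \<gamma> u t S \<longleftrightarrow> continuous (at t within S) \<gamma> \<and>
     ((snd (chart_at A (\<gamma> t)) \<circ> \<gamma>) has_vector_derivative u) (at t within S)"

section \<open>Submanifolds\<close>

definition slice :: "('p, 'e) chart \<Rightarrow> 'e set \<Rightarrow> 'p set" where
  "slice c E = {p \<in> dom_of c. snd c p \<in> E}"

definition submanifold ::
    "('p::topological_space, 'e::euclidean_space) chart set \<Rightarrow> 'p set \<Rightarrow> bool" where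
  "submanifold A N \<longleftrightarrow>
     (\<forall>p\<in>N. \<exists>c E. smooth_chart A c \<and> subspace E \<and> p \<in> dom_of c \<and> N \<inter> dom_of c = slice c E)"

definition tangent ::
    "('p::topological_space, 'e::euclidean_space) chart set \<Rightarrow> 'p set \<Rightarrow> 'p \<Rightarrow> 'e set" where
  "tangent A N p = {u. \<exists>\<gamma> \<epsilon>. \<epsilon> > 0 \<and> smooth_curve A {-\<epsilon><..<\<epsilon>} \<gamma> \<and> (\<forall>t\<in>{-\<epsilon><..<\<epsilon>}. \<gamma> t \<in> N) \<and>
     \<gamma> 0 = p \<and> has_velocity A \<gamma> u 0 {-\<epsilon><..<\<epsilon>}}"

section \<open>Symplectic forms and Riemannian metrics\<close>

text \<open>A covariant 2-tensor field assigns to each point a bilinear form on the tangent space;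
  \<open>in_chart A \<tau> c x\<close> is its coordinate expression in the chart \<open>c\<close>.\<close>

definition in_chart ::
    "('p, 'e::euclidean_space) chart set \<Rightarrow> ('p \<Rightarrow> 'e \<Rightarrow> 'e \<Rightarrow> real) \<Rightarrow> ('p, 'e) chart
      \<Rightarrow> 'e \<Rightarrow> 'e \<Rightarrow> 'e \<Rightarrow> real" where
  "in_chart A \<tau> c x u v = \<tau> (chart_inv c x) (to_ref A c x u) (to_ref A c x v)"

definition smooth_2tensor ::
    "('p, 'e::euclidean_space) chart set \<Rightarrow> ('p \<Rightarrow> 'e \<Rightarrow> 'e \<Rightarrow> real) \<Rightarrow> bool" where
  "smooth_2tensor A \<tau> \<longleftrightarrow> (\<forall>p. bilinear (\<tau> p)) \<and>
     (\<forall>c\<in>A. \<forall>u v. smooth_on (img_of c) (\<lambda>x. in_chart A \<tau> c x u v))"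

text \<open>\<open>d\<omega> = 0\<close>, evaluated on constant coordinate vector fields \<open>u, v, w\<close>.\<close>

definition closed_2form ::
    "('p, 'e::euclidean_space) chart set \<Rightarrow> ('p \<Rightarrow> 'e \<Rightarrow> 'e \<Rightarrow> real) \<Rightarrow> bool" where
  "closed_2form A \<omega> \<longleftrightarrow> (\<forall>c\<in>A. \<forall>x\<in>img_of c. \<forall>u v w.
       frechet_derivative (\<lambda>y. in_chart A \<omega> c y v w) (at x) u
     + frechet_derivative (\<lambda>y. in_chart A \<omega> c y w u) (at x) v
     + frechet_derivative (\<lambda>y. in_chart A \<omega> c y u v) (at x) w = 0)"

definition symplectic_form ::
    "('p, 'e::euclidean_space) chart set \<Rightarrow> ('p \<Rightarrow> 'e \<Rightarrow> 'e \<Rightarrow> real) \<Rightarrow> bool" where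
  "symplectic_form A \<omega> \<longleftrightarrow> smooth_2tensor A \<omega> \<and> (\<forall>p u. \<omega> p u u = 0) \<and>
     (\<forall>p u. (\<forall>v. \<omega> p u v = 0) \<longrightarrow> u = 0) \<and> closed_2form A \<omega>"

definition riemannian_metric ::
    "('p, 'e::euclidean_space) chart set \<Rightarrow> ('p \<Rightarrow> 'e \<Rightarrow> 'e \<Rightarrow> real) \<Rightarrow> bool" where
  "riemannian_metric A g \<longleftrightarrow> smooth_2tensor A g \<and> (\<forall>p u v. g p u v = g p v u) \<and>
     (\<forall>p u. u \<noteq> 0 \<longrightarrow> g p u u > 0)"

definition piecewise_C1_curve ::
    "('p::topological_space, 'e::euclidean_space) chart set \<Rightarrow> (real \<Rightarrow> 'p) \<Rightarrow> bool" where
  "piecewise_C1_curve A \<gamma> \<longleftrightarrow> continuous_on {0..1} \<gamma> \<and>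
     (\<exists>X. finite X \<and> (\<forall>d\<in>A. (snd d \<circ> \<gamma>) C1_differentiable_on ({t \<in> {0..1}. \<gamma> t \<in> dom_of d} - X)))"

definition curve_length ::
    "('p, 'e::euclidean_space) chart set \<Rightarrow> ('p \<Rightarrow> 'e \<Rightarrow> 'e \<Rightarrow> real) \<Rightarrow> (real \<Rightarrow> 'p) \<Rightarrow> ennreal" where
  "curve_length A g \<gamma> = (\<integral>\<^sup>+ t\<in>{0..1}.
     (let u = vector_derivative (snd (chart_at A (\<gamma> t)) \<circ> \<gamma>) (at t)
      in ennreal (sqrt (g (\<gamma> t) u u))) \<partial>lborel)"

text \<open>The value is \<open>\<infinity>\<close> exactly for points in different components.\<close>

definition riemannian_dist ::
    "('p::topological_space, 'e::euclidean_space) chart set \<Rightarrow> ('p \<Rightarrow> 'e \<Rightarrow> 'e \<Rightarrow> real)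
      \<Rightarrow> 'p \<Rightarrow> 'p \<Rightarrow> ennreal" where
  "riemannian_dist A g p q =
     (INF \<gamma>\<in>{\<gamma>. piecewise_C1_curve A \<gamma> \<and> \<gamma> 0 = p \<and> \<gamma> 1 = q}. curve_length A g \<gamma>)"

section \<open>Hamiltonian systems and smooth methods\<close>

definition hamiltonian_field ::
    "('p, 'e::euclidean_space) chart set \<Rightarrow> ('p \<Rightarrow> 'e \<Rightarrow> 'e \<Rightarrow> real) \<Rightarrow> ('p \<Rightarrow> real) \<Rightarrow> 'p \<Rightarrow> 'e" where
  "hamiltonian_field A \<omega> H p = (THE u. \<forall>v. \<omega> p u v = mderiv A H p v)"

definition consistent_method ::
    "('p::topological_space, 'e::euclidean_space) chart set \<Rightarrow> ('p \<Rightarrow> 'e) \<Rightarrow> real set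
      \<Rightarrow> (real \<Rightarrow> 'p \<Rightarrow> 'p) \<Rightarrow> bool" where
  "consistent_method A X I \<phi> \<longleftrightarrow> open I \<and> is_interval I \<and> 0 \<in> I \<and> smooth_family A I \<phi> \<and>
     (\<forall>z. \<phi> 0 z = z) \<and> (\<forall>z. has_velocity A (\<lambda>h. \<phi> h z) (X z) 0 I)"

section \<open>Constraint manifolds\<close>

text \<open>The elements of \<open>V\<^sup>*\<close> are the linear maps \<open>'v \<Rightarrow> real\<close>. Smoothness of a \<open>V\<^sup>*\<close>-valued map and its
  differential are taken pointwise on \<open>V\<close>, which, \<open>V\<close> being finite-dimensional, is the same as in
  linear coordinates of \<open>V\<^sup>*\<close>.\<close>

definition smooth_dual_map ::
    "('p, 'e::euclidean_space) chart set \<Rightarrow> ('p \<Rightarrow> 'v::real_vector \<Rightarrow> real) \<Rightarrow> bool" where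
  "smooth_dual_map A J \<longleftrightarrow> (\<forall>z. linear (J z)) \<and> (\<forall>v. smooth_fun A (\<lambda>z. J z v))"

definition zero_level :: "('p \<Rightarrow> 'v \<Rightarrow> real) \<Rightarrow> 'p set" where
  "zero_level J = {z. \<forall>v. J z v = 0}"

definition zero_is_regular_value ::
    "('p, 'e::euclidean_space) chart set \<Rightarrow> ('p \<Rightarrow> 'v::real_vector \<Rightarrow> real) \<Rightarrow> bool" where
  "zero_is_regular_value A J \<longleftrightarrow>
     (\<forall>z\<in>zero_level J. \<forall>l. linear l \<longrightarrow> (\<exists>u. \<forall>v. mderiv A (\<lambda>p. J p v) z u = l v))"

definition coisotropic ::
    "('p::topological_space, 'e::euclidean_space) chart set \<Rightarrow> ('p \<Rightarrow> 'e \<Rightarrow> 'e \<Rightarrow> real) \<Rightarrow> 'p set \<Rightarrow> bool" where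
  "coisotropic A \<omega> M \<longleftrightarrow> submanifold A M \<and>
     (\<forall>z\<in>M. {u. \<forall>v\<in>tangent A M z. \<omega> z u v = 0} \<subseteq> tangent A M z)"

text \<open>The pull-back \<open>\<nu>\<close> of \<open>\<omega>\<close> to \<open>M\<close> at \<open>z\<close> is \<open>\<omega> z\<close> with both arguments restricted to \<open>tangent A M z\<close>;
  likewise, \<open>d(H|M)(z)\<close> is the restriction of \<open>mderiv A H z\<close> to \<open>tangent A M z\<close>.\<close>

definition ker_pullback ::
    "('p::topological_space, 'e::euclidean_space) chart set \<Rightarrow> ('p \<Rightarrow> 'e \<Rightarrow> 'e \<Rightarrow> real) \<Rightarrow> 'p set
      \<Rightarrow> 'p \<Rightarrow> 'e set" where
  "ker_pullback A \<omega> M z = {u \<in> tangent A M z. \<forall>v\<in>tangent A M z. \<omega> z u v = 0}"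

definition hidden_constraint ::
    "('p::topological_space, 'e::euclidean_space) chart set \<Rightarrow> ('p \<Rightarrow> 'e \<Rightarrow> 'e \<Rightarrow> real) \<Rightarrow> 'p set
      \<Rightarrow> ('p \<Rightarrow> real) \<Rightarrow> 'p set" where
  "hidden_constraint A \<omega> M H =
     {z \<in> M. \<exists>u\<in>tangent A M z. \<forall>v\<in>tangent A M z. mderiv A H z v = \<omega> z u v}"

text \<open>Solutions on \<open>[0, T]\<close> of \<open>\<nu>(\<gamma>', \<cdot>) = d(H|M)(\<gamma>)\<close> with values in the hidden constraint set
  (one-sided derivatives at the endpoints).\<close>

definition constrained_solution ::
    "('p::topological_space, 'e::euclidean_space) chart set \<Rightarrow> ('p \<Rightarrow> 'e \<Rightarrow> 'e \<Rightarrow> real) \<Rightarrow> 'p set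
      \<Rightarrow> ('p \<Rightarrow> real) \<Rightarrow> real \<Rightarrow> (real \<Rightarrow> 'p) \<Rightarrow> bool" where
  "constrained_solution A \<omega> M H T \<gamma> \<longleftrightarrow>
     (\<forall>t\<in>{0..T}. \<gamma> t \<in> hidden_constraint A \<omega> M H \<and>
        (\<exists>u\<in>tangent A M (\<gamma> t). has_velocity A \<gamma> u t {0..T} \<and>
           (\<forall>v\<in>tangent A M (\<gamma> t). \<omega> (\<gamma> t) u v = mderiv A H (\<gamma> t) v)))"

section \<open>Fibres\<close>

text \<open>The leaf topology of the foliation of \<open>M\<close> integrating \<open>ker \<nu>\<close> is generated by the (embedded)
  integral manifolds of \<open>ker \<nu>\<close>; the leaves are its connected components.\<close>

definition integral_manifold ::
    "('p::topological_space, 'e::euclidean_space) chart set \<Rightarrow> ('p \<Rightarrow> 'e \<Rightarrow> 'e \<Rightarrow> real) \<Rightarrow> 'p set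
      \<Rightarrow> 'p set \<Rightarrow> bool" where
  "integral_manifold A \<omega> M N \<longleftrightarrow> submanifold A N \<and> N \<subseteq> M \<and>
     (\<forall>z\<in>N. tangent A N z = ker_pullback A \<omega> M z)"

definition leaf_topology ::
    "('p::topological_space, 'e::euclidean_space) chart set \<Rightarrow> ('p \<Rightarrow> 'e \<Rightarrow> 'e \<Rightarrow> real) \<Rightarrow> 'p set
      \<Rightarrow> 'p topology" where
  "leaf_topology A \<omega> M = topology_generated_by {N. integral_manifold A \<omega> M N}"

definition fibre ::
    "('p::topological_space, 'e::euclidean_space) chart set \<Rightarrow> ('p \<Rightarrow> 'e \<Rightarrow> 'e \<Rightarrow> real) \<Rightarrow> 'p set
      \<Rightarrow> 'p \<Rightarrow> 'p set" where
  "fibre A \<omega> M z = connected_component_of_set (leaf_topology A \<omega> M) z"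

definition local_fibre ::
    "('p::topological_space, 'e::euclidean_space) chart set \<Rightarrow> ('p \<Rightarrow> 'e \<Rightarrow> 'e \<Rightarrow> real) \<Rightarrow> 'p set
      \<Rightarrow> 'p set \<Rightarrow> 'p \<Rightarrow> 'p set" where
  "local_fibre A \<omega> M W z =
     connected_component_of_set (subtopology (leaf_topology A \<omega> M) (fibre A \<omega> M z \<inter> W)) z"

text \<open>The tangent space of a fibre at \<open>x\<close> is \<open>ker \<nu>\<close> at \<open>x\<close>.\<close>

definition critical_on_fibre ::
    "('p::topological_space, 'e::euclidean_space) chart set \<Rightarrow> ('p \<Rightarrow> 'e \<Rightarrow> 'e \<Rightarrow> real) \<Rightarrow> 'p set
      \<Rightarrow> ('p \<Rightarrow> real) \<Rightarrow> 'p \<Rightarrow> 'p \<Rightarrow> bool" where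
  "critical_on_fibre A \<omega> M H z x \<longleftrightarrow>
     x \<in> fibre A \<omega> M z \<and> (\<forall>u\<in>ker_pullback A \<omega> M x. mderiv A H x u = 0)"

text \<open>A chart of the fibre through \<open>z\<close>: the domain is the plaque \<open>slice c E\<close>, which is open in the fibre,
  and the coordinates are \<open>snd c\<close>, with values in the subspace \<open>E\<close>.\<close>

definition fibre_chart ::
    "('p::topological_space, 'e::euclidean_space) chart set \<Rightarrow> ('p \<Rightarrow> 'e \<Rightarrow> 'e \<Rightarrow> real) \<Rightarrow> 'p set
      \<Rightarrow> 'p \<Rightarrow> ('p, 'e) chart \<Rightarrow> 'e set \<Rightarrow> bool" where
  "fibre_chart A \<omega> M z c E \<longleftrightarrow> smooth_chart A c \<and> subspace E \<and>
     integral_manifold A \<omega> M (slice c E) \<and> slice c E \<subseteq> fibre A \<omega> M z"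

definition second_deriv ::
    "('a::real_normed_vector \<Rightarrow> real) \<Rightarrow> 'a \<Rightarrow> 'a \<Rightarrow> 'a \<Rightarrow> real" where
  "second_deriv f x a b = frechet_derivative (\<lambda>y. frechet_derivative f (at y) b) (at x) a"

text \<open>Nonsingularity of the Hessian, at a critical point \<open>x\<close>, of the restriction of \<open>H\<close> to the fibre
  through \<open>z\<close>. At a critical point the condition does not depend on the chart of the fibre.\<close>

definition nondegenerate_on_fibre ::
    "('p::topological_space, 'e::euclidean_space) chart set \<Rightarrow> ('p \<Rightarrow> 'e \<Rightarrow> 'e \<Rightarrow> real) \<Rightarrow> 'p set
      \<Rightarrow> ('p \<Rightarrow> real) \<Rightarrow> 'p \<Rightarrow> 'p \<Rightarrow> bool" where
  "nondegenerate_on_fibre A \<omega> M H z x \<longleftrightarrow>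
     (\<forall>c E. fibre_chart A \<omega> M z c E \<and> x \<in> slice c E \<longrightarrow>
        (\<forall>a\<in>E. (\<forall>b\<in>E. second_deriv (H \<circ> chart_inv c) (snd c x) a b = 0) \<longrightarrow> a = 0))"

section \<open>SHAKE and RATTLE\<close>

definition fibre_projection ::
    "('p::topological_space, 'e::euclidean_space) chart set \<Rightarrow> ('p \<Rightarrow> 'e \<Rightarrow> 'e \<Rightarrow> real) \<Rightarrow> 'p set
      \<Rightarrow> ('p \<Rightarrow> real) \<Rightarrow> 'p set \<Rightarrow> 'p \<Rightarrow> 'p" where
  "fibre_projection A \<omega> M H W x =
     (THE p. p \<in> local_fibre A \<omega> M W x \<inter> hidden_constraint A \<omega> M H)"

definition shake_shift ::
    "('p::topological_space, 'e::euclidean_space) chart set \<Rightarrow> ('p \<Rightarrow> 'e \<Rightarrow> 'e \<Rightarrow> real) \<Rightarrow> 'p set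
      \<Rightarrow> (real \<Rightarrow> 'p \<Rightarrow> 'p) \<Rightarrow> 'p set \<Rightarrow> real \<Rightarrow> 'p \<Rightarrow> 'p" where
  "shake_shift A \<omega> M \<phi> W h z = (THE p. p \<in> local_fibre A \<omega> M W z \<and> \<phi> h p \<in> M)"

definition shake_rattle_well_defined ::
    "('p::topological_space, 'e::euclidean_space) chart set \<Rightarrow> ('p \<Rightarrow> 'e \<Rightarrow> 'e \<Rightarrow> real) \<Rightarrow> 'p set
      \<Rightarrow> ('p \<Rightarrow> real) \<Rightarrow> (real \<Rightarrow> 'p \<Rightarrow> 'p) \<Rightarrow> 'p set \<Rightarrow> real \<Rightarrow> bool" where
  "shake_rattle_well_defined A \<omega> M H \<phi> W h0 \<longleftrightarrow>
     (\<forall>x\<in>W. \<exists>!p. p \<in> local_fibre A \<omega> M W x \<inter> hidden_constraint A \<omega> M H) \<and>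
     smooth_map_on_subset A W (fibre_projection A \<omega> M H W) \<and>
     (\<forall>h. 0 < \<bar>h\<bar> \<and> \<bar>h\<bar> < h0 \<longrightarrow>
        (\<forall>z\<in>W. \<exists>!p. p \<in> local_fibre A \<omega> M W z \<and> \<phi> h p \<in> M) \<and>
        smooth_map_on_subset A W (shake_shift A \<omega> M \<phi> W h) \<and>
        (\<forall>z\<in>W. \<phi> h (shake_shift A \<omega> M \<phi> W h z) \<in> W))"

definition shake ::
    "('p::topological_space, 'e::euclidean_space) chart set \<Rightarrow> ('p \<Rightarrow> 'e \<Rightarrow> 'e \<Rightarrow> real) \<Rightarrow> 'p set
      \<Rightarrow> (real \<Rightarrow> 'p \<Rightarrow> 'p) \<Rightarrow> 'p set \<Rightarrow> real \<Rightarrow> 'p \<Rightarrow> 'p" where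
  "shake A \<omega> M \<phi> W h = \<phi> h \<circ> shake_shift A \<omega> M \<phi> W h"

definition rattle ::
    "('p::topological_space, 'e::euclidean_space) chart set \<Rightarrow> ('p \<Rightarrow> 'e \<Rightarrow> 'e \<Rightarrow> real) \<Rightarrow> 'p set
      \<Rightarrow> ('p \<Rightarrow> real) \<Rightarrow> (real \<Rightarrow> 'p \<Rightarrow> 'p) \<Rightarrow> 'p set \<Rightarrow> real \<Rightarrow> 'p \<Rightarrow> 'p" where
  "rattle A \<omega> M H \<phi> W h = fibre_projection A \<omega> M H W \<circ> shake A \<omega> M \<phi> W h"

end

theory Submission
  imports Defs
begin

text \<open>Let \<open>\<pi>\<close> be the projection to the hidden constraint set along the fibres. Since \<open>\<pi>\<close> is constant on
  local fibres, its derivative annihilates \<open>ker \<nu>\<close>, and conversely the local fibre of a point \<open>z\<close> of the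
  hidden constraint set is the solution set of \<open>\<pi>(x) = z\<close>. Nondegeneracy of the Hessians makes the
  equations \<open>\<pi>(x) = z\<close>, \<open>\<phi>\<^sub>h(x) \<in> M\<close> uniformly solvable for \<open>x = z + O(h)\<close> by contraction; by uniqueness
  the solution is the shifted point of SHAKE. Hence a RATTLE step is \<open>\<pi>(\<phi>\<^sub>h(x)) = z + h Y(z) + O(h\<^sup>2)\<close> with
  \<open>Y = d\<pi>(X\<^sub>H)\<close>. A solution satisfies \<open>\<gamma> = \<pi>(\<gamma>)\<close> and \<open>\<gamma>' - X\<^sub>H \<in> ker \<nu>\<close>, so \<open>\<gamma>' = Y(\<gamma>)\<close>, and RATTLE
  converges by the usual error recursion, carried out in finitely many charts along \<open>\<gamma>\<close>. A SHAKE iterate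
  is one SHAKE step, which moves points by \<open>O(h)\<close>, applied to the previous RATTLE iterate.\<close>


section \<open>Calculus of smooth maps\<close>

text \<open>Two obstacles shape the estimates. For each fixed h the shift \<open>\<Gamma> h\<close>
  is smooth, but nothing given bounds it as h tends to 0; all constants must come from a solution
  built by hand, which uniqueness then identifies with the shifted point. And at h = 0 the equation
  \<open>\<phi> h x \<in> M\<close> is empty, because \<open>\<phi> 0\<close> is the identity. Its
  part normal to M has to be divided by h; what is left in the limit is tangency of the Hamiltonian
  field to M, that is, the hidden constraint. The count behind solvability: by nondegeneracy of
  \<omega> the dimension of ker \<nu> is the codimension of M, and coisotropy places ker \<nu> in
  TM. Hence the normal part of the derivative of the field, which along ker \<nu> encodes the
  Hessian on the fibre, maps ker \<nu> bijectively onto the normal directions. The divided equation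
  then determines x along the fibre, and the equation for \<pi> determines it along the hidden
  constraint set. The tangent directions of that set are obtained by the same contraction argument,
  applied to the condition that the field be tangent to M.\<close>

lemma Ck_on_subset: "Ck_on k S f \<Longrightarrow> T \<subseteq> S \<Longrightarrow> Ck_on k T f"
  by (induction k arbitrary: f) (auto intro: continuous_on_subset)

lemma Ck_on_SucD:
  assumes "Ck_on (Suc k) S f" "x \<in> S"
  shows "(f has_derivative frechet_derivative f (at x)) (at x)"
  using assms by (simp add: frechet_derivative_works)

lemma Ck_on_cong:
  assumes "open S" "\<And>x. x \<in> S \<Longrightarrow> f x = g x" "Ck_on k S f"
  shows "Ck_on k S g"
  using assms(2,3)
proof (induction k arbitrary: f g)
  case 0
  then show ?case using continuous_on_cong by (metis Ck_on.simps(1))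
next
  case (Suc k)
  have d: "(g has_derivative frechet_derivative f (at x)) (at x)" if "x \<in> S" for x
    using Ck_on_SucD[OF Suc.prems(2) that] has_derivative_transform_within_open[OF _ assms(1) that]
      Suc.prems(1) by blast
  then have e: "frechet_derivative f (at x) = frechet_derivative g (at x)" if "x \<in> S" for x
    using frechet_derivative_at that by blast
  have "Ck_on k S (\<lambda>x. frechet_derivative g (at x) v)" for v
    by (rule Suc.IH[of "\<lambda>x. frechet_derivative f (at x) v"]) (use e Suc.prems in auto)
  moreover have "\<forall>x\<in>S. g differentiable (at x)"
    using d by (metis differentiable_def)
  ultimately show ?case by simp
qed

lemma Ck_on_SucI:
  assumes "open S" "\<And>x. x \<in> S \<Longrightarrow> (f has_derivative f' x) (at x)"
    and "\<And>v. Ck_on k S (\<lambda>x. f' x v)"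
  shows "Ck_on (Suc k) S f"
proof -
  have "f' x = frechet_derivative f (at x)" if "x \<in> S" for x
    using assms(2)[OF that] by (rule frechet_derivative_at)
  then have "Ck_on k S (\<lambda>x. frechet_derivative f (at x) v)" for v
    by (intro Ck_on_cong[OF assms(1) _ assms(3)]) simp
  moreover have "\<forall>x\<in>S. f differentiable (at x)"
    using assms(2) by (metis differentiable_def)
  ultimately show ?thesis by simp
qed

lemma Ck_on_imp_continuous_on: "Ck_on k S f \<Longrightarrow> continuous_on S f"
  by (cases k) (simp_all add: continuous_at_imp_continuous_on differentiable_imp_continuous_within)

lemma Ck_on_Suc: "Ck_on (Suc k) S f \<Longrightarrow> Ck_on k S f"
proof (induction k arbitrary: f)
  case 0
  then show ?case by (metis Ck_on.simps(1) Ck_on_imp_continuous_on)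
next
  case (Suc k)
  then show ?case by (metis Ck_on.simps(2))
qed

text \<open>The derivative in \<open>Ck_on\<close> is the full one \<open>at x\<close>, so
  differentiability is tested on neighbourhoods and \<open>S\<close> may be any set. This is what
  transfers smoothness from charts of the atlas to charts of the maximal atlas.\<close>

lemma Ck_on_local:
  assumes "\<And>x. x \<in> S \<Longrightarrow> \<exists>U. open U \<and> x \<in> U \<and> Ck_on k U f"
  shows "Ck_on k S f"
  using assms
proof (induction k arbitrary: f)
  case 0
  have "isCont f x" if "x \<in> S" for x
    using 0[OF that] continuous_on_eq_continuous_at by (metis Ck_on.simps(1))
  then show ?case by (simp add: continuous_at_imp_continuous_on)
next
  case (Suc k)
  have "f differentiable (at x)" if "x \<in> S" for x
    using Suc.prems[OF that] by auto
  moreover have "Ck_on k S (\<lambda>x. frechet_derivative f (at x) v)" for v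
  proof (rule Suc.IH)
    fix x assume "x \<in> S"
    then obtain U where "open U \<and> x \<in> U \<and> Ck_on (Suc k) U f" using Suc.prems by blast
    then show "\<exists>U. open U \<and> x \<in> U \<and> Ck_on k U (\<lambda>x. frechet_derivative f (at x) v)" by auto
  qed
  ultimately show ?case by simp
qed

lemma Ck_on_const: "open S \<Longrightarrow> Ck_on k S (\<lambda>x. c)"
proof (induction k arbitrary: c)
  case (Suc k)
  show ?case by (rule Ck_on_SucI[OF Suc.prems, where f'="\<lambda>x v. 0"]) (use Suc in auto)
qed simp

lemma Ck_on_bounded_linear:
  assumes "bounded_linear l" "open S" "Ck_on k S f"
  shows "Ck_on k S (\<lambda>x. l (f x))"
  using assms(3)
proof (induction k arbitrary: f)
  case 0
  then show ?case using assms(1) by (simp add: bounded_linear.continuous_on)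
next
  case (Suc k)
  show ?case
    by (rule Ck_on_SucI[OF assms(2) bounded_linear.has_derivative[OF assms(1) Ck_on_SucD[OF Suc.prems]]])
      (use Suc in auto)
qed

lemma Ck_on_id: "open S \<Longrightarrow> Ck_on k S (\<lambda>x. x)"
proof (cases k)
  case (Suc j)
  assume "open S"
  show ?thesis unfolding Suc
    by (rule Ck_on_SucI[OF \<open>open S\<close>, where f'="\<lambda>x v. v"]) (use Ck_on_const \<open>open S\<close> in auto)
qed simp

lemma Ck_on_linear: "bounded_linear l \<Longrightarrow> open S \<Longrightarrow> Ck_on k S l"
  using Ck_on_bounded_linear[OF _ _ Ck_on_id] .

lemma Ck_on_add:
  assumes "open S" "Ck_on k S f" "Ck_on k S g"
  shows "Ck_on k S (\<lambda>x. f x + g x)"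
  using assms(2,3)
proof (induction k arbitrary: f g)
  case 0
  then show ?case by (simp add: continuous_on_add)
next
  case (Suc k)
  show ?case
    by (rule Ck_on_SucI[OF assms(1) has_derivative_add[OF Ck_on_SucD[OF Suc.prems(1)] Ck_on_SucD[OF Suc.prems(2)]]])
      (use Suc in auto)
qed

lemma Ck_on_sum:
  assumes "open S" "\<And>i. i \<in> B \<Longrightarrow> Ck_on k S (f i)"
  shows "Ck_on k S (\<lambda>x. \<Sum>i\<in>B. f i x)"
  using assms(2)
  by (induction B rule: infinite_finite_induct) (auto intro!: Ck_on_const Ck_on_add assms(1))

lemma Ck_on_bilinear:
  assumes "bounded_bilinear p" "open S" "Ck_on k S f" "Ck_on k S g"
  shows "Ck_on k S (\<lambda>x. p (f x) (g x))"
  using assms(3,4)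
proof (induction k arbitrary: f g)
  case 0
  then show ?case using assms(1) by (simp add: bounded_bilinear.continuous_on)
next
  case (Suc k)
  show ?case
  proof (rule Ck_on_SucI[OF assms(2) bounded_bilinear.FDERIV[OF assms(1) Ck_on_SucD[OF Suc.prems(1)] Ck_on_SucD[OF Suc.prems(2)]]])
    fix v
    show "Ck_on k S (\<lambda>x. p (f x) (frechet_derivative g (at x) v) + p (frechet_derivative f (at x) v) (g x))"
      using Suc.prems Ck_on_Suc[OF Suc.prems(1)] Ck_on_Suc[OF Suc.prems(2)]
      by (intro Ck_on_add Suc.IH assms(2)) auto
  qed
qed

lemma Ck_on_Pair:
  assumes "open S" "Ck_on k S f" "Ck_on k S g"
  shows "Ck_on k S (\<lambda>x. (f x, g x))"
  using assms(2,3)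
proof (induction k arbitrary: f g)
  case 0
  then show ?case by (simp add: continuous_on_Pair)
next
  case (Suc k)
  show ?case
    by (rule Ck_on_SucI[OF assms(1) has_derivative_Pair[OF Ck_on_SucD[OF Suc.prems(1)] Ck_on_SucD[OF Suc.prems(2)]]])
      (use Suc in auto)
qed

lemma linear_expand_Basis:
  fixes l :: "'a::euclidean_space \<Rightarrow> 'b::real_normed_vector"
  assumes "linear l"
  shows "l v = (\<Sum>b\<in>Basis. (v \<bullet> b) *\<^sub>R l b)"
proof -
  have "l v = l (\<Sum>b\<in>Basis. (v \<bullet> b) *\<^sub>R b)" by (simp add: euclidean_representation)
  then show ?thesis using assms by (simp add: linear_sum linear_scale)
qed

text \<open>The chain rule feeds a varying vector into the derivative of \<open>g\<close>, whereas
  \<open>Ck_on\<close> controls derivatives in fixed directions. Expanding that vector in the basis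
  gives finitely many products, which is why the intermediate space is Euclidean.\<close>

lemma Ck_on_compose:
  fixes f :: "'a::real_normed_vector \<Rightarrow> 'b::euclidean_space"
  assumes "open S" "open T" "f ` S \<subseteq> T" "Ck_on k S f" "Ck_on k T g"
  shows "Ck_on k S (\<lambda>x. g (f x))"
  using assms(4,5)
proof (induction k arbitrary: g)
  case 0
  then show ?case using assms(3) by (auto intro: continuous_on_compose2)
next
  case (Suc k)
  let ?g' = "\<lambda>x v. \<Sum>b\<in>Basis. (frechet_derivative f (at x) v \<bullet> b) *\<^sub>R frechet_derivative g (at (f x)) b"
  show ?case
  proof (rule Ck_on_SucI[OF assms(1)])
    fix x assume x: "x \<in> S"
    have dg: "(g has_derivative frechet_derivative g (at (f x))) (at (f x))"
      using Ck_on_SucD[OF Suc.prems(2)] assms(3) x by blast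
    have "((\<lambda>x. g (f x)) has_derivative (\<lambda>v. frechet_derivative g (at (f x)) (frechet_derivative f (at x) v))) (at x)"
      using has_derivative_compose[OF Ck_on_SucD[OF Suc.prems(1) x] dg] .
    also have "(\<lambda>v. frechet_derivative g (at (f x)) (frechet_derivative f (at x) v)) = ?g' x"
      by (rule ext, rule linear_expand_Basis, rule has_derivative_linear[OF dg])
    finally show "((\<lambda>x. g (f x)) has_derivative ?g' x) (at x)" .
  next
    fix v
    show "Ck_on k S (\<lambda>x. ?g' x v)"
    proof (intro Ck_on_sum assms(1))
      fix b :: 'b
      have "Ck_on k S (\<lambda>x. frechet_derivative f (at x) v \<bullet> b)"
        using Suc.prems(1) by (intro Ck_on_bounded_linear[OF bounded_linear_inner_left] assms(1)) auto
      moreover have "Ck_on k S (\<lambda>x. frechet_derivative g (at (f x)) b)"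
        using Suc.IH[of "\<lambda>y. frechet_derivative g (at y) b"] Suc.prems Ck_on_Suc by auto
      ultimately show "Ck_on k S (\<lambda>x. (frechet_derivative f (at x) v \<bullet> b) *\<^sub>R frechet_derivative g (at (f x)) b)"
        using Ck_on_bilinear[OF bounded_bilinear_scaleR assms(1)] by blast
    qed
  qed
qed

lemma smooth_on_subset: "smooth_on S f \<Longrightarrow> T \<subseteq> S \<Longrightarrow> smooth_on T f"
  unfolding smooth_on_def using Ck_on_subset by blast

lemma smooth_on_cong: "open S \<Longrightarrow> (\<And>x. x \<in> S \<Longrightarrow> f x = g x) \<Longrightarrow> smooth_on S f \<Longrightarrow> smooth_on S g"
  unfolding smooth_on_def using Ck_on_cong by blast

lemma smooth_on_local: "(\<And>x. x \<in> S \<Longrightarrow> \<exists>U. open U \<and> x \<in> U \<and> smooth_on U f) \<Longrightarrow> smooth_on S f"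
  unfolding smooth_on_def by (intro allI Ck_on_local) meson

lemma smooth_on_imp_continuous_on: "smooth_on S f \<Longrightarrow> continuous_on S f"
  unfolding smooth_on_def using Ck_on_imp_continuous_on by blast

lemma smooth_on_const: "open S \<Longrightarrow> smooth_on S (\<lambda>x. c)"
  unfolding smooth_on_def using Ck_on_const by blast

lemma smooth_on_id: "open S \<Longrightarrow> smooth_on S (\<lambda>x. x)"
  unfolding smooth_on_def using Ck_on_id by blast

lemma smooth_on_linear: "bounded_linear l \<Longrightarrow> open S \<Longrightarrow> smooth_on S l"
  unfolding smooth_on_def using Ck_on_linear by blast

lemma smooth_on_bounded_linear:
  "bounded_linear l \<Longrightarrow> open S \<Longrightarrow> smooth_on S f \<Longrightarrow> smooth_on S (\<lambda>x. l (f x))"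
  unfolding smooth_on_def using Ck_on_bounded_linear by blast

lemma smooth_on_add: "open S \<Longrightarrow> smooth_on S f \<Longrightarrow> smooth_on S g \<Longrightarrow> smooth_on S (\<lambda>x. f x + g x)"
  unfolding smooth_on_def using Ck_on_add by blast

lemma smooth_on_sum: "open S \<Longrightarrow> (\<And>i. i \<in> B \<Longrightarrow> smooth_on S (f i)) \<Longrightarrow> smooth_on S (\<lambda>x. \<Sum>i\<in>B. f i x)"
  unfolding smooth_on_def by (intro allI Ck_on_sum) auto

lemma smooth_on_bilinear:
  "bounded_bilinear p \<Longrightarrow> open S \<Longrightarrow> smooth_on S f \<Longrightarrow> smooth_on S g \<Longrightarrow> smooth_on S (\<lambda>x. p (f x) (g x))"
  unfolding smooth_on_def using Ck_on_bilinear by blast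

lemma smooth_on_Pair: "open S \<Longrightarrow> smooth_on S f \<Longrightarrow> smooth_on S g \<Longrightarrow> smooth_on S (\<lambda>x. (f x, g x))"
  unfolding smooth_on_def using Ck_on_Pair by blast

lemma smooth_on_compose:
  fixes f :: "'a::real_normed_vector \<Rightarrow> 'b::euclidean_space"
  shows "open S \<Longrightarrow> open T \<Longrightarrow> f ` S \<subseteq> T \<Longrightarrow> smooth_on S f \<Longrightarrow> smooth_on T g \<Longrightarrow> smooth_on S (\<lambda>x. g (f x))"
  unfolding smooth_on_def using Ck_on_compose by blast

lemma smooth_on_frechet: "smooth_on S f \<Longrightarrow> smooth_on S (\<lambda>x. frechet_derivative f (at x) v)"
  unfolding smooth_on_def by (metis Ck_on.simps(2))

lemma smooth_on_has_derivative:
  "smooth_on S f \<Longrightarrow> x \<in> S \<Longrightarrow> (f has_derivative frechet_derivative f (at x)) (at x)"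
  unfolding smooth_on_def using Ck_on_SucD by blast

lemma smooth_on_linear_frechet:
  "smooth_on S f \<Longrightarrow> x \<in> S \<Longrightarrow> linear (frechet_derivative f (at x))"
  using smooth_on_has_derivative has_derivative_linear by blast

lemma smooth_on_has_vector_derivative:
  assumes "smooth_on S f" "t \<in> S"
  shows "(f has_vector_derivative frechet_derivative f (at t) 1) (at t)"
proof -
  have "frechet_derivative f (at t) h = h *\<^sub>R frechet_derivative f (at t) 1" for h
    using linear_scale[OF smooth_on_linear_frechet[OF assms], of h 1] by simp
  then have "frechet_derivative f (at t) = (\<lambda>h. h *\<^sub>R frechet_derivative f (at t) 1)" by blast
  then show ?thesis using smooth_on_has_derivative[OF assms] by (simp add: has_vector_derivative_def)
qed

text \<open>The same basis expansion for an arbitrary smooth vector \<open>v x\<close>. It yields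
  smoothness of the constrained field \<open>Y\<close>, a derivative of \<open>F\<close> applied to
  the point-dependent vector \<open>X x\<close>.\<close>

lemma smooth_on_frechet_apply:
  fixes f :: "'a::real_normed_vector \<Rightarrow> 'b::euclidean_space"
  assumes S: "open S" and T: "open T" and ST: "f ` S \<subseteq> T" and f: "smooth_on S f" and g: "smooth_on T g"
    and v: "smooth_on S v"
  shows "smooth_on S (\<lambda>x. frechet_derivative g (at (f x)) (v x))"
proof (rule smooth_on_cong[OF S])
  show "smooth_on S (\<lambda>x. \<Sum>b\<in>Basis. (v x \<bullet> b) *\<^sub>R frechet_derivative g (at (f x)) b)"
    by (intro smooth_on_sum S smooth_on_bilinear[OF bounded_bilinear_scaleR]
      smooth_on_bounded_linear[OF bounded_linear_inner_left] v
      smooth_on_compose[OF S T ST f] smooth_on_frechet g)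
  show "(\<Sum>b\<in>Basis. (v x \<bullet> b) *\<^sub>R frechet_derivative g (at (f x)) b) = frechet_derivative g (at (f x)) (v x)"
    if "x \<in> S" for x
    by (rule linear_expand_Basis[symmetric], rule smooth_on_linear_frechet[OF g]) (use ST that in auto)
qed

section \<open>Strict differentiability, Lipschitz bounds and Taylor remainders\<close>

lemma linear_norm_le_Basis:
  fixes l :: "'a::euclidean_space \<Rightarrow> 'b::real_normed_vector"
  assumes "linear l" "\<And>b. b \<in> Basis \<Longrightarrow> norm (l b) \<le> e"
  shows "norm (l v) \<le> (real DIM('a) * e) * norm v"
proof -
  have "norm (l v) \<le> (\<Sum>b\<in>Basis. norm ((v \<bullet> b) *\<^sub>R l b))"
    unfolding linear_expand_Basis[OF assms(1), of v] by (rule norm_sum)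
  also have "\<dots> \<le> (\<Sum>b\<in>(Basis::'a set). norm v * e)"
    by (intro sum_mono) (auto intro!: mult_mono assms(2) Basis_le_norm)
  finally show ?thesis by (simp add: mult_ac)
qed

text \<open>Continuity of the derivative is known direction by direction; finitely many basis
  directions, each with tolerance \<open>e / DIM('a)\<close>, give it uniformly in
  \<open>v\<close>.\<close>

lemma smooth_on_frechet_close:
  fixes f :: "'a::euclidean_space \<Rightarrow> 'b::real_normed_vector"
  assumes S: "open S" and f: "smooth_on S f" and x: "x \<in> S" and e: "e > 0"
  obtains d where "d > 0" "ball x d \<subseteq> S"
    "\<And>y v. y \<in> ball x d \<Longrightarrow> norm (frechet_derivative f (at y) v - frechet_derivative f (at x) v) \<le> e * norm v"
proof -
  define e' where "e' = e / real DIM('a)"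
  have e': "e' > 0" using e by (simp add: e'_def)
  have "\<forall>\<^sub>F y in nhds x. norm (frechet_derivative f (at y) b - frechet_derivative f (at x) b) < e'" for b
  proof -
    have "isCont (\<lambda>y. frechet_derivative f (at y) b) x"
      using smooth_on_imp_continuous_on[OF smooth_on_frechet[OF f]] S x continuous_on_eq_continuous_at by blast
    then have "((\<lambda>y. frechet_derivative f (at y) b) \<longlongrightarrow> frechet_derivative f (at x) b) (nhds x)"
      unfolding isCont_def by (rule tendsto_at_iff_tendsto_nhds[THEN iffD1])
    then show ?thesis using e' unfolding tendsto_iff dist_norm by blast
  qed
  then have "\<forall>\<^sub>F y in nhds x. \<forall>b\<in>(Basis::'a set). norm (frechet_derivative f (at y) b - frechet_derivative f (at x) b) < e'"
    by (simp add: eventually_ball_finite_distrib)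
  then have "\<forall>\<^sub>F y in nhds x. y \<in> S \<and> (\<forall>b\<in>(Basis::'a set). norm (frechet_derivative f (at y) b - frechet_derivative f (at x) b) < e')"
    using eventually_nhds_in_open[OF S x] eventually_conj by blast
  then obtain d where d: "d > 0"
    "\<And>y. y \<in> ball x d \<Longrightarrow> y \<in> S \<and> (\<forall>b\<in>(Basis::'a set). norm (frechet_derivative f (at y) b - frechet_derivative f (at x) b) < e')"
    unfolding eventually_nhds_metric by (metis dist_commute mem_ball)
  show thesis
  proof (rule that[OF d(1)])
    show "ball x d \<subseteq> S" using d by blast
    fix y v assume y: "y \<in> ball x d"
    have "norm (frechet_derivative f (at y) v - frechet_derivative f (at x) v) \<le> (real DIM('a) * e') * norm v"
      by (rule linear_norm_le_Basis[where l="\<lambda>v. frechet_derivative f (at y) v - frechet_derivative f (at x) v"])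
        (use d(2)[OF y] linear_compose_sub smooth_on_linear_frechet[OF f] x in \<open>auto intro: less_imp_le\<close>)
    then show "norm (frechet_derivative f (at y) v - frechet_derivative f (at x) v) \<le> e * norm v"
      by (simp add: e'_def)
  qed
qed

text \<open>Mean value inequality for \<open>f\<close> minus its linearisation at the centre. Both
  points may vary, as contraction estimates demand.\<close>

lemma smooth_on_strict_derivative:
  fixes f :: "'a::euclidean_space \<Rightarrow> 'b::real_normed_vector"
  assumes S: "open S" and f: "smooth_on S f" and x: "x \<in> S" and e: "e > 0"
  obtains d where "d > 0" "ball x d \<subseteq> S"
    "\<And>y z. y \<in> ball x d \<Longrightarrow> z \<in> ball x d \<Longrightarrow>
      norm (f y - f z - frechet_derivative f (at x) (y - z)) \<le> e * norm (y - z)"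
proof -
  obtain d where d: "d > 0" "ball x d \<subseteq> S"
    "\<And>y v. y \<in> ball x d \<Longrightarrow> norm (frechet_derivative f (at y) v - frechet_derivative f (at x) v) \<le> e * norm v"
    using smooth_on_frechet_close[OF S f x e] by blast
  have lx: "bounded_linear (frechet_derivative f (at x))"
    using smooth_on_has_derivative[OF f x] has_derivative_bounded_linear by blast
  show thesis
  proof (rule that[OF d(1,2)])
    fix y z assume y: "y \<in> ball x d" and z: "z \<in> ball x d"
    have "norm ((f y - frechet_derivative f (at x) y) - (f z - frechet_derivative f (at x) z)) \<le> e * norm (y - z)"
    proof (rule differentiable_bound[OF convex_ball _ _ y z])
      fix w assume w: "w \<in> ball x d"
      then have "w \<in> S" using d by blast
      then show "((\<lambda>w. f w - frechet_derivative f (at x) w) has_derivative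
          (\<lambda>v. frechet_derivative f (at w) v - frechet_derivative f (at x) v)) (at w within ball x d)"
        by (intro has_derivative_diff has_derivative_at_withinI[OF smooth_on_has_derivative[OF f]]
            bounded_linear_imp_has_derivative lx)
      show "onorm (\<lambda>v. frechet_derivative f (at w) v - frechet_derivative f (at x) v) \<le> e"
        by (rule onorm_le[OF d(3)[OF w]])
    qed
    then show "norm (f y - f z - frechet_derivative f (at x) (y - z)) \<le> e * norm (y - z)"
      by (simp add: linear_diff[OF bounded_linear.linear[OF lx]] algebra_simps)
  qed
qed

lemma smooth_on_locally_lipschitz:
  fixes f :: "'a::euclidean_space \<Rightarrow> 'b::real_normed_vector"
  assumes S: "open S" and f: "smooth_on S f" and x: "x \<in> S"
  obtains d K where "d > 0" "K > 0" "ball x d \<subseteq> S"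
    "\<And>y z. y \<in> ball x d \<Longrightarrow> z \<in> ball x d \<Longrightarrow> norm (f y - f z) \<le> K * norm (y - z)"
proof -
  obtain d where d: "d > 0" "ball x d \<subseteq> S"
    "\<And>y z. y \<in> ball x d \<Longrightarrow> z \<in> ball x d \<Longrightarrow>
      norm (f y - f z - frechet_derivative f (at x) (y - z)) \<le> 1 * norm (y - z)"
    using smooth_on_strict_derivative[OF S f x, of 1] by (metis zero_less_one)
  have lx: "bounded_linear (frechet_derivative f (at x))"
    using smooth_on_has_derivative[OF f x] has_derivative_bounded_linear by blast
  then obtain K where K: "K > 0" "\<And>v. norm (frechet_derivative f (at x) v) \<le> norm v * K"
    using bounded_linear.pos_bounded by blast
  show thesis
  proof (rule that[OF d(1) _ d(2), of "K + 1"])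
    fix y z assume "y \<in> ball x d" and "z \<in> ball x d"
    then show "norm (f y - f z) \<le> (K + 1) * norm (y - z)"
      using d(3)[of y z] K(2)[of "y - z"]
        norm_triangle_sub[of "f y - f z" "frechet_derivative f (at x) (y - z)"]
      by (simp add: algebra_simps)
  qed (use K in simp)
qed

text \<open>The derivative is Lipschitz because each of its basis components is. On the part of the
  ball within \<open>norm (y - z)\<close> of \<open>z\<close> it differs from its value at
  \<open>z\<close> by at most a multiple of that distance, and the mean value inequality turns this
  into the quadratic remainder.\<close>

lemma smooth_on_taylor:
  fixes f :: "'a::euclidean_space \<Rightarrow> 'b::real_normed_vector"
  assumes S: "open S" and f: "smooth_on S f" and x: "x \<in> S"
  obtains d K where "d > 0" "K > 0" "ball x d \<subseteq> S"
    "\<And>y z. y \<in> ball x d \<Longrightarrow> z \<in> ball x d \<Longrightarrow>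
      norm (f y - f z - frechet_derivative f (at z) (y - z)) \<le> K * (norm (y - z))\<^sup>2"
    "\<And>y z v. y \<in> ball x d \<Longrightarrow> z \<in> ball x d \<Longrightarrow>
      norm (frechet_derivative f (at y) v - frechet_derivative f (at z) v) \<le> K * norm (y - z) * norm v"
proof -
  have "\<exists>d K. d > 0 \<and> K > 0 \<and> ball x d \<subseteq> S \<and> (\<forall>y\<in>ball x d. \<forall>z\<in>ball x d.
      norm (frechet_derivative f (at y) b - frechet_derivative f (at z) b) \<le> K * norm (y - z))" for b
    using smooth_on_locally_lipschitz[OF S smooth_on_frechet[OF f, of b] x] by metis
  then obtain d K where dK: "\<And>b. d b > (0::real)" "\<And>b. K b > (0::real)" "\<And>b. ball x (d b) \<subseteq> S"
    "\<And>b y z. y \<in> ball x (d b) \<Longrightarrow> z \<in> ball x (d b) \<Longrightarrow>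
      norm (frechet_derivative f (at y) b - frechet_derivative f (at z) b) \<le> K b * norm (y - z)"
    by metis
  define d0 where "d0 = Min (d ` Basis)"
  define K0 where "K0 = (\<Sum>b\<in>Basis. K b)"
  have d0: "d0 > 0" using dK by (simp add: d0_def)
  have d0b: "d0 \<le> d b" if "b \<in> Basis" for b using that by (simp add: d0_def)
  have K0b: "K b \<le> K0" if "b \<in> Basis" for b
    unfolding K0_def by (rule member_le_sum[OF that]) (use dK in \<open>auto intro: less_imp_le\<close>)
  have K0: "K0 > 0" unfolding K0_def by (rule sum_pos) (use dK in auto)
  let ?K = "real DIM('a) * K0"
  have K: "?K > 0" using K0 by simp
  have sub: "ball x d0 \<subseteq> S"
    using dK(3) d0b nonempty_Basis by (meson ex_in_conv order_trans subset_ball)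
  have lip: "norm (frechet_derivative f (at y) v - frechet_derivative f (at z) v) \<le> ?K * norm (y - z) * norm v"
    if y: "y \<in> ball x d0" and z: "z \<in> ball x d0" for y z v
  proof -
    have "norm (frechet_derivative f (at y) v - frechet_derivative f (at z) v)
        \<le> (real DIM('a) * (K0 * norm (y - z))) * norm v"
    proof (rule linear_norm_le_Basis[where l="\<lambda>v. frechet_derivative f (at y) v - frechet_derivative f (at z) v"])
      show "linear (\<lambda>v. frechet_derivative f (at y) v - frechet_derivative f (at z) v)"
        using linear_compose_sub smooth_on_linear_frechet[OF f] sub y z by blast
      fix b :: 'a assume b: "b \<in> Basis"
      have "norm (frechet_derivative f (at y) b - frechet_derivative f (at z) b) \<le> K b * norm (y - z)"
        using dK(4) y z d0b[OF b] by auto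
      also have "\<dots> \<le> K0 * norm (y - z)" using K0b[OF b] by (simp add: mult_right_mono)
      finally show "norm (frechet_derivative f (at y) b - frechet_derivative f (at z) b) \<le> K0 * norm (y - z)" .
    qed
    then show ?thesis by (simp add: mult_ac)
  qed
  show thesis
  proof (rule that[OF d0 K sub _ lip])
    fix y z assume y: "y \<in> ball x d0" and z: "z \<in> ball x d0"
    have lz: "bounded_linear (frechet_derivative f (at z))"
      using smooth_on_has_derivative[OF f] has_derivative_bounded_linear sub z by blast
    define C where "C = ball x d0 \<inter> cball z (norm (y - z))"
    have "norm ((f y - frechet_derivative f (at z) y) - (f z - frechet_derivative f (at z) z))
        \<le> (?K * norm (y - z)) * norm (y - z)"
    proof (rule differentiable_bound[of C])
      show "convex C" unfolding C_def by (intro convex_Int convex_ball convex_cball)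
      fix w assume w: "w \<in> C"
      then have wS: "w \<in> S" using sub by (auto simp: C_def)
      then show "((\<lambda>w. f w - frechet_derivative f (at z) w) has_derivative
          (\<lambda>v. frechet_derivative f (at w) v - frechet_derivative f (at z) v)) (at w within C)"
        by (intro has_derivative_diff has_derivative_at_withinI[OF smooth_on_has_derivative[OF f]]
            bounded_linear_imp_has_derivative lz)
      show "onorm (\<lambda>v. frechet_derivative f (at w) v - frechet_derivative f (at z) v) \<le> ?K * norm (y - z)"
      proof (rule onorm_le)
        fix v :: 'a
        have "norm (w - z) \<le> norm (y - z)" using w by (simp add: C_def dist_norm norm_minus_commute)
        then have "?K * norm (w - z) * norm v \<le> ?K * norm (y - z) * norm v"
          using K by (intro mult_right_mono mult_left_mono) auto
        then show "norm (frechet_derivative f (at w) v - frechet_derivative f (at z) v) \<le> ?K * norm (y - z) * norm v"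
          using order_trans[OF lip[of w z v]] w z by (simp add: C_def)
      qed
    qed (use y z in \<open>auto simp: C_def dist_norm norm_minus_commute\<close>)
    then show "norm (f y - f z - frechet_derivative f (at z) (y - z)) \<le> ?K * (norm (y - z))\<^sup>2"
      by (simp add: linear_diff[OF bounded_linear.linear[OF lz]] algebra_simps power2_eq_square)
  qed
qed

section \<open>One step in coordinates\<close>

text \<open>\<open>Q\<close> is the component orthogonal to \<open>E\<close>. It turns membership in
  \<open>E\<close> into the linear equation \<open>Q x = 0\<close>, which can be differentiated and
  solved.\<close>

lemma subspace_projection:
  fixes E :: "'e::euclidean_space set"
  assumes E: "subspace E"
  obtains Q :: "'e \<Rightarrow> 'e" where "bounded_linear Q" "\<And>x. Q x = 0 \<longleftrightarrow> x \<in> E" "\<And>x. x - Q x \<in> E"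
    "\<And>x y. y \<in> E \<Longrightarrow> orthogonal y (Q x)"
proof -
  obtain B where B: "B \<subseteq> E" "pairwise orthogonal B" "\<And>x. x \<in> B \<Longrightarrow> norm x = 1"
    "independent B" "card B = dim E" "span B = E"
    using orthonormal_basis_subspace[OF E] by metis
  have fB: "finite B" using B independent_imp_finite by blast
  define Q where "Q x = x - (\<Sum>b\<in>B. (x \<bullet> b) *\<^sub>R b)" for x
  have lin: "linear Q" unfolding Q_def
    by (intro linear_compose_sub linear_id[unfolded id_def] linear_compose_sum ballI)
       (auto intro!: linearI simp: inner_left_distrib scaleR_left_distrib)
  have in_E: "x - Q x \<in> E" for x
    using B E by (auto simp: Q_def intro!: subspace_sum subspace_scale)
  have "b \<bullet> Q x = 0" if b: "b \<in> B" for b x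
  proof -
    have "(\<Sum>c\<in>B. (x \<bullet> c) * (b \<bullet> c)) = (\<Sum>c\<in>B. if c = b then x \<bullet> b else 0)"
      by (rule sum.cong) (use B b in \<open>auto simp: pairwise_def orthogonal_def dot_square_norm\<close>)
    then show ?thesis using b fB
      by (simp add: Q_def inner_diff_right inner_sum_right inner_commute)
  qed
  then have orth: "orthogonal y (Q x)" if "y \<in> E" for x y
    using orthogonal_to_span[of y B "Q x"] that B by (auto simp: orthogonal_def inner_commute)
  have "Q x = 0" if "x \<in> E" for x
  proof -
    have "Q x \<in> E" using subspace_diff[OF E that in_E[of x]] by simp
    then show ?thesis using orth[of "Q x" x] by (simp add: orthogonal_self)
  qed
  then have "Q x = 0 \<longleftrightarrow> x \<in> E" for x using in_E[of x] by auto
  then show thesis using that[of Q] linear_conv_bounded_linear lin in_E orth by blast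
qed

text \<open>The map \<open>k - G k\<close> is a simplified Newton iteration for a \<open>G\<close>
  whose linearisation has been normalised to the identity. It preserves the part of \<open>S\<close>
  within radius \<open>2 * norm (G 0)\<close>, so the residual at 0 bounds the size of the
  solution.\<close>

lemma contraction_zero:
  fixes G :: "'e::euclidean_space \<Rightarrow> 'e"
  assumes S: "subspace S" and GS: "\<And>k. k \<in> S \<Longrightarrow> G k \<in> S" and r: "norm (G 0) \<le> r / 2"
    and G: "\<And>k k'. k \<in> S \<Longrightarrow> k' \<in> S \<Longrightarrow> norm k \<le> r \<Longrightarrow> norm k' \<le> r \<Longrightarrow>
      norm (k - k' - (G k - G k')) \<le> norm (k - k') / 2"
  obtains k where "k \<in> S" "G k = 0" "norm k \<le> 2 * norm (G 0)" "norm k \<le> r"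
proof -
  define \<rho> where "\<rho> = 2 * norm (G 0)"
  have \<rho>: "0 \<le> \<rho>" "\<rho> \<le> r" using r by (auto simp: \<rho>_def)
  let ?S = "S \<inter> cball 0 \<rho>"
  have "\<exists>!k\<in>?S. k - G k = k"
  proof (rule Banach_fix[of _ "1/2"])
    show "complete ?S" using closed_subspace[OF S] by (simp add: complete_eq_closed closed_Int)
    show "?S \<noteq> {}" using \<rho> subspace_0[OF S] by auto
    show "(\<lambda>k. k - G k) ` ?S \<subseteq> ?S"
    proof clarify
      fix k assume k: "k \<in> S" "k \<in> cball 0 \<rho>"
      have "norm (k - G k) \<le> norm (k - 0 - (G k - G 0)) + norm (G 0)"
        using norm_triangle_ineq4[of "k - 0 - (G k - G 0)" "G 0"] by (simp add: algebra_simps)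
      also have "\<dots> \<le> norm (k - 0) / 2 + norm (G 0)"
        using G[of k 0] k \<rho> subspace_0[OF S] by auto
      also have "\<dots> \<le> \<rho>" using k by (simp add: \<rho>_def)
      finally show "k - G k \<in> ?S" using k GS subspace_diff[OF S] by auto
    qed
    show "dist (k - G k) (k' - G k') \<le> 1/2 * dist k k'" if "k \<in> ?S" "k' \<in> ?S" for k k'
      using G[of k k'] that \<rho> by (simp add: dist_norm algebra_simps)
  qed auto
  then obtain k where k: "k \<in> S" "norm k \<le> \<rho>" "G k = 0" by auto
  then show thesis using that[of k] \<rho> by (simp add: \<rho>_def)
qed

lemma bounded_linear_normE:
  assumes "bounded_linear l"
  obtains K where "K > 0" "\<And>v. norm (l v) \<le> K * norm v"
  using bounded_linear.pos_bounded[OF assms] by (metis mult.commute)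

text \<open>On the line through \<open>x\<close> in direction \<open>u\<close> the component of
  \<open>f\<close> orthogonal to \<open>E\<close> vanishes near \<open>x\<close>, hence so does its
  derivative.\<close>

lemma derivative_in_subspace:
  fixes f :: "'a::real_normed_vector \<Rightarrow> 'e::euclidean_space"
  assumes E: "subspace E" and f: "(f has_derivative f') (at x)" and U: "open U" "x \<in> U"
    and S: "subspace S" "x \<in> S" and fE: "\<And>y. y \<in> S \<inter> U \<Longrightarrow> f y \<in> E" and u: "u \<in> S"
  shows "f' u \<in> E"
proof -
  obtain Q :: "'e \<Rightarrow> 'e" where Q: "bounded_linear Q" "\<And>x. Q x = 0 \<longleftrightarrow> x \<in> E"
    using subspace_projection[OF E] by metis
  have "((\<lambda>t. x + t *\<^sub>R u) has_derivative (\<lambda>t. t *\<^sub>R u)) (at (0::real))"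
    by (auto intro!: derivative_eq_intros)
  from has_derivative_compose[OF this, of f f'] f
  have "((\<lambda>t. f (x + t *\<^sub>R u)) has_derivative (\<lambda>t. f' (t *\<^sub>R u))) (at (0::real))" by simp
  from bounded_linear.has_derivative[OF Q(1) this]
  have 1: "((\<lambda>t. Q (f (x + t *\<^sub>R u))) has_derivative (\<lambda>t. Q (f' (t *\<^sub>R u)))) (at (0::real))" .
  have "open ((\<lambda>t. x + t *\<^sub>R u) -` U)" by (intro open_vimage U continuous_intros)
  moreover have "Q (f (x + t *\<^sub>R u)) = 0" if "t \<in> (\<lambda>t. x + t *\<^sub>R u) -` U" for t
    using that fE[of "x + t *\<^sub>R u"] Q(2) subspace_add[OF S] subspace_scale[OF S(1) u] by auto
  ultimately have "((\<lambda>t. 0) has_derivative (\<lambda>t. Q (f' (t *\<^sub>R u)))) (at (0::real))"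
    using has_derivative_transform_within_open[OF 1] U by (metis (no_types, lifting) add.right_neutral scaleR_zero_left vimage_eq)
  then have "(\<lambda>t. Q (f' (t *\<^sub>R u))) = (\<lambda>t. 0)" for t :: real
    by (rule has_derivative_unique) (rule has_derivative_const)
  from fun_cong[OF this, of 1] show ?thesis using Q by simp
qed

lemma norm_Pair_le: "norm (a, b) \<le> norm a + norm b"
  by (simp add: norm_Pair sqrt_sum_squares_le_sum)

text \<open>The situation in a slice chart of the constraint manifold at a point \<open>x0\<close> of the hidden
  constraint set \<open>MH\<close>: \<open>E\<close> is the constraint manifold, \<open>D\<close> the kernel of the pulled-back form at \<open>x0\<close>,
  \<open>\<phi>\<close> the method, \<open>X\<close> the Hamiltonian vector field, \<open>F\<close> the projection to \<open>MH\<close> along the fibres,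
  and \<open>Y\<close> on \<open>MH\<close> the constrained vector field.\<close>

locale constrained_step =
  fixes E D MH U :: "'e::euclidean_space set" and Om :: "(real \<times> 'e) set"
    and \<phi> :: "real \<times> 'e \<Rightarrow> 'e" and F Q :: "'e \<Rightarrow> 'e" and x0 :: 'e
    and V :: "real \<times> 'e \<Rightarrow> 'e" and X Y :: "'e \<Rightarrow> 'e"
  defines "V \<equiv> \<lambda>p. frechet_derivative \<phi> (at p) (1, 0)"
    and "X \<equiv> \<lambda>x. V (0, x)"
    and "Y \<equiv> \<lambda>x. frechet_derivative F (at x) (X x)"
  assumes E: "subspace E" and D: "subspace D" and DE: "D \<subseteq> E" and dim: "dim D + dim E = DIM('e)"
    and Q: "bounded_linear Q" and Q0: "\<And>x. Q x = 0 \<longleftrightarrow> x \<in> E" and QE: "\<And>x. x - Q x \<in> E"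
    and Q_orth: "\<And>x y. y \<in> E \<Longrightarrow> orthogonal y (Q x)"
    and Om: "open Om" and \<phi>: "smooth_on Om \<phi>" and \<phi>0: "\<And>x. (0, x) \<in> Om \<Longrightarrow> \<phi> (0, x) = x"
    and U: "open U" and UOm: "\<And>x. x \<in> U \<Longrightarrow> (0, x) \<in> Om" and F: "smooth_on U F"
    and x0U: "x0 \<in> U" and x0MH: "x0 \<in> MH"
    and MHE: "MH \<subseteq> E" and F_MH: "\<And>x. x \<in> E \<inter> U \<Longrightarrow> F x \<in> MH"
    and F_id: "\<And>x. x \<in> MH \<inter> U \<Longrightarrow> F x = x" and MH: "\<And>x. x \<in> E \<inter> U \<Longrightarrow> x \<in> MH \<longleftrightarrow> X x \<in> E"
    and F_kernel: "\<And>u. u \<in> D \<Longrightarrow> frechet_derivative F (at x0) u = 0"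
    and nondegenerate: "\<And>u. u \<in> D \<Longrightarrow> frechet_derivative X (at x0) u \<in> E \<Longrightarrow> u = 0"
begin

section \<open>Linearisation of the projection and of the field at the base point\<close>

abbreviation "L \<equiv> frechet_derivative F (at x0)"
abbreviation "DX \<equiv> frechet_derivative X (at x0)"

lemma x0E: "x0 \<in> E" using x0MH MHE by blast

lemma V_smooth: "smooth_on Om V"
  unfolding V_def by (rule smooth_on_frechet[OF \<phi>])

lemma X_smooth: "smooth_on U X"
  unfolding X_def
  by (rule smooth_on_compose[OF U Om _ _ V_smooth])
    (auto simp: UOm intro!: smooth_on_Pair U smooth_on_const smooth_on_id)

lemma Y_smooth: "smooth_on U Y"
  unfolding Y_def by (rule smooth_on_frechet_apply[OF U U _ smooth_on_id[OF U] F X_smooth]) simp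

lemma bounded_linear_L: "bounded_linear L"
  using smooth_on_has_derivative[OF F x0U] has_derivative_bounded_linear by blast

lemma bounded_linear_DX: "bounded_linear DX"
  using smooth_on_has_derivative[OF X_smooth x0U] has_derivative_bounded_linear by blast

lemmas linear_simps' =
  linear_diff[OF bounded_linear.linear[OF Q]] linear_add[OF bounded_linear.linear[OF Q]] linear_scale[OF bounded_linear.linear[OF Q]] linear_0[OF bounded_linear.linear[OF Q]]
  linear_diff[OF bounded_linear.linear[OF bounded_linear_L]] linear_add[OF bounded_linear.linear[OF bounded_linear_L]] linear_scale[OF bounded_linear.linear[OF bounded_linear_L]] linear_0[OF bounded_linear.linear[OF bounded_linear_L]]
  linear_diff[OF bounded_linear.linear[OF bounded_linear_DX]] linear_add[OF bounded_linear.linear[OF bounded_linear_DX]] linear_scale[OF bounded_linear.linear[OF bounded_linear_DX]] linear_0[OF bounded_linear.linear[OF bounded_linear_DX]]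

lemma Q_idem: "Q (Q x) = Q x"
  using Q0[of "x - Q x"] QE[of x] by (simp add: linear_simps')

lemma L_E: "u \<in> E \<Longrightarrow> L u \<in> E"
  by (rule derivative_in_subspace[OF E smooth_on_has_derivative[OF F x0U] U x0U E x0E])
    (use F_MH MHE in auto)

lemma X_E: "x \<in> MH \<inter> U \<Longrightarrow> X x \<in> E"
  using MH MHE by blast

text \<open>Nondegeneracy makes the map injective on \<open>D\<close>, so its image has dimension
  \<open>dim D\<close>, the codimension of \<open>E\<close>. This is at least the dimension of
  \<open>range Q\<close>, which is orthogonal to \<open>E\<close>. Thus the fibre directions reach
  every normal direction.\<close>

lemma Q_DX_range: "(\<lambda>u. Q (DX u)) ` D = range Q"
proof -
  let ?B = "\<lambda>u. Q (DX u)"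
  have lin: "linear ?B"
    using bounded_linear_compose[OF Q bounded_linear_DX] bounded_linear.linear by blast
  have "inj_on ?B D"
    by (rule linear_injective_on_subspace_0[OF lin D, THEN iffD2]) (use nondegenerate Q0 in blast)
  then have "dim (?B ` D) = dim D"
    by (intro dim_image_eq lin) (simp add: span_eq_iff[THEN iffD2, OF D])
  moreover have "dim {y \<in> UNIV. \<forall>x\<in>E. orthogonal x y} + dim E = dim (UNIV :: 'e set)"
    by (rule dim_subspace_orthogonal_to_vectors[OF E]) auto
  moreover have "dim (range Q) \<le> dim {y \<in> UNIV. \<forall>x\<in>E. orthogonal x y}"
    using Q_orth by (intro dim_subset) auto
  ultimately have "dim (range Q) \<le> dim (?B ` D)" using dim by simp
  moreover have "subspace (range Q)" "subspace (?B ` D)"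
    using linear_subspace_image[OF lin D] linear_subspace_image[OF bounded_linear.linear[OF Q] subspace_UNIV] by auto
  ultimately show ?thesis by (intro subspace_dim_equal) auto
qed

text \<open>A point of \<open>x0 + t u + D\<close> in \<open>MH\<close> is found at distance \<open>o(t)\<close> from \<open>x0 + t u\<close>; it is fixed
  by \<open>F\<close>.\<close>

lemma L_fixes:
  assumes uE: "u \<in> E" and Xu: "DX u \<in> E"
  shows "L u = u"
proof (cases "u = 0")
  case False
  let ?B = "\<lambda>u. Q (DX u)"
  have linB: "linear ?B"
    using bounded_linear_compose[OF Q bounded_linear_DX] bounded_linear.linear by blast
  have "inj_on ?B D"
    by (rule linear_injective_on_subspace_0[OF linB D, THEN iffD2]) (use nondegenerate Q0 in blast)
  \<comment> \<open>\<open>R\<close> inverts the normal part of \<open>DX\<close> along the fibre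
    directions, so that solving \<open>R (Q (X y)) = 0\<close> by contraction in \<open>D\<close>
    puts \<open>y\<close> into \<open>MH\<close>.\<close>
  then obtain R where R: "range R \<subseteq> D" "linear R" "\<And>v. v \<in> D \<Longrightarrow> R (?B v) = v"
    using linear_exists_left_inverse_on[OF linB D] by blast
  obtain K where K: "K > 0" "\<And>v. norm (R v) \<le> K * norm v"
    using bounded_linear_normE R(2) linear_conv_bounded_linear by blast
  obtain KQ where KQ: "KQ > 0" "\<And>v. norm (Q v) \<le> KQ * norm v"
    using bounded_linear_normE[OF Q] by blast
  have R_inj: "w = 0" if "w \<in> range Q" "R w = 0" for w
  proof -
    obtain v where v: "v \<in> D" "w = ?B v" using \<open>w \<in> range Q\<close> Q_DX_range by blast
    then have "v = 0" using R(3)[OF v(1)] \<open>R w = 0\<close> by simp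
    then show ?thesis using v by (simp add: linear_simps')
  qed
  have key: "norm (u - L u) \<le> (2 + 3 * norm u) * e" if e: "0 < e" "e \<le> 1" "2 * e \<le> norm u" for e
  proof -
    \<comment> \<open>Of the two entries of the minimum, the first makes the map a contraction with
      factor 1/2, the second makes the correction \<open>k\<close> at most
      \<open>t * e\<close>.\<close>
    define e1 where "e1 = min (1/2) (e / (2 * norm u)) / (K * KQ)"
    have e1: "e1 > 0" using e K KQ False by (simp add: e1_def)
    have e1': "K * (KQ * e1) \<le> 1/2" "2 * (K * (KQ * e1) * norm u) \<le> e"
      using K KQ False e by (auto simp: e1_def min_def field_simps)
    obtain d1 where d1: "d1 > 0" "ball x0 d1 \<subseteq> U" "\<And>y z. y \<in> ball x0 d1 \<Longrightarrow> z \<in> ball x0 d1 \<Longrightarrow>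
      norm (X y - X z - DX (y - z)) \<le> e1 * norm (y - z)"
      using smooth_on_strict_derivative[OF U X_smooth x0U e1] by blast
    obtain d2 where d2: "d2 > 0" "ball x0 d2 \<subseteq> U" "\<And>y z. y \<in> ball x0 d2 \<Longrightarrow> z \<in> ball x0 d2 \<Longrightarrow>
      norm (F y - F z - L (y - z)) \<le> e * norm (y - z)"
      using smooth_on_strict_derivative[OF U F x0U e(1)] by blast
    define d where "d = min d1 d2"
    have d: "d > 0" using d1 d2 by (simp add: d_def)
    have R_est: "norm (R (Q (X y)) - R (Q (X z)) - R (?B (y - z))) \<le> K * (KQ * (e1 * norm (y - z)))"
      if "y \<in> ball x0 d" "z \<in> ball x0 d" for y z
    proof -
      have "norm (R (Q (X y - X z - DX (y - z)))) \<le> K * (KQ * norm (X y - X z - DX (y - z)))"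
        using K KQ by (meson mult_left_mono order_trans less_imp_le)
      also have "\<dots> \<le> K * (KQ * (e1 * norm (y - z)))"
        using d1(3)[of y z] that K KQ by (simp add: d_def)
      finally show ?thesis by (simp add: linear_simps' linear_diff[OF R(2)])
    qed
    \<comment> \<open>The displacement \<open>t *\<^sub>R u\<close> then has norm
      \<open>d / 4\<close>; with a correction of at most \<open>d / 2\<close> the point stays in the
      ball.\<close>
    define t where "t = d / (4 * norm u)"
    have t: "t > 0" "norm (t *\<^sub>R u) = d / 4" using d False by (auto simp: t_def)
    define G where "G k = R (Q (X (x0 + t *\<^sub>R u + k)))" for k
    have bd: "x0 + t *\<^sub>R u + k \<in> ball x0 d" if "norm k \<le> d / 2" for k
    proof -
      have "norm (x0 - (x0 + t *\<^sub>R u + k)) = norm (t *\<^sub>R u + k)"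
        by (metis add.assoc add_diff_cancel_left' norm_minus_commute)
      then show ?thesis using that t(2) d norm_triangle_ineq[of "t *\<^sub>R u" k] by (simp add: dist_norm)
    qed
    have "R (Q (X x0)) = 0" using X_E x0MH x0U Q0 linear_0[OF R(2)] by (metis IntI)
    moreover have "R (?B (t *\<^sub>R u)) = 0" using Xu Q0[of "DX u"] linear_0[OF R(2)] by (simp add: linear_simps')
    ultimately have G0: "norm (G 0) \<le> K * (KQ * (e1 * norm (t *\<^sub>R u)))"
      using R_est[of "x0 + t *\<^sub>R u" x0] bd[of 0] d by (simp add: G_def)
    also have "\<dots> = (K * (KQ * e1)) * (d / 4)" using t(2) by simp
    also have "\<dots> \<le> 1/2 * (d / 4)" using e1' d by (intro mult_right_mono) auto
    finally have G0': "norm (G 0) \<le> d / 2 / 2" using d by simp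
    obtain k where k: "k \<in> D" "G k = 0" "norm k \<le> 2 * norm (G 0)" "norm k \<le> d / 2"
    proof (rule contraction_zero[where S = D and G = G and r = "d / 2", OF D _ G0'])
      show "G k \<in> D" for k using R(1) by (auto simp: G_def)
      fix k k' assume k: "k \<in> D" "k' \<in> D" "norm k \<le> d / 2" "norm k' \<le> d / 2"
      have "norm (G k - G k' - R (?B (k - k'))) \<le> K * (KQ * (e1 * norm (k - k')))"
        using R_est[OF bd[OF k(3)] bd[OF k(4)]] by (simp add: G_def)
      also have "\<dots> = (K * (KQ * e1)) * norm (k - k')" by simp
      also have "\<dots> \<le> 1/2 * norm (k - k')" using e1' by (intro mult_right_mono) auto
      finally show "norm (k - k' - (G k - G k')) \<le> norm (k - k') / 2"
        using R(3)[of "k - k'"] subspace_diff[OF D] k by (simp add: norm_minus_commute)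
    qed
    define y where "y = x0 + t *\<^sub>R u + k"
    have yb: "y \<in> ball x0 d" using bd k by (simp add: y_def)
    then have yU: "y \<in> U" using d1 by (auto simp: d_def)
    have yE: "y \<in> E" using x0E uE k DE E by (auto simp: y_def intro!: subspace_add subspace_scale)
    have "Q (X y) = 0" using R_inj k(2) by (auto simp: G_def y_def)
    then have "y \<in> MH" using MH Q0 yE yU by blast
    then have "F y = y" using F_id yU by blast
    moreover have "F x0 = x0" using F_id x0U x0MH by blast
    \<comment> \<open>The correction \<open>k\<close> lies in \<open>D\<close>, which
      \<open>L\<close> annihilates; only the displacement along \<open>u\<close> is seen.\<close>
    moreover have "L (y - x0) = t *\<^sub>R L u" using F_kernel[OF k(1)] by (simp add: y_def linear_simps' algebra_simps)
    ultimately have 1: "norm (t *\<^sub>R u + k - t *\<^sub>R L u) \<le> e * norm (t *\<^sub>R u + k)"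
      using d2(3)[of y x0] yb d by (simp add: d_def y_def algebra_simps)
    have nk: "norm k \<le> t * e"
    proof -
      have "norm k \<le> 2 * (K * (KQ * (e1 * (t * norm u))))" using k(3) G0 t by simp
      also have "\<dots> = t * (2 * (K * (KQ * e1) * norm u))" by simp
      also have "\<dots> \<le> t * e" using e1' t by (intro mult_left_mono) auto
      finally show ?thesis .
    qed
    have "t * norm (u - L u) = norm ((t *\<^sub>R u + k - t *\<^sub>R L u) - k)"
      using t by (simp flip: scaleR_diff_right)
    also have "\<dots> \<le> e * (norm (t *\<^sub>R u) + norm k) + norm k"
      using 1 norm_triangle_ineq4[of "t *\<^sub>R u + k - t *\<^sub>R L u" k]
        mult_left_mono[OF norm_triangle_ineq[of "t *\<^sub>R u" k], of e] e by linarith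
    also have "\<dots> \<le> e * (t * norm u + t * e) + t * e"
      using nk t e by (intro add_mono mult_left_mono) auto
    also have "\<dots> = t * (e * (norm u + e + 1))" by (simp add: algebra_simps)
    finally have "norm (u - L u) \<le> e * (norm u + e + 1)" using t by simp
    also have "\<dots> \<le> e * (2 + 3 * norm u)" using e by (intro mult_left_mono) auto
    finally show ?thesis by (simp add: mult.commute)
  qed
  have "norm (u - L u) \<le> 0"
  proof (rule field_le_epsilon)
    fix \<epsilon> :: real assume \<epsilon>: "0 < \<epsilon>"
    have c: "2 + 3 * norm u > 0" using norm_ge_zero[of u] by linarith
    define e where "e = min (min 1 (norm u / 2)) (\<epsilon> / (2 + 3 * norm u))"
    have "e \<le> norm u / 2" "e \<le> 1" unfolding e_def
      by (meson min.cobounded1 min.cobounded2 order_trans)+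
    moreover have "0 < e" using \<epsilon> False divide_pos_pos[OF \<epsilon> c] by (simp add: e_def)
    ultimately have "0 < e" "e \<le> 1" "2 * e \<le> norm u" by auto
    from key[OF this] have "norm (u - L u) \<le> (2 + 3 * norm u) * e" .
    also have "\<dots> \<le> (2 + 3 * norm u) * (\<epsilon> / (2 + 3 * norm u))" using c by (intro mult_left_mono) (auto simp: e_def)
    also have "\<dots> = \<epsilon>" using c by simp
    finally show "norm (u - L u) \<le> 0 + \<epsilon>" by simp
  qed
  then show ?thesis by simp
qed (simp add: linear_simps')

text \<open>\<open>F\<close> maps into \<open>MH\<close>, where \<open>X\<close> takes values in
  \<open>E\<close>. Differentiating the composition of \<open>X\<close> with \<open>F\<close> along
  \<open>E\<close> gives \<open>DX (L u) \<in> E\<close>, so \<open>L_fixes\<close> applies to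
  \<open>L u\<close>.\<close>

lemma L_idem:
  assumes u: "u \<in> E"
  shows "L (L u) = L u"
proof (rule L_fixes[OF L_E[OF u]])
  have Fx0: "F x0 = x0" using F_id x0U x0MH by blast
  have "isCont F x0" using smooth_on_has_derivative[OF F x0U] has_derivative_continuous by blast
  then obtain N where N: "open N" "x0 \<in> N" "F ` N \<subseteq> U"
    using U x0U Fx0 unfolding continuous_at_open by (metis image_subset_iff)
  have "((\<lambda>x. X (F x)) has_derivative (\<lambda>v. DX (L v))) (at x0)"
    using has_derivative_compose[OF smooth_on_has_derivative[OF F x0U], of X DX]
      smooth_on_has_derivative[OF X_smooth x0U] Fx0 by simp
  then show "DX (L u) \<in> E"
  proof (rule derivative_in_subspace[OF E _ _ _ E x0E _ u])
    show "open (N \<inter> U)" "x0 \<in> N \<inter> U" using N U x0U by auto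
    show "X (F y) \<in> E" if "y \<in> E \<inter> (N \<inter> U)" for y
      using that F_MH X_E N by blast
  qed
qed

section \<open>Uniform solvability of the step equations and the one-step error\<close>

lemma \<phi>_difference:
  assumes e: "e > 0"
  obtains d where "d > 0" "ball x0 d \<subseteq> U" "\<And>h y. 0 \<le> h \<Longrightarrow> h < d \<Longrightarrow> y \<in> ball x0 d \<Longrightarrow> (h, y) \<in> Om"
    "\<And>h y z. 0 \<le> h \<Longrightarrow> h < d \<Longrightarrow> y \<in> ball x0 d \<Longrightarrow> z \<in> ball x0 d \<Longrightarrow>
      norm (\<phi> (h, y) - \<phi> (h, z) - (y - z) - h *\<^sub>R DX (y - z)) \<le> e * h * norm (y - z)"
proof -
  let ?DV = "frechet_derivative V (at (0, x0))"
  obtain d where d: "d > 0" "ball (0, x0) d \<subseteq> Om"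
    "\<And>p q. p \<in> ball (0, x0) d \<Longrightarrow> q \<in> ball (0, x0) d \<Longrightarrow> norm (V p - V q - ?DV (p - q)) \<le> e * norm (p - q)"
    using smooth_on_strict_derivative[OF Om V_smooth UOm[OF x0U] e] by blast
  obtain d' where d': "d' > 0" "ball x0 d' \<subseteq> U" using U x0U openE by blast
  have DV: "?DV (0, v) = DX v" for v
  proof -
    have "((\<lambda>x. (0::real, x)) has_derivative (\<lambda>v. (0, v))) (at x0)"
      by (auto intro!: derivative_eq_intros)
    from has_derivative_compose[OF this smooth_on_has_derivative[OF V_smooth UOm[OF x0U]]]
    have "(X has_derivative (\<lambda>v. ?DV (0, v))) (at x0)" by (simp add: X_def)
    then show ?thesis using frechet_derivative_at by metis
  qed
  define d0 where "d0 = min (d / 2) d'"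
  have d0: "d0 > 0" using d d' by (simp add: d0_def)
  have in_ball: "(s, y) \<in> ball (0, x0) d" if "0 \<le> s" "s < d0" "y \<in> ball x0 d0" for s y
  proof -
    have "dist (0, x0) (s, y) \<le> \<bar>s\<bar> + dist x0 y"
      using norm_Pair_le[of "0 - s" "x0 - y"] by (simp add: dist_norm)
    then show ?thesis using that by (auto simp: d0_def)
  qed
  show thesis
  proof (rule that[OF d0])
    show "ball x0 d0 \<subseteq> U" using d' by (auto simp: d0_def)
    show "(h, y) \<in> Om" if "0 \<le> h" "h < d0" "y \<in> ball x0 d0" for h y using in_ball that d by blast
    fix h y z assume h: "0 \<le> h" "h < d0" and y: "y \<in> ball x0 d0" and z: "z \<in> ball x0 d0"
    \<comment> \<open>The mean value inequality is applied in the time variable, starting at 0 where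
      the method is the identity. This produces the factor h in the error, which compensates the
      division by h in \<open>solvable\<close>.\<close>
    define g where "g s = \<phi> (s, y) - \<phi> (s, z) - s *\<^sub>R DX (y - z)" for s
    have dV: "((\<lambda>s. \<phi> (s, w)) has_derivative (\<lambda>v. v *\<^sub>R V (s, w))) (at s)"
      if "0 \<le> s" "s < d0" "w \<in> ball x0 d0" for s w
    proof -
      have om: "(s, w) \<in> Om" using that in_ball d by blast
      have "((\<lambda>s. (s, w)) has_derivative (\<lambda>v. (v, 0))) (at s)" by (auto intro!: derivative_eq_intros)
      from has_derivative_compose[OF this smooth_on_has_derivative[OF \<phi> om]]
      have "((\<lambda>s. \<phi> (s, w)) has_derivative (\<lambda>v. frechet_derivative \<phi> (at (s, w)) (v, 0))) (at s)" .
      moreover have "frechet_derivative \<phi> (at (s, w)) (v, 0) = v *\<^sub>R V (s, w)" for v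
        using linear_scale[OF smooth_on_linear_frechet[OF \<phi> om], of v "(1, 0)"] by (simp add: V_def)
      ultimately show ?thesis by simp
    qed
    have "norm (g h - g 0) \<le> (e * norm (y - z)) * norm (h - 0)"
    proof (rule differentiable_bound[of "{0..h}"])
      fix s assume s: "s \<in> {0..h}"
      show "(g has_derivative (\<lambda>v. v *\<^sub>R (V (s, y) - V (s, z) - DX (y - z)))) (at s within {0..h})"
        unfolding g_def
        by (rule has_derivative_at_withinI)
          (use s h y z in \<open>auto intro!: derivative_eq_intros dV simp: algebra_simps\<close>)
      have "norm (V (s, y) - V (s, z) - DX (y - z)) \<le> e * norm (y - z)"
        using d(3)[OF in_ball in_ball, of s y s z] s h y z DV[of "y - z"] by (simp add: norm_prod_def)
      then show "onorm (\<lambda>v. v *\<^sub>R (V (s, y) - V (s, z) - DX (y - z))) \<le> e * norm (y - z)"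
        by (intro onorm_le) (simp add: mult.commute mult_left_mono)
    qed (use h in auto)
    moreover have "\<phi> (0, y) = y" "\<phi> (0, z) = z" using y z d' by (auto intro!: \<phi>0 UOm simp: d0_def)
    ultimately show "norm (\<phi> (h, y) - \<phi> (h, z) - (y - z) - h *\<^sub>R DX (y - z)) \<le> e * h * norm (y - z)"
      using h by (simp add: g_def algebra_simps)
  qed
qed

text \<open>The expansion is made at \<open>(0, y)\<close> in the direction \<open>(h, 0)\<close>,
  and not at \<open>(0, x0)\<close>: the remainder is then quadratic in h alone and uniform in
  \<open>y\<close>.\<close>

lemma \<phi>_taylor:
  obtains d C where "d > 0" "C > 0" "ball x0 d \<subseteq> U" "\<And>h y. 0 \<le> h \<Longrightarrow> h < d \<Longrightarrow> y \<in> ball x0 d \<Longrightarrow> (h, y) \<in> Om"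
    "\<And>h y. 0 \<le> h \<Longrightarrow> h < d \<Longrightarrow> y \<in> ball x0 d \<Longrightarrow> norm (\<phi> (h, y) - y - h *\<^sub>R X y) \<le> C * h\<^sup>2"
proof -
  obtain d C where d: "d > 0" "C > 0" "ball (0, x0) d \<subseteq> Om"
    "\<And>p q. p \<in> ball (0, x0) d \<Longrightarrow> q \<in> ball (0, x0) d \<Longrightarrow>
      norm (\<phi> p - \<phi> q - frechet_derivative \<phi> (at q) (p - q)) \<le> C * (norm (p - q))\<^sup>2"
    using smooth_on_taylor[OF Om \<phi> UOm[OF x0U]] by metis
  obtain d' where d': "d' > 0" "ball x0 d' \<subseteq> U" using U x0U openE by blast
  define d0 where "d0 = min (d / 2) d'"
  have d0: "d0 > 0" using d d' by (simp add: d0_def)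
  have in_ball: "(s, y) \<in> ball (0, x0) d" if "0 \<le> s" "s < d0" "y \<in> ball x0 d0" for s y
  proof -
    have "dist (0, x0) (s, y) \<le> \<bar>s\<bar> + dist x0 y"
      using norm_Pair_le[of "0 - s" "x0 - y"] by (simp add: dist_norm)
    then show ?thesis using that by (auto simp: d0_def)
  qed
  show thesis
  proof (rule that[OF d0 d(2)])
    show "ball x0 d0 \<subseteq> U" using d' by (auto simp: d0_def)
    fix h y assume h: "0 \<le> h" "h < d0" and y: "y \<in> ball x0 d0"
    show "(h, y) \<in> Om" using in_ball h y d by blast
    have om: "(0, y) \<in> Om" using y d' by (auto intro!: UOm simp: d0_def)
    have "frechet_derivative \<phi> (at (0, y)) (h, 0) = h *\<^sub>R X y"
      using linear_scale[OF smooth_on_linear_frechet[OF \<phi> om], of h "(1, 0)"] by (simp add: V_def X_def)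
    then show "norm (\<phi> (h, y) - y - h *\<^sub>R X y) \<le> C * h\<^sup>2"
      using d(4)[of "(h, y)" "(0, y)"] in_ball[OF h y] in_ball[of 0 y] h y d0 \<phi>0[OF om] by (simp add: norm_Pair)
  qed
qed

text \<open>The linearisation of the equations for \<open>y\<close> is \<open>u \<mapsto> Q (DX u) + L u\<close>, which is injective
  on \<open>E\<close> by the two preceding lemmas.\<close>

lemma solvable:
  obtains d C where "d > 0" "C > 0" "ball x0 d \<subseteq> U"
    "\<And>z h. z \<in> MH \<Longrightarrow> z \<in> ball x0 d \<Longrightarrow> 0 < h \<Longrightarrow> h < d \<Longrightarrow>
      \<exists>y\<in>E \<inter> U. norm (y - z) \<le> C * h \<and> (h, y) \<in> Om \<and> \<phi> (h, y) \<in> E \<and> F y = z"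
proof -
  let ?T = "\<lambda>u. Q (DX u) + L u"
  have linT: "linear ?T"
    using bounded_linear_compose[OF Q bounded_linear_DX] bounded_linear_L
    by (intro linear_compose_add) (auto intro: bounded_linear.linear)
  \<comment> \<open>The two summands are separated by applying \<open>Q\<close>, which kills
    \<open>E\<close> and is idempotent.\<close>
  have T_split: "Q w = 0 \<and> v = 0" if "Q w + v = 0" "v \<in> E" for v w
  proof -
    have "Q v = 0" using Q0 that by blast
    then have "Q (Q w + v) = Q w" by (simp add: linear_simps' Q_idem)
    then have "Q w = 0" using that(1) by (simp add: linear_simps')
    then show ?thesis using that(1) by simp
  qed
  have "inj_on ?T E"
  proof (rule linear_injective_on_subspace_0[OF linT E, THEN iffD2], intro ballI impI)
    fix u assume u: "u \<in> E" "?T u = 0"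
    then show "u = 0" using T_split[OF u(2) L_E[OF u(1)]] Q0 L_fixes by metis
  qed
  then obtain R where R: "range R \<subseteq> E" "linear R" "\<And>v. v \<in> E \<Longrightarrow> R (?T v) = v"
    using linear_exists_left_inverse_on[OF linT E] by blast
  \<comment> \<open>\<open>R\<close> is a left inverse on the image of \<open>E\<close> under
    \<open>?T\<close>. All sums \<open>Q w + L v\<close> lie in that image: the missing normal part
    is supplied by some \<open>k\<close> in \<open>D\<close>, which \<open>L\<close> does not
    see.\<close>
  have R_inj: "Q w = 0 \<and> L v = 0" if v: "v \<in> E" and 0: "R (Q w + L v) = 0" for v w
  proof -
    have "Q (w - DX v) \<in> (\<lambda>u. Q (DX u)) ` D" using Q_DX_range by auto
    then obtain k where k: "k \<in> D" "Q (DX k) = Q w - Q (DX v)" by (auto simp: linear_simps')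
    then have "?T (v + k) = Q w + L v" using F_kernel[OF k(1)] by (simp add: linear_simps')
    moreover have "v + k \<in> E" using v k DE E subspace_add by blast
    ultimately have "v + k = 0" using R(3)[of "v + k"] 0 by metis
    then have "Q w + L v = 0" using \<open>?T (v + k) = Q w + L v\<close> by (simp add: linear_simps')
    then show ?thesis using T_split L_E[OF v] by blast
  qed
  obtain K where K: "K > 0" "\<And>v. norm (R v) \<le> K * norm v"
    using bounded_linear_normE R(2) linear_conv_bounded_linear by blast
  obtain KQ where KQ: "KQ > 0" "\<And>v. norm (Q v) \<le> KQ * norm v"
    using bounded_linear_normE[OF Q] by blast
  obtain KL where KL: "KL > 0" "\<And>v. norm (L v) \<le> KL * norm v"
    using bounded_linear_normE[OF bounded_linear_L] by blast
  \<comment> \<open>The two linearisation errors, magnified by \<open>R\<close> and by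
    \<open>Q\<close> or \<open>L\<close>, are to contribute a quarter each to the contraction factor
    1/2.\<close>
  have "1 / (4 * K * KQ) > 0" using K KQ by simp
  from \<phi>_difference[OF this] obtain d1 where d1: "d1 > 0" "ball x0 d1 \<subseteq> U"
    "\<And>h y. 0 \<le> h \<Longrightarrow> h < d1 \<Longrightarrow> y \<in> ball x0 d1 \<Longrightarrow> (h, y) \<in> Om"
    "\<And>h y z. 0 \<le> h \<Longrightarrow> h < d1 \<Longrightarrow> y \<in> ball x0 d1 \<Longrightarrow> z \<in> ball x0 d1 \<Longrightarrow>
      norm (\<phi> (h, y) - \<phi> (h, z) - (y - z) - h *\<^sub>R DX (y - z)) \<le> 1 / (4 * K * KQ) * h * norm (y - z)"
    by blast
  have "1 / (4 * K * KL) > 0" using K KL by simp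
  from smooth_on_strict_derivative[OF U F x0U this] obtain d2 where d2: "d2 > 0" "ball x0 d2 \<subseteq> U"
    "\<And>y z. y \<in> ball x0 d2 \<Longrightarrow> z \<in> ball x0 d2 \<Longrightarrow>
      norm (F y - F z - L (y - z)) \<le> 1 / (4 * K * KL) * norm (y - z)"
    by blast
  \<comment> \<open>This estimate serves the end of the proof: \<open>F y\<close> and
    \<open>z\<close> are fixed points of \<open>F\<close> whose difference is annihilated by
    \<open>L\<close>, and the factor 1/2 forces them to coincide.\<close>
  have "(1/2 :: real) > 0" by simp
  from smooth_on_strict_derivative[OF U F x0U this] obtain d3 where d3: "d3 > 0" "ball x0 d3 \<subseteq> U"
    "\<And>y z. y \<in> ball x0 d3 \<Longrightarrow> z \<in> ball x0 d3 \<Longrightarrow>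
      norm (F y - F z - L (y - z)) \<le> 1/2 * norm (y - z)"
    by blast
  obtain d4 KF where d4: "d4 > 0" "KF > 0" "ball x0 d4 \<subseteq> U"
    "\<And>y z. y \<in> ball x0 d4 \<Longrightarrow> z \<in> ball x0 d4 \<Longrightarrow> norm (F y - F z) \<le> KF * norm (y - z)"
    using smooth_on_locally_lipschitz[OF U F x0U] by blast
  obtain d5 CT where d5: "d5 > 0" "CT > 0" "ball x0 d5 \<subseteq> U"
    "\<And>h y. 0 \<le> h \<Longrightarrow> h < d5 \<Longrightarrow> y \<in> ball x0 d5 \<Longrightarrow> norm (\<phi> (h, y) - y - h *\<^sub>R X y) \<le> CT * h\<^sup>2"
    using \<phi>_taylor by metis
  define \<rho> where "\<rho> = min (min (min d1 d2) (min d3 d4)) d5"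
  have \<rho>: "\<rho> > 0" "\<rho> \<le> d1" "\<rho> \<le> d2" "\<rho> \<le> d3" "\<rho> \<le> d4" "\<rho> \<le> d5"
    using d1(1) d2(1) d3(1) d4(1) d5(1) by (auto simp: \<rho>_def)
  \<comment> \<open>\<open>z + k\<close> stays within \<open>2 * r\<close> of \<open>x0\<close>, and
    \<open>F\<close>, with Lipschitz constant \<open>KF\<close>, then keeps its value within
    \<rho>.\<close>
  define r where "r = \<rho> / (4 * (KF + 1))"
  have r: "r > 0" "2 * r < \<rho>" "KF * (2 * r) < \<rho>" using \<rho>(1) d4(2) by (auto simp: r_def field_simps intro!: add_pos_pos)
  \<comment> \<open>\<open>K * KQ * CT * h\<close> bounds the residual at \<open>k = 0\<close>; the
    contraction doubles it.\<close>
  define C where "C = 2 * (K * KQ * CT)"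
  have C: "C > 0" using K KQ d5 by (simp add: C_def)
  define d where "d = min r (r / C)"
  have d: "d > 0" using r C by (simp add: d_def)
  show thesis
  proof (rule that[OF d C])
    have "ball x0 d \<subseteq> ball x0 d1" using r \<rho> by (intro subset_ball) (auto simp: d_def)
    then show "ball x0 d \<subseteq> U" using d1 by blast
    fix z h assume z: "z \<in> MH" "z \<in> ball x0 d" and h: "0 < h" "h < d"
    have h\<rho>: "0 \<le> h" "h < \<rho>" using h r by (auto simp: d_def)
    have z\<rho>: "z \<in> ball x0 \<rho>" using z r by (auto simp: d_def)
    have zE: "z \<in> E" using z MHE by blast
    have zU: "z \<in> U" using z\<rho> \<rho> d1 by auto
    have Fz: "F z = z" using F_id z(1) zU by blast
    have Xz: "X z \<in> E" using X_E z(1) zU by blast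
    have bd: "z + k \<in> ball x0 (2 * r)" if "norm k \<le> r" for k
      using that z norm_triangle_ineq[of "z - x0" k] by (auto simp: d_def dist_norm norm_minus_commute algebra_simps)
    have bd\<rho>: "z + k \<in> ball x0 \<rho>" if "norm k \<le> r" for k using bd[OF that] r by auto
    \<comment> \<open>Dividing the normal equation by h gives it the linearisation
      \<open>Q (DX k)\<close>. The equation \<open>F (z + k) = z\<close> is replaced by its image
      under \<open>L\<close>, so that the argument of \<open>R\<close> has the form covered by
      \<open>R_inj\<close>; the full equation is recovered at the end.\<close>
    define G where "G k = R ((1 / h) *\<^sub>R Q (\<phi> (h, z + k)) + L (F (z + k) - z))" for k
    have G0: "norm (G 0) \<le> K * KQ * CT * h"
    proof -
      \<comment> \<open>Neither a point of \<open>MH\<close> nor the field there has a normal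
        component, so \<open>z\<close> itself satisfies the divided equation up to O(h).\<close>
      have "Q z = 0" "Q (X z) = 0" using Q0 zE Xz by blast+
      then have "Q (\<phi> (h, z)) = Q (\<phi> (h, z) - z - h *\<^sub>R X z)" by (simp add: linear_simps')
      then have "norm (Q (\<phi> (h, z))) \<le> KQ * norm (\<phi> (h, z) - z - h *\<^sub>R X z)" using KQ by simp
      also have "\<dots> \<le> KQ * (CT * h\<^sup>2)" using d5(4)[of h z] h\<rho> z\<rho> \<rho> KQ by auto
      finally have 1: "norm ((1 / h) *\<^sub>R Q (\<phi> (h, z))) \<le> KQ * CT * h"
        using h by (simp add: field_simps power2_eq_square)
      have "norm (G 0) \<le> K * norm ((1 / h) *\<^sub>R Q (\<phi> (h, z)))"
        unfolding G_def using K(2)[of "(1 / h) *\<^sub>R Q (\<phi> (h, z))"] Fz by (simp add: linear_simps')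
      also have "\<dots> \<le> K * (KQ * CT * h)" using 1 K by (intro mult_left_mono) auto
      finally show ?thesis by (simp add: mult_ac)
    qed
    also have "\<dots> \<le> r / 2"
    proof -
      have "C * h \<le> C * (r / C)" using h C by (intro mult_left_mono) (auto simp: d_def)
      also have "\<dots> = r" using C by simp
      finally show ?thesis by (simp add: C_def)
    qed
    finally have G0': "norm (G 0) \<le> r / 2" .
    obtain k where k: "k \<in> E" "G k = 0" "norm k \<le> 2 * norm (G 0)" "norm k \<le> r"
    proof (rule contraction_zero[where S = E and G = G and r = r, OF E _ G0'])
      show "G k \<in> E" for k using R(1) by (auto simp: G_def)
      fix k k' assume k: "k \<in> E" "k' \<in> E" "norm k \<le> r" "norm k' \<le> r"
      define v where "v = k - k'"
      have vE: "v \<in> E" using k E subspace_diff by (simp add: v_def)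
      define a where "a = \<phi> (h, z + k) - \<phi> (h, z + k') - v - h *\<^sub>R DX v"
      define b where "b = F (z + k) - F (z + k') - L v"
      have na: "norm a \<le> 1 / (4 * K * KQ) * h * norm v"
        using d1(4)[of h "z + k" "z + k'"] bd\<rho>[OF k(3)] bd\<rho>[OF k(4)] h\<rho> \<rho> by (auto simp: a_def v_def)
      have nb: "norm b \<le> 1 / (4 * K * KL) * norm v"
        using d2(3)[of "z + k" "z + k'"] bd\<rho>[OF k(3)] bd\<rho>[OF k(4)] h\<rho> \<rho> by (auto simp: b_def v_def)
      have "Q v = 0" using Q0 vE by blast
      \<comment> \<open>\<open>L_idem\<close> replaces \<open>L (L v)\<close> by \<open>L v\<close>,
        so the linear part is exactly the map \<open>?T\<close> that \<open>R\<close>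
        inverts.\<close>
      then have eqT: "((1 / h) *\<^sub>R Q (\<phi> (h, z + k)) + L (F (z + k) - z)) -
            ((1 / h) *\<^sub>R Q (\<phi> (h, z + k')) + L (F (z + k') - z)) = (1 / h) *\<^sub>R Q a + L b + ?T v"
        using h L_idem[OF vE] by (simp add: a_def b_def linear_simps' algebra_simps)
      have "G k - G k' = R (((1 / h) *\<^sub>R Q (\<phi> (h, z + k)) + L (F (z + k) - z)) -
            ((1 / h) *\<^sub>R Q (\<phi> (h, z + k')) + L (F (z + k') - z)))"
        unfolding G_def by (rule linear_diff[OF R(2), symmetric])
      then have eq: "R ((1 / h) *\<^sub>R Q a + L b) + v = G k - G k'"
        using linear_add[OF R(2), of "(1 / h) *\<^sub>R Q a + L b" "?T v"] R(3)[OF vE] unfolding eqT by simp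
      have "norm (k - k' - (G k - G k')) = norm (R ((1 / h) *\<^sub>R Q a + L b))"
        unfolding eq[symmetric] by (simp add: v_def)
      also have "\<dots> \<le> K * (norm ((1 / h) *\<^sub>R Q a) + norm (L b))"
        using K by (meson mult_left_mono norm_triangle_ineq order_trans less_imp_le)
      also have "\<dots> \<le> K * ((1 / h) * (KQ * (1 / (4 * K * KQ) * h * norm v)) + KL * (1 / (4 * K * KL) * norm v))"
      proof (intro mult_left_mono add_mono)
        show "norm ((1 / h) *\<^sub>R Q a) \<le> (1 / h) * (KQ * (1 / (4 * K * KQ) * h * norm v))"
          using h mult_left_mono[OF order_trans[OF KQ(2)[of a] mult_left_mono[OF na, of KQ]], of "1 / h"] KQ by simp
        show "norm (L b) \<le> KL * (1 / (4 * K * KL) * norm v)"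
          using order_trans[OF KL(2)[of b] mult_left_mono[OF nb, of KL]] KL by simp
      qed (use K in auto)
      also have "\<dots> = norm v / 2" using K KQ KL h by (simp add: field_simps)
      finally show "norm (k - k' - (G k - G k')) \<le> norm (k - k') / 2" by (simp add: v_def)
    qed
    define y where "y = z + k"
    have y\<rho>: "y \<in> ball x0 \<rho>" using bd\<rho>[OF k(4)] by (simp add: y_def)
    have yU: "y \<in> U" using y\<rho> \<rho> d1 by auto
    have yE: "y \<in> E" using zE k E subspace_add by (simp add: y_def)
    have FyMH: "F y \<in> MH" using F_MH yE yU by blast
    have FyzE: "F y - z \<in> E" using FyMH MHE zE E subspace_diff by blast
    have "R (Q ((1 / h) *\<^sub>R \<phi> (h, y)) + L (F y - z)) = 0"
      using k(2) by (simp add: G_def y_def linear_simps')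
    from R_inj[OF FyzE this] have QL: "Q ((1 / h) *\<^sub>R \<phi> (h, y)) = 0" "L (F y - z) = 0" by auto
    then have "Q (\<phi> (h, y)) = 0" using h by (simp add: linear_simps')
    then have \<phi>E: "\<phi> (h, y) \<in> E" using Q0 by blast
    have "norm (F y - F x0) \<le> KF * norm (y - x0)"
      using d4(4)[of y x0] y\<rho> \<rho> by auto
    also have "\<dots> \<le> KF * (2 * r)"
      using bd[OF k(4)] d4(2) by (intro mult_left_mono) (auto simp: y_def dist_norm norm_minus_commute)
    also have "\<dots> < \<rho>" by (rule r)
    finally have Fy\<rho>: "F y \<in> ball x0 \<rho>"
      using F_id x0U x0MH by (simp add: dist_norm norm_minus_commute)
    then have "F y \<in> U" using \<rho> d1 by auto
    then have "F (F y) = F y" using F_id FyMH by blast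
    then have "norm (F y - z) \<le> 1/2 * norm (F y - z)"
      using d3(3)[of "F y" z] Fy\<rho> z\<rho> \<rho> Fz QL by auto
    then have "norm (F y - z) \<le> 0" by linarith
    then have Fy: "F y = z" by simp
    have "norm (y - z) \<le> C * h" using k(3) G0 by (simp add: y_def C_def)
    moreover have "(h, y) \<in> Om" using d1(3)[of h y] h\<rho> y\<rho> \<rho> by auto
    ultimately show "\<exists>y\<in>E \<inter> U. norm (y - z) \<le> C * h \<and> (h, y) \<in> Om \<and> \<phi> (h, y) \<in> E \<and> F y = z"
      using yE yU \<phi>E Fy by blast
  qed
qed

text \<open>The shifted point \<open>y\<close> is only O(h) close to \<open>z\<close>, yet the step
  is accurate to second order: since \<open>F y = z\<close> holds exactly, the displacement enters
  only through \<open>Y y - Y z\<close>, which carries another factor h.\<close>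

lemma one_step:
  obtains d C K where "d > 0" "C > 0" "K > 0" "ball x0 d \<subseteq> U"
    "\<And>y z. y \<in> ball x0 d \<Longrightarrow> z \<in> ball x0 d \<Longrightarrow> norm (Y y - Y z) \<le> K * norm (y - z)"
    "\<And>z h. z \<in> MH \<Longrightarrow> z \<in> ball x0 d \<Longrightarrow> 0 < h \<Longrightarrow> h < d \<Longrightarrow>
      \<exists>y\<in>E \<inter> U. (h, y) \<in> Om \<and> F y = z \<and> \<phi> (h, y) \<in> E \<inter> U \<and>
        norm (\<phi> (h, y) - z) \<le> C * h \<and> norm (F (\<phi> (h, y)) - z - h *\<^sub>R Y z) \<le> C * h\<^sup>2"
proof -
  obtain d1 C1 where d1: "d1 > 0" "C1 > 0" "ball x0 d1 \<subseteq> U"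
    "\<And>z h. z \<in> MH \<Longrightarrow> z \<in> ball x0 d1 \<Longrightarrow> 0 < h \<Longrightarrow> h < d1 \<Longrightarrow>
      \<exists>y\<in>E \<inter> U. norm (y - z) \<le> C1 * h \<and> (h, y) \<in> Om \<and> \<phi> (h, y) \<in> E \<and> F y = z"
    using solvable by metis
  obtain d2 KX where d2: "d2 > 0" "KX > 0" "ball x0 d2 \<subseteq> U"
    "\<And>y z. y \<in> ball x0 d2 \<Longrightarrow> z \<in> ball x0 d2 \<Longrightarrow> norm (X y - X z) \<le> KX * norm (y - z)"
    using smooth_on_locally_lipschitz[OF U X_smooth x0U] by blast
  obtain d3 CT where d3: "d3 > 0" "CT > 0" "ball x0 d3 \<subseteq> U"
    "\<And>h y. 0 \<le> h \<Longrightarrow> h < d3 \<Longrightarrow> y \<in> ball x0 d3 \<Longrightarrow> norm (\<phi> (h, y) - y - h *\<^sub>R X y) \<le> CT * h\<^sup>2"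
    using \<phi>_taylor by metis
  obtain d4 CF where d4: "d4 > 0" "CF > 0" "ball x0 d4 \<subseteq> U"
    "\<And>y z. y \<in> ball x0 d4 \<Longrightarrow> z \<in> ball x0 d4 \<Longrightarrow>
      norm (F y - F z - frechet_derivative F (at z) (y - z)) \<le> CF * (norm (y - z))\<^sup>2"
    "\<And>y z v. y \<in> ball x0 d4 \<Longrightarrow> z \<in> ball x0 d4 \<Longrightarrow>
      norm (frechet_derivative F (at y) v - frechet_derivative F (at z) v) \<le> CF * norm (y - z) * norm v"
    using smooth_on_taylor[OF U F x0U] by metis
  obtain d5 KY where d5: "d5 > 0" "KY > 0" "ball x0 d5 \<subseteq> U"
    "\<And>y z. y \<in> ball x0 d5 \<Longrightarrow> z \<in> ball x0 d5 \<Longrightarrow> norm (Y y - Y z) \<le> KY * norm (y - z)"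
    using smooth_on_locally_lipschitz[OF U Y_smooth x0U] by blast
  obtain KL where KL: "KL > 0" "\<And>v. norm (L v) \<le> KL * norm v"
    using bounded_linear_normE[OF bounded_linear_L] by blast
  define \<rho> where "\<rho> = min (min (min d1 d2) (min d3 d4)) d5"
  have \<rho>: "\<rho> > 0" "\<rho> \<le> d1" "\<rho> \<le> d2" "\<rho> \<le> d3" "\<rho> \<le> d4" "\<rho> \<le> d5"
    using d1(1) d2(1) d3(1) d4(1) d5(1) by (auto simp: \<rho>_def)
  define BX where "BX = norm (X x0) + KX * \<rho>"
  have BX: "BX \<ge> 0" using d2(2) \<rho>(1) by (simp add: BX_def)
  define KF where "KF = KL + CF * \<rho>"
  have KF: "KF \<ge> 0" using KL d4(2) \<rho>(1) by (simp add: KF_def)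
  define B where "B = BX + CT"
  have B: "B > 0" using BX d3(2) by (simp add: B_def)
  define C where "C = C1 + B + (CF * B\<^sup>2 + KF * CT + KY * C1)"
  have C: "C > 0" "C1 + B \<le> C" "CF * B\<^sup>2 + KF * CT + KY * C1 \<le> C"
    using d1(2) B d4(2) KF d3(2) d5(2) by (auto simp: C_def intro!: add_pos_nonneg)
  \<comment> \<open>The radius leaves room for \<open>y\<close> and for
    \<open>\<phi> (h, y)\<close>, both within \<open>(C1 + B) * h\<close> of \<open>z\<close>; the
    bound 1 is for \<open>h\<^sup>2 \<le> h\<close>.\<close>
  define d where "d = min (min 1 \<rho>) (\<rho> / (1 + C1 + B))"
  have d: "d > 0" using \<rho>(1) d1(2) B by (simp add: d_def)
  have d\<rho>: "d + (C1 + B) * d \<le> \<rho>"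
  proof -
    have "(1 + C1 + B) * d \<le> (1 + C1 + B) * (\<rho> / (1 + C1 + B))"
      using d1(2) B by (intro mult_left_mono) (auto simp: d_def)
    also have "\<dots> = \<rho>" using d1(2) B by simp
    finally show ?thesis by (simp add: algebra_simps)
  qed
  show thesis
  proof (rule that[OF d C(1) d5(2)])
    have d5': "ball x0 d \<subseteq> ball x0 d5" using \<rho> by (intro subset_ball) (auto simp: d_def)
    show "ball x0 d \<subseteq> U" using d5' d5(3) by blast
    show "norm (Y y - Y z) \<le> KY * norm (y - z)" if "y \<in> ball x0 d" "z \<in> ball x0 d" for y z
      using that d5' d5(4) by blast
    fix z h assume z: "z \<in> MH" "z \<in> ball x0 d" and h: "0 < h" "h < d"
    have h1: "h \<le> 1" "h < \<rho>" using h by (auto simp: d_def)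
    have z\<rho>: "z \<in> ball x0 \<rho>" using z by (auto simp: d_def)
    obtain y where y: "y \<in> E" "y \<in> U" "norm (y - z) \<le> C1 * h" "(h, y) \<in> Om" "\<phi> (h, y) \<in> E" "F y = z"
      using d1(4)[of z h] z\<rho> \<rho> h h1 z by auto
    have zx: "norm (z - x0) < d" using z by (simp add: dist_norm norm_minus_commute)
    have Ch: "(C1 + B) * h \<le> (C1 + B) * d" using h B d1(2) by (intro mult_left_mono) auto
    have "norm (y - x0) \<le> norm (y - z) + norm (z - x0)"
      using norm_triangle_ineq[of "y - z" "z - x0"] by simp
    moreover have "C1 * h \<le> (C1 + B) * h" using h B by (intro mult_right_mono) auto
    ultimately have "norm (y - x0) < \<rho>" using zx Ch d\<rho> y(3) by linarith
    then have y\<rho>: "y \<in> ball x0 \<rho>" by (simp add: dist_norm norm_minus_commute)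
    define p where "p = \<phi> (h, y)"
    have t1: "norm (p - y - h *\<^sub>R X y) \<le> CT * h\<^sup>2"
      unfolding p_def using d3(4)[of h y] h1 h y\<rho> \<rho> by auto
    have "norm (X y - X x0) \<le> KX * norm (y - x0)" using d2(4)[of y x0] y\<rho> \<rho> by auto
    also have "\<dots> \<le> KX * \<rho>" using \<open>norm (y - x0) < \<rho>\<close> d2(2) by (intro mult_left_mono) auto
    finally have Xy: "norm (X y) \<le> BX" using norm_triangle_sub[of "X y" "X x0"] by (simp add: BX_def)
    have "norm (p - y) \<le> norm (p - y - h *\<^sub>R X y) + h * norm (X y)"
      using norm_triangle_sub[of "p - y" "h *\<^sub>R X y"] h by simp
    also have "\<dots> \<le> CT * h + h * BX"
    proof (intro add_mono mult_left_mono Xy)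
      have "CT * h\<^sup>2 \<le> CT * h" using h h1 d3(2) by (intro mult_left_mono) (auto simp: power2_eq_square mult_left_le_one_le)
      then show "norm (p - y - h *\<^sub>R X y) \<le> CT * h" using t1 by linarith
    qed (use h in auto)
    finally have py: "norm (p - y) \<le> B * h" by (simp add: B_def algebra_simps)
    have "norm (p - z) \<le> norm (p - y) + norm (y - z)" using norm_triangle_ineq[of "p - y" "y - z"] by simp
    then have pz: "norm (p - z) \<le> (C1 + B) * h" using py y(3) by (simp add: algebra_simps)
    have "norm (p - x0) \<le> norm (p - z) + norm (z - x0)" using norm_triangle_ineq[of "p - z" "z - x0"] by simp
    then have "norm (p - x0) < \<rho>" using pz zx Ch d\<rho> by linarith
    then have p\<rho>: "p \<in> ball x0 \<rho>" by (simp add: dist_norm norm_minus_commute)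
    have pU: "p \<in> U" using p\<rho> \<rho> d5(3) by auto
    have linDF: "linear (frechet_derivative F (at y))" by (rule smooth_on_linear_frechet[OF F y(2)])
    have DFb: "norm (frechet_derivative F (at y) v) \<le> KF * norm v" for v
    proof -
      have "norm (frechet_derivative F (at y) v - L v) \<le> CF * norm (y - x0) * norm v"
        using d4(5)[of y x0 v] y\<rho> \<rho> by auto
      also have "\<dots> \<le> CF * \<rho> * norm v"
        using \<open>norm (y - x0) < \<rho>\<close> d4(2) by (intro mult_right_mono mult_left_mono) auto
      finally show ?thesis using KL(2)[of v] norm_triangle_sub[of "frechet_derivative F (at y) v" "L v"]
        by (simp add: KF_def algebra_simps)
    qed
    have a: "norm (F p - z - frechet_derivative F (at y) (p - y)) \<le> CF * B\<^sup>2 * h\<^sup>2"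
    proof -
      have "norm (F p - F y - frechet_derivative F (at y) (p - y)) \<le> CF * (norm (p - y))\<^sup>2"
        using d4(4)[of p y] p\<rho> y\<rho> \<rho> by auto
      also have "\<dots> \<le> CF * (B * h)\<^sup>2" using py d4(2) by (intro mult_left_mono power_mono) auto
      finally show ?thesis using y(6) by (simp add: power_mult_distrib)
    qed
    have b: "norm (frechet_derivative F (at y) (p - y) - h *\<^sub>R Y y) \<le> KF * CT * h\<^sup>2"
    proof -
      have "frechet_derivative F (at y) (p - y) - h *\<^sub>R Y y = frechet_derivative F (at y) (p - y - h *\<^sub>R X y)"
        by (simp add: Y_def linear_diff[OF linDF] linear_scale[OF linDF])
      then show ?thesis using order_trans[OF DFb mult_left_mono[OF t1 KF]] by (simp add: mult_ac)
    qed
    have c: "norm (h *\<^sub>R Y y - h *\<^sub>R Y z) \<le> KY * C1 * h\<^sup>2"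
    proof -
      have "norm (Y y - Y z) \<le> KY * norm (y - z)" using d5(4)[of y z] y\<rho> z\<rho> \<rho> by auto
      also have "\<dots> \<le> KY * (C1 * h)" using y(3) d5(2) by (intro mult_left_mono) auto
      finally have "h * norm (Y y - Y z) \<le> h * (KY * (C1 * h))" using h by (intro mult_left_mono) auto
      then show ?thesis using h by (simp add: power2_eq_square mult_ac flip: scaleR_diff_right)
    qed
    \<comment> \<open>The three terms are the Taylor remainder of \<open>F\<close> at
      \<open>y\<close>, the remainder of the method transported by the derivative of
      \<open>F\<close>, and the variation of \<open>Y\<close> between \<open>y\<close> and
      \<open>z\<close>.\<close>
    have "F p - z - h *\<^sub>R Y z = (F p - z - frechet_derivative F (at y) (p - y))
        + (frechet_derivative F (at y) (p - y) - h *\<^sub>R Y y) + (h *\<^sub>R Y y - h *\<^sub>R Y z)" by simp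
    then have "norm (F p - z - h *\<^sub>R Y z) \<le> CF * B\<^sup>2 * h\<^sup>2 + KF * CT * h\<^sup>2 + KY * C1 * h\<^sup>2"
      using a b c by (metis norm_triangle_mono)
    also have "\<dots> = (CF * B\<^sup>2 + KF * CT + KY * C1) * h\<^sup>2" by (simp add: algebra_simps)
    also have "\<dots> \<le> C * h\<^sup>2" using C by (intro mult_right_mono) auto
    finally have "norm (F p - z - h *\<^sub>R Y z) \<le> C * h\<^sup>2" .
    moreover have "norm (p - z) \<le> C * h" using pz C h by (meson mult_right_mono less_imp_le order_trans)
    ultimately show "\<exists>y\<in>E \<inter> U. (h, y) \<in> Om \<and> F y = z \<and> \<phi> (h, y) \<in> E \<inter> U \<and>
        norm (\<phi> (h, y) - z) \<le> C * h \<and> norm (F (\<phi> (h, y)) - z - h *\<^sub>R Y z) \<le> C * h\<^sup>2"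
      using y pU by (auto simp: p_def)
  qed
qed

end

section \<open>Charts and tangent vectors\<close>

lemma chart_inv_into:
  assumes "is_chart c"
  shows "p \<in> dom_of c \<Longrightarrow> chart_inv c (snd c p) = p"
    and "x \<in> img_of c \<Longrightarrow> snd c (chart_inv c x) = x"
    and "x \<in> img_of c \<Longrightarrow> chart_inv c x \<in> dom_of c"
  using assms by (auto simp: is_chart_def homeomorphism_def inv_into_into f_inv_into_f)

lemma chart_continuous:
  assumes "is_chart c"
  shows "continuous_on (dom_of c) (snd c)" "continuous_on (img_of c) (chart_inv c)"
    "open (dom_of c)" "open (img_of c)"
  using assms by (auto simp: is_chart_def homeomorphism_def)

lemma chart_image_open:
  assumes c: "is_chart c" and U: "open U"
  shows "open (snd c ` (dom_of c \<inter> U))"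
proof -
  have "snd c ` (dom_of c \<inter> U) = img_of c \<inter> chart_inv c -` U"
    using chart_inv_into[OF c] by force
  then show ?thesis
    using continuous_open_preimage[OF chart_continuous(2,4)[OF c] U] by (simp add: vimage_def)
qed

text \<open>Based at a point of the manifold and not at its coordinates, so that changes of chart at
  one point compose as a cocycle. With \<open>d\<close> the reference chart at \<open>p\<close> this
  is the conversion \<open>to_ref\<close>.\<close>

definition chart_deriv :: "('p, 'e::euclidean_space) chart \<Rightarrow> ('p, 'e) chart \<Rightarrow> 'p \<Rightarrow> 'e \<Rightarrow> 'e" where
  "chart_deriv c d p = frechet_derivative (\<lambda>x. snd d (chart_inv c x)) (at (snd c p))"

section \<open>Transition maps and smoothness in charts of the maximal atlas\<close>

locale atlas =
  fixes A :: "('p::topological_space, 'e::euclidean_space) chart set"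
  assumes A: "smooth_atlas A"
begin

lemma atlas_smooth_chart: "c \<in> A \<Longrightarrow> smooth_chart A c"
  using A by (auto simp: smooth_atlas_def smooth_chart_def)

lemma smooth_chart_is_chart: "smooth_chart A c \<Longrightarrow> is_chart c"
  by (simp add: smooth_chart_def)

lemmas chart_simps = chart_inv_into[OF smooth_chart_is_chart]
lemmas chart_cont = chart_continuous[OF smooth_chart_is_chart]
lemmas chart_open = chart_image_open[OF smooth_chart_is_chart]

abbreviation ref :: "'p \<Rightarrow> ('p, 'e) chart" where "ref p \<equiv> chart_at A p"

lemma ref: "ref p \<in> A" "p \<in> dom_of (ref p)" "smooth_chart A (ref p)"
proof -
  have "\<exists>c. c \<in> A \<and> p \<in> dom_of c" using A unfolding smooth_atlas_def by (metis UNIV_I UN_iff)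
  from someI_ex[OF this] show "ref p \<in> A" "p \<in> dom_of (ref p)" by (auto simp: chart_at_def)
  then show "smooth_chart A (ref p)" using atlas_smooth_chart by blast
qed

text \<open>Compatibility is postulated against charts of \<open>A\<close> only; near each point the
  transition is factored through an atlas chart there. Slice charts are the reason: they need not
  belong to \<open>A\<close>.\<close>

lemma transition_smooth:
  assumes c: "smooth_chart A c" and d: "smooth_chart A d"
  shows "smooth_on (snd c ` (dom_of c \<inter> dom_of d)) (\<lambda>x. snd d (chart_inv c x))"
proof (rule smooth_on_local, clarify)
  fix p assume p: "p \<in> dom_of c" "p \<in> dom_of d"
  define a where "a = ref p"
  have a: "a \<in> A" "p \<in> dom_of a" "smooth_chart A a" using ref by (auto simp: a_def)
  define U where "U = snd c ` (dom_of c \<inter> (dom_of d \<inter> dom_of a))"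
  have U: "open U" unfolding U_def using chart_cont(3) a d by (intro chart_open c open_Int) auto
  have T: "open (snd a ` (dom_of d \<inter> dom_of a))"
    using chart_open[OF a(3) chart_cont(3)[OF d]] by (simp add: Int_commute)
  have "smooth_on (snd c ` (dom_of c \<inter> dom_of a)) (snd a \<circ> chart_inv c)"
    using c a by (auto simp: smooth_chart_def compatible_def)
  then have 1: "smooth_on U (\<lambda>x. snd a (chart_inv c x))"
    unfolding o_def by (rule smooth_on_subset) (auto simp: U_def)
  have 2: "smooth_on (snd a ` (dom_of d \<inter> dom_of a)) (\<lambda>x. snd d (chart_inv a x))"
    using d a by (auto simp: smooth_chart_def compatible_def o_def)
  have "smooth_on U (\<lambda>x. snd d (chart_inv a (snd a (chart_inv c x))))"
    by (rule smooth_on_compose[OF U T _ 1 2]) (auto simp: U_def chart_simps(1)[OF c])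
  then have "smooth_on U (\<lambda>x. snd d (chart_inv c x))"
    by (rule smooth_on_cong[OF U, rotated]) (auto simp: U_def chart_simps(1)[OF c] chart_simps(1)[OF a(3)])
  then show "\<exists>U. open U \<and> snd c p \<in> U \<and> smooth_on U (\<lambda>x. snd d (chart_inv c x))"
    using U p a by (auto simp: U_def)
qed

lemma transition_open:
  "smooth_chart A c \<Longrightarrow> smooth_chart A d \<Longrightarrow> open (snd c ` (dom_of c \<inter> dom_of d))"
  using chart_open chart_cont(3) by blast

lemma chart_deriv:
  assumes "smooth_chart A c" "smooth_chart A d" "p \<in> dom_of c" "p \<in> dom_of d"
  shows "((\<lambda>x. snd d (chart_inv c x)) has_derivative chart_deriv c d p) (at (snd c p))"
  unfolding chart_deriv_def
  by (rule smooth_on_has_derivative[OF transition_smooth[OF assms(1,2)]]) (use assms in auto)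

lemma chart_deriv_linear:
  assumes "smooth_chart A c" "smooth_chart A d" "p \<in> dom_of c" "p \<in> dom_of d"
  shows "linear (chart_deriv c d p)"
  using chart_deriv[OF assms] has_derivative_linear by blast

lemma chart_deriv_cocycle:
  assumes c: "smooth_chart A c" "p \<in> dom_of c" and d: "smooth_chart A d" "p \<in> dom_of d"
    and e: "smooth_chart A e" "p \<in> dom_of e"
  shows "chart_deriv d e p (chart_deriv c d p u) = chart_deriv c e p u"
proof -
  have "((\<lambda>y. snd e (chart_inv d y)) has_derivative chart_deriv d e p) (at (snd d (chart_inv c (snd c p))))"
    using chart_deriv[OF d(1) e(1) d(2) e(2)] chart_simps(1)[OF c] by simp
  from has_derivative_compose[OF chart_deriv[OF c(1) d(1) c(2) d(2)] this]
  have 1: "((\<lambda>x. snd e (chart_inv d (snd d (chart_inv c x)))) has_derivative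
      (\<lambda>u. chart_deriv d e p (chart_deriv c d p u))) (at (snd c p))" .
  have "((\<lambda>x. snd e (chart_inv c x)) has_derivative
      (\<lambda>u. chart_deriv d e p (chart_deriv c d p u))) (at (snd c p))"
    by (rule has_derivative_transform_within_open[OF 1 transition_open[OF c(1) d(1)]])
      (use c d chart_simps(1) in auto)
  then show ?thesis using frechet_derivative_at unfolding chart_deriv_def by metis
qed

lemma chart_deriv_same:
  assumes c: "smooth_chart A c" "p \<in> dom_of c"
  shows "chart_deriv c c p u = u"
proof -
  have "((\<lambda>x. snd c (chart_inv c x)) has_derivative (\<lambda>u. u)) (at (snd c p))"
    by (rule has_derivative_transform_within_open[OF has_derivative_ident chart_cont(4)[OF c(1)]])
      (use c chart_simps in auto)
  then show ?thesis using frechet_derivative_at unfolding chart_deriv_def by metis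
qed

lemma to_ref_chart_deriv:
  "smooth_chart A c \<Longrightarrow> p \<in> dom_of c \<Longrightarrow> to_ref A c (snd c p) u = chart_deriv c (ref p) p u"
  by (simp add: to_ref_def chart_deriv_def chart_simps(1) o_def)

lemma chart_deriv_smooth:
  assumes c: "smooth_chart A c" and d: "smooth_chart A d" and e: "smooth_chart A e"
  shows "smooth_on (snd e ` (dom_of c \<inter> dom_of d \<inter> dom_of e)) (\<lambda>x. chart_deriv c d (chart_inv e x) u)"
proof -
  let ?S = "snd e ` (dom_of c \<inter> dom_of d \<inter> dom_of e)" and ?T = "snd c ` (dom_of c \<inter> dom_of d)"
  have S: "open ?S" using chart_open[OF e open_Int[OF chart_cont(3)[OF c] chart_cont(3)[OF d]]]
    by (simp add: Int_ac)
  show ?thesis unfolding chart_deriv_def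
  proof (rule smooth_on_compose[OF S transition_open[OF c d], where f = "\<lambda>x. snd c (chart_inv e x)"
        and g = "\<lambda>x. frechet_derivative (\<lambda>x. snd d (chart_inv c x)) (at x) u"])
    show "(\<lambda>x. snd c (chart_inv e x)) ` ?S \<subseteq> ?T" using chart_simps(1)[OF e] by auto
    show "smooth_on ?S (\<lambda>x. snd c (chart_inv e x))"
      by (rule smooth_on_subset[OF transition_smooth[OF e c]]) auto
    show "smooth_on ?T (\<lambda>x. frechet_derivative (\<lambda>x. snd d (chart_inv c x)) (at x) u)"
      by (intro smooth_on_frechet transition_smooth c d)
  qed
qed

lemma smooth_fun_chart:
  assumes f: "smooth_fun A f" and c: "smooth_chart A c"
  shows "smooth_on (img_of c) (\<lambda>x. f (chart_inv c x))"
proof (rule smooth_on_local, clarify)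
  fix p assume p: "p \<in> dom_of c"
  define a where "a = ref p"
  have a: "a \<in> A" "p \<in> dom_of a" "smooth_chart A a" using ref by (auto simp: a_def)
  let ?U = "snd c ` (dom_of c \<inter> dom_of a)"
  have "smooth_on ?U (\<lambda>x. f (chart_inv a (snd a (chart_inv c x))))"
    using f a(1) by (intro smooth_on_compose[OF transition_open[OF c a(3)] chart_cont(4)[OF a(3)] _ transition_smooth[OF c a(3)]])
      (auto simp: smooth_fun_def o_def chart_simps(1)[OF c])
  then have "smooth_on ?U (\<lambda>x. f (chart_inv c x))"
    by (rule smooth_on_cong[OF transition_open[OF c a(3)], rotated]) (auto simp: chart_simps(1)[OF c] chart_simps(1)[OF a(3)])
  then show "\<exists>U. open U \<and> snd c p \<in> U \<and> smooth_on U (\<lambda>x. f (chart_inv c x))"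
    using transition_open[OF c a(3)] p a by blast
qed

text \<open>The coordinate expression is factored through atlas charts at \<open>p\<close> and
  \<open>f p\<close>, where smoothness is assumed. Continuity of \<open>f\<close> on the open set
  \<open>U\<close> makes the common domain open.\<close>

lemma smooth_map_chart:
  assumes f: "smooth_map A U f" and U: "open U" and c: "smooth_chart A c" and d: "smooth_chart A d"
  shows "smooth_on (snd c ` {p \<in> dom_of c \<inter> U. f p \<in> dom_of d}) (\<lambda>x. snd d (f (chart_inv c x)))"
    and "open (snd c ` {p \<in> dom_of c \<inter> U. f p \<in> dom_of d})"
proof -
  have op: "open {p \<in> U. f p \<in> B}" if "open B" for B
    using continuous_open_preimage[of U f B] f U that by (auto simp: smooth_map_def vimage_def Int_def)
  have op': "open (snd e ` {p \<in> dom_of e \<inter> U. f p \<in> B})" if "open B" "smooth_chart A e" for B e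
    using chart_open[OF that(2) op[OF that(1)]] by (simp add: Int_def conj_assoc)
  show "open (snd c ` {p \<in> dom_of c \<inter> U. f p \<in> dom_of d})" by (intro op' chart_cont(3) d c)
  show "smooth_on (snd c ` {p \<in> dom_of c \<inter> U. f p \<in> dom_of d}) (\<lambda>x. snd d (f (chart_inv c x)))"
  proof (rule smooth_on_local, clarify)
    fix p assume p: "p \<in> dom_of c" "p \<in> U" "f p \<in> dom_of d"
    define a where "a = ref p"
    define b where "b = ref (f p)"
    have a: "a \<in> A" "p \<in> dom_of a" "smooth_chart A a" using ref by (auto simp: a_def)
    have b: "b \<in> A" "f p \<in> dom_of b" "smooth_chart A b" using ref by (auto simp: b_def)
    let ?N = "dom_of c \<inter> (dom_of a \<inter> {p \<in> U. f p \<in> dom_of d \<inter> dom_of b})"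
    define N where "N = snd c ` ?N"
    have N: "open N" unfolding N_def
      by (intro chart_open c open_Int op chart_cont(3) a b d)
    have 1: "smooth_on N (\<lambda>x. snd a (chart_inv c x))"
      by (rule smooth_on_subset[OF transition_smooth[OF c a(3)]]) (auto simp: N_def)
    have "smooth_on (snd a ` {p \<in> dom_of a \<inter> U. f p \<in> dom_of b}) (snd b \<circ> f \<circ> chart_inv a)"
      using f a b by (simp add: smooth_map_def)
    then have "smooth_on N (\<lambda>x. (snd b \<circ> f \<circ> chart_inv a) (snd a (chart_inv c x)))"
      by (rule smooth_on_compose[OF N op'[OF chart_cont(3)[OF b(3)] a(3)] _ 1, rotated])
        (auto simp: N_def chart_simps(1)[OF c])
    then have 2: "smooth_on N (\<lambda>x. snd b (f (chart_inv c x)))"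
      by (rule smooth_on_cong[OF N, rotated]) (auto simp: N_def chart_simps(1)[OF c] chart_simps(1)[OF a(3)])
    have "smooth_on N (\<lambda>x. snd d (chart_inv b (snd b (f (chart_inv c x)))))"
      by (rule smooth_on_compose[OF N transition_open[OF b(3) d] _ 2 transition_smooth[OF b(3) d]])
        (auto simp: N_def chart_simps(1)[OF c])
    then have "smooth_on N (\<lambda>x. snd d (f (chart_inv c x)))"
      by (rule smooth_on_cong[OF N, rotated]) (auto simp: N_def chart_simps(1)[OF c] chart_simps(1)[OF b(3)])
    then show "\<exists>U. open U \<and> snd c p \<in> U \<and> smooth_on U (\<lambda>x. snd d (f (chart_inv c x)))"
      using N p a b by (intro exI[of _ N]) (auto simp: N_def)
  qed
qed

lemma smooth_curve_chart:
  assumes \<gamma>: "smooth_curve A I \<gamma>" and I: "open I" and d: "smooth_chart A d"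
  shows "smooth_on {t \<in> I. \<gamma> t \<in> dom_of d} (\<lambda>t. snd d (\<gamma> t))"
    and "open {t \<in> I. \<gamma> t \<in> dom_of d}"
proof -
  have op: "open {t \<in> I. \<gamma> t \<in> B}" if "open B" for B
    using continuous_open_preimage[of I \<gamma> B] \<gamma> I that by (auto simp: smooth_curve_def vimage_def Int_def)
  show "open {t \<in> I. \<gamma> t \<in> dom_of d}" by (intro op chart_cont(3) d)
  show "smooth_on {t \<in> I. \<gamma> t \<in> dom_of d} (\<lambda>t. snd d (\<gamma> t))"
  proof (rule smooth_on_local, clarify)
    fix t assume t: "t \<in> I" "\<gamma> t \<in> dom_of d"
    define b where "b = ref (\<gamma> t)"
    have b: "b \<in> A" "\<gamma> t \<in> dom_of b" "smooth_chart A b" using ref by (auto simp: b_def)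
    define N where "N = {t \<in> I. \<gamma> t \<in> dom_of b \<inter> dom_of d}"
    have N: "open N" unfolding N_def by (intro op open_Int chart_cont(3) b d)
    have "smooth_on {t \<in> I. \<gamma> t \<in> dom_of b} (\<lambda>t. snd b (\<gamma> t))"
      using \<gamma> b by (simp add: smooth_curve_def o_def)
    then have 2: "smooth_on N (\<lambda>t. snd b (\<gamma> t))" by (rule smooth_on_subset) (auto simp: N_def)
    have "smooth_on N (\<lambda>t. snd d (chart_inv b (snd b (\<gamma> t))))"
      by (rule smooth_on_compose[OF N transition_open[OF b(3) d] _ 2 transition_smooth[OF b(3) d]]) (auto simp: N_def)
    then have "smooth_on N (\<lambda>t. snd d (\<gamma> t))"
      by (rule smooth_on_cong[OF N, rotated]) (auto simp: N_def chart_simps(1)[OF b(3)])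
    then show "\<exists>U. open U \<and> t \<in> U \<and> smooth_on U (\<lambda>t. snd d (\<gamma> t))"
      using N t b by (intro exI[of _ N]) (auto simp: N_def)
  qed
qed

lemma smooth_family_chart:
  assumes \<phi>: "smooth_family A I \<phi>" and I: "open I" and c: "smooth_chart A c" and d: "smooth_chart A d"
  shows "smooth_on {(h, x). h \<in> I \<and> x \<in> img_of c \<and> \<phi> h (chart_inv c x) \<in> dom_of d}
      (\<lambda>(h, x). snd d (\<phi> h (chart_inv c x)))"
    and "open {(h, x). h \<in> I \<and> x \<in> img_of c \<and> \<phi> h (chart_inv c x) \<in> dom_of d}"
proof -
  have op: "open {(h, x). h \<in> I \<and> x \<in> snd e ` (dom_of e \<inter> C) \<and> \<phi> h (chart_inv e x) \<in> B}"
    if B: "open B" and C: "open C" and e: "smooth_chart A e" for B C e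
  proof -
    let ?D = "I \<times> (snd e ` (dom_of e \<inter> C))"
    have "continuous_on ?D (\<lambda>(h, x). \<phi> h (chart_inv e x))"
    proof -
      have 1: "continuous_on ?D (\<lambda>q. (fst q, chart_inv e (snd q)))"
        by (intro continuous_intros continuous_on_compose2[OF chart_cont(2)[OF e]]) auto
      have 2: "continuous_on (I \<times> UNIV) (\<lambda>(h, z). \<phi> h z)"
        using \<phi> by (simp add: smooth_family_def)
      have "continuous_on ?D (\<lambda>q. (\<lambda>(h, z). \<phi> h z) (fst q, chart_inv e (snd q)))"
        by (rule continuous_on_compose2[OF 2 1]) auto
      then show ?thesis by (simp add: case_prod_beta)
    qed
    moreover have "open ?D" using I chart_open[OF e C] by (intro open_Times)
    ultimately have "open (?D \<inter> (\<lambda>(h, x). \<phi> h (chart_inv e x)) -` B)"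
      using continuous_open_preimage B by blast
    moreover have "?D \<inter> (\<lambda>(h, x). \<phi> h (chart_inv e x)) -` B =
        {(h, x). h \<in> I \<and> x \<in> snd e ` (dom_of e \<inter> C) \<and> \<phi> h (chart_inv e x) \<in> B}" by auto
    ultimately show ?thesis by simp
  qed
  show "open {(h, x). h \<in> I \<and> x \<in> img_of c \<and> \<phi> h (chart_inv c x) \<in> dom_of d}"
    using op[OF chart_cont(3)[OF d] open_UNIV c] by simp
  show "smooth_on {(h, x). h \<in> I \<and> x \<in> img_of c \<and> \<phi> h (chart_inv c x) \<in> dom_of d}
      (\<lambda>(h, x). snd d (\<phi> h (chart_inv c x)))"
  proof (rule smooth_on_local, clarify)
    fix h p assume p: "h \<in> I" "p \<in> dom_of c" and p2: "\<phi> h (chart_inv c (snd c p)) \<in> dom_of d"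
    have p3: "\<phi> h p \<in> dom_of d" using p p2 chart_simps(1)[OF c] by simp
    define a where "a = ref p"
    define b where "b = ref (\<phi> h p)"
    have a: "a \<in> A" "p \<in> dom_of a" "smooth_chart A a" using ref by (auto simp: a_def)
    have b: "b \<in> A" "\<phi> h p \<in> dom_of b" "smooth_chart A b" using ref by (auto simp: b_def)
    define N where "N = {(h, x). h \<in> I \<and> x \<in> snd c ` (dom_of c \<inter> dom_of a) \<and>
      \<phi> h (chart_inv c x) \<in> dom_of d \<inter> dom_of b}"
    have N: "open N" unfolding N_def
      by (intro op c open_Int chart_cont(3) a b d)
    have 0: "smooth_on N (\<lambda>q. snd a (chart_inv c (snd q)))"
      by (rule smooth_on_compose[OF N transition_open[OF c a(3)] _ smooth_on_linear[OF bounded_linear_snd N]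
        transition_smooth[OF c a(3)]]) (auto simp: N_def)
    have 1: "smooth_on N (\<lambda>q. (fst q, snd a (chart_inv c (snd q))))"
      by (intro smooth_on_Pair N 0 smooth_on_linear[OF bounded_linear_fst])
    let ?S = "{(h, x). h \<in> I \<and> x \<in> img_of a \<and> \<phi> h (chart_inv a x) \<in> dom_of b}"
    have S: "open ?S" using op[OF chart_cont(3)[OF b(3)] open_UNIV a(3)] by simp
    have S': "smooth_on ?S (\<lambda>(h, x). snd b (\<phi> h (chart_inv a x)))"
      using \<phi> a b by (simp add: smooth_family_def)
    have "smooth_on N (\<lambda>q. (\<lambda>(h, x). snd b (\<phi> h (chart_inv a x))) (fst q, snd a (chart_inv c (snd q))))"
      by (rule smooth_on_compose[OF N S _ 1 S']) (auto simp: N_def chart_simps(1)[OF c] chart_simps(1)[OF a(3)])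
    then have 2: "smooth_on N (\<lambda>q. snd b (\<phi> (fst q) (chart_inv c (snd q))))"
      by (rule smooth_on_cong[OF N, rotated]) (auto simp: N_def chart_simps(1)[OF c] chart_simps(1)[OF a(3)])
    have "smooth_on N (\<lambda>q. snd d (chart_inv b (snd b (\<phi> (fst q) (chart_inv c (snd q))))))"
      by (rule smooth_on_compose[OF N transition_open[OF b(3) d] _ 2 transition_smooth[OF b(3) d]])
        (auto simp: N_def)
    then have "smooth_on N (\<lambda>(h, x). snd d (\<phi> h (chart_inv c x)))"
      by (rule smooth_on_cong[OF N, rotated]) (auto simp: N_def chart_simps(1)[OF b(3)])
    then show "\<exists>U. open U \<and> (h, snd c p) \<in> U \<and> smooth_on U (\<lambda>(h, x). snd d (\<phi> h (chart_inv c x)))"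
      using N p p3 a b by (intro exI[of _ N]) (auto simp: N_def chart_simps(1)[OF c])
  qed
qed

section \<open>Velocities, differentials and tangent spaces in charts\<close>

lemma velocity_change_chart:
  assumes cont: "continuous (at t within S) \<gamma>" and t: "t \<in> S"
    and c: "smooth_chart A c" "\<gamma> t \<in> dom_of c" and d: "smooth_chart A d" "\<gamma> t \<in> dom_of d"
    and w: "((\<lambda>s. snd c (\<gamma> s)) has_vector_derivative w) (at t within S)"
  shows "((\<lambda>s. snd d (\<gamma> s)) has_vector_derivative chart_deriv c d (\<gamma> t) w) (at t within S)"
proof -
  have lin: "linear (chart_deriv c d (\<gamma> t))" by (rule chart_deriv_linear[OF c(1) d(1) c(2) d(2)])
  have "((\<lambda>s. snd d (chart_inv c (snd c (\<gamma> s)))) has_derivative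
      (\<lambda>h. chart_deriv c d (\<gamma> t) (h *\<^sub>R w))) (at t within S)"
    by (rule has_derivative_compose[OF w[unfolded has_vector_derivative_def] chart_deriv[OF c(1) d(1) c(2) d(2)]])
  then have 1: "((\<lambda>s. snd d (chart_inv c (snd c (\<gamma> s)))) has_derivative
      (\<lambda>h. h *\<^sub>R chart_deriv c d (\<gamma> t) w)) (at t within S)" by (simp add: linear_scale[OF lin])
  have "\<forall>\<^sub>F s in at t within S. \<gamma> s \<in> dom_of c"
    using cont chart_cont(3)[OF c(1)] c(2) unfolding continuous_within tendsto_def by blast
  then have "\<forall>\<^sub>F s in at t within S. snd d (chart_inv c (snd c (\<gamma> s))) = snd d (\<gamma> s)"
    by eventually_elim (simp add: chart_simps(1)[OF c(1)])
  then show ?thesis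
    unfolding has_vector_derivative_def
    using has_derivative_transform_eventually[OF 1 _ _ t] chart_simps(1)[OF c(1)] c(2) by simp
qed

text \<open>Continuity belongs to the notion because coordinates carry information only inside a
  chart domain: it keeps the curve there for times near \<open>t\<close>. The change of chart is
  then applied in both directions.\<close>

lemma has_velocity_chart:
  assumes c: "smooth_chart A c" "\<gamma> t \<in> dom_of c" and t: "t \<in> S"
  shows "has_velocity A \<gamma> (chart_deriv c (ref (\<gamma> t)) (\<gamma> t) w) t S \<longleftrightarrow>
    continuous (at t within S) \<gamma> \<and> ((\<lambda>s. snd c (\<gamma> s)) has_vector_derivative w) (at t within S)"
proof -
  let ?a = "ref (\<gamma> t)"
  note a = ref(3,2)[of "\<gamma> t"]
  have "((\<lambda>s. snd ?a (\<gamma> s)) has_vector_derivative chart_deriv c ?a (\<gamma> t) w) (at t within S) \<longleftrightarrow>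
    ((\<lambda>s. snd c (\<gamma> s)) has_vector_derivative w) (at t within S)"
    if "continuous (at t within S) \<gamma>"
    using velocity_change_chart[OF that t c a]
      velocity_change_chart[OF that t a c, of "chart_deriv c ?a (\<gamma> t) w"]
    by (auto simp: chart_deriv_cocycle[OF c a c] chart_deriv_same[OF c])
  then show ?thesis by (auto simp: has_velocity_def o_def)
qed

lemma chart_deriv_inverse:
  assumes c: "smooth_chart A c" "p \<in> dom_of c" and d: "smooth_chart A d" "p \<in> dom_of d"
  shows "chart_deriv d c p (chart_deriv c d p u) = u"
  using chart_deriv_cocycle[OF c d c] chart_deriv_same[OF c] by simp

lemma mderiv_chart:
  assumes f: "smooth_fun A f" and c: "smooth_chart A c" "p \<in> dom_of c"
  shows "mderiv A f p (chart_deriv c (ref p) p w) = frechet_derivative (\<lambda>x. f (chart_inv c x)) (at (snd c p)) w"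
proof -
  note a = ref(3,2)[of p]
  have "((\<lambda>y. f (chart_inv (ref p) y)) has_derivative mderiv A f p) (at (snd (ref p) (chart_inv c (snd c p))))"
    using smooth_on_has_derivative[OF smooth_fun_chart[OF f a(1)], of "snd (ref p) p"] a(2)
    by (simp add: mderiv_def o_def chart_simps(1)[OF c])
  from has_derivative_compose[OF chart_deriv[OF c(1) a(1) c(2) a(2)] this]
  have "((\<lambda>x. f (chart_inv (ref p) (snd (ref p) (chart_inv c x)))) has_derivative
     (\<lambda>w. mderiv A f p (chart_deriv c (ref p) p w))) (at (snd c p))" .
  then have "((\<lambda>x. f (chart_inv c x)) has_derivative
     (\<lambda>w. mderiv A f p (chart_deriv c (ref p) p w))) (at (snd c p))"
    by (rule has_derivative_transform_within_open[OF _ transition_open[OF c(1) a(1)]])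
      (use c a chart_simps(1) in auto)
  then show ?thesis using frechet_derivative_at by metis
qed

lemma in_chart_eq:
  assumes c: "smooth_chart A c" "p \<in> dom_of c"
  shows "in_chart A \<tau> c (snd c p) u v = \<tau> p (chart_deriv c (ref p) p u) (chart_deriv c (ref p) p v)"
  by (simp add: in_chart_def to_ref_chart_deriv[OF c] chart_simps(1)[OF c])

lemma bilinear_expand:
  fixes f :: "'e \<Rightarrow> 'e \<Rightarrow> real"
  assumes "bilinear f"
  shows "f u v = (\<Sum>b\<in>Basis. (v \<bullet> b) * f u b)" "f u v = (\<Sum>b\<in>Basis. (u \<bullet> b) * f b v)"
  using linear_expand_Basis[of "f u" v] linear_expand_Basis[of "\<lambda>u. f u v" u] assms
  by (auto simp: bilinear_def)

text \<open>The two vectors may come from different charts: below, one is adapted to a leaf and the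
  other to \<open>M\<close>. The reference chart can jump from point to point, so both vectors are
  first moved to a fixed atlas chart, where the coefficients of \<tau> are smooth.\<close>

lemma tensor_mixed_smooth:
  assumes \<tau>: "smooth_2tensor A \<tau>" and c: "smooth_chart A c" and d: "smooth_chart A d" and e: "smooth_chart A e"
  shows "smooth_on (snd e ` (dom_of c \<inter> dom_of d \<inter> dom_of e))
    (\<lambda>x. let p = chart_inv e x in \<tau> p (chart_deriv c (ref p) p u) (chart_deriv d (ref p) p v))"
proof (rule smooth_on_local, clarify)
  fix p assume p: "p \<in> dom_of c" "p \<in> dom_of d" "p \<in> dom_of e"
  define a where "a = ref p"
  have a: "a \<in> A" "p \<in> dom_of a" "smooth_chart A a" using ref by (auto simp: a_def)
  define N where "N = snd e ` (dom_of e \<inter> (dom_of c \<inter> dom_of d \<inter> dom_of a))"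
  have N: "open N" unfolding N_def by (intro chart_open e open_Int chart_cont(3) a c d)
  have u: "smooth_on N (\<lambda>x. chart_deriv c a (chart_inv e x) u)"
    by (rule smooth_on_subset[OF chart_deriv_smooth[OF c a(3) e]]) (auto simp: N_def)
  have v: "smooth_on N (\<lambda>x. chart_deriv d a (chart_inv e x) v)"
    by (rule smooth_on_subset[OF chart_deriv_smooth[OF d a(3) e]]) (auto simp: N_def)
  have \<tau>': "smooth_on N (\<lambda>x. in_chart A \<tau> a (snd a (chart_inv e x)) b b')" for b b'
  proof (rule smooth_on_compose[OF N chart_cont(4)[OF a(3)]])
    show "smooth_on N (\<lambda>x. snd a (chart_inv e x))"
      by (rule smooth_on_subset[OF transition_smooth[OF e a(3)]]) (auto simp: N_def)
    show "smooth_on (img_of a) (\<lambda>x. in_chart A \<tau> a x b b')"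
      using \<tau> a by (auto simp: smooth_2tensor_def)
  qed (auto simp: N_def chart_simps(1)[OF e])
  have "smooth_on N (\<lambda>x. \<Sum>b\<in>Basis. (chart_deriv c a (chart_inv e x) u \<bullet> b) *
      (\<Sum>b'\<in>Basis. (chart_deriv d a (chart_inv e x) v \<bullet> b') * in_chart A \<tau> a (snd a (chart_inv e x)) b b'))"
    by (intro smooth_on_sum N smooth_on_bilinear[OF bounded_bilinear_mult] \<tau>'
       smooth_on_bounded_linear[OF bounded_linear_inner_left] u v)
  then have "smooth_on N (\<lambda>x. let p = chart_inv e x in \<tau> p (chart_deriv c (ref p) p u) (chart_deriv d (ref p) p v))"
  proof (rule smooth_on_cong[OF N, rotated])
    fix x assume "x \<in> N"
    then obtain q where q: "x = snd e q" "q \<in> dom_of e" "q \<in> dom_of c" "q \<in> dom_of d" "q \<in> dom_of a"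
      by (auto simp: N_def)
    have bil: "bilinear (\<tau> q)" using \<tau> by (simp add: smooth_2tensor_def)
    have lin: "linear (chart_deriv a (ref q) q)"
      by (rule chart_deriv_linear[OF a(3) ref(3) q(5) ref(2)])
    have bil': "bilinear (\<lambda>u v. \<tau> q (chart_deriv a (ref q) q u) (chart_deriv a (ref q) q v))"
      using bil linear_compose[OF lin] by (auto simp: bilinear_def o_def)
    show "(\<Sum>b\<in>Basis. (chart_deriv c a (chart_inv e x) u \<bullet> b) *
      (\<Sum>b'\<in>Basis. (chart_deriv d a (chart_inv e x) v \<bullet> b') * in_chart A \<tau> a (snd a (chart_inv e x)) b b')) =
      (let p = chart_inv e x in \<tau> p (chart_deriv c (ref p) p u) (chart_deriv d (ref p) p v))"
      using bilinear_expand(2)[OF bil', of "chart_deriv c a q u" "chart_deriv d a q v"]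
      by (simp add: q(1) chart_simps(1)[OF e q(2)] in_chart_eq[OF a(3) q(5)]
        chart_deriv_cocycle[OF c q(3) a(3) q(5) ref(3,2)] chart_deriv_cocycle[OF d q(4) a(3) q(5) ref(3,2)]
        flip: bilinear_expand(1)[OF bil'])
  qed
  then show "\<exists>U. open U \<and> snd e p \<in> U \<and> smooth_on U (\<lambda>x. let p = chart_inv e x in
      \<tau> p (chart_deriv c (ref p) p u) (chart_deriv d (ref p) p v))"
    using N p a by (intro exI[of _ N]) (auto simp: N_def)
qed

lemma line_smooth_curve:
  assumes c: "smooth_chart A c" and I: "open I" and x: "\<And>t. t \<in> I \<Longrightarrow> x + t *\<^sub>R u \<in> img_of c"
  shows "smooth_curve A I (\<lambda>t. chart_inv c (x + t *\<^sub>R u))"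
proof -
  have cont: "continuous_on I (\<lambda>t. chart_inv c (x + t *\<^sub>R u))"
    by (intro continuous_on_compose2[OF chart_cont(2)[OF c]] continuous_intros) (use x in auto)
  have sm: "smooth_on J (\<lambda>t. x + t *\<^sub>R u)" if "open J" for J
    by (intro smooth_on_add smooth_on_const smooth_on_linear bounded_linear_scaleR_left that)
  have "smooth_on {t \<in> I. chart_inv c (x + t *\<^sub>R u) \<in> dom_of d} (\<lambda>t. snd d (chart_inv c (x + t *\<^sub>R u)))"
    if d: "smooth_chart A d" for d
  proof -
    have op: "open {t \<in> I. chart_inv c (x + t *\<^sub>R u) \<in> dom_of d}"
      using continuous_open_preimage[OF cont I chart_cont(3)[OF d]] by (simp add: vimage_def Int_def)
    show ?thesis
    proof (rule smooth_on_compose[OF op transition_open[OF c d] _ sm[OF op] transition_smooth[OF c d]], clarify)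
      fix t assume t: "t \<in> I" "chart_inv c (x + t *\<^sub>R u) \<in> dom_of d"
      then show "x + t *\<^sub>R u \<in> snd c ` (dom_of c \<inter> dom_of d)"
        using x[OF t(1)] chart_simps(2,3)[OF c x[OF t(1)]] by (metis IntI image_eqI)
    qed
  qed
  then show ?thesis using cont atlas_smooth_chart by (simp add: smooth_curve_def o_def)
qed

text \<open>A curve in \<open>N\<close> has coordinates in \<open>E\<close>, hence its coordinate
  velocity lies in \<open>E\<close>. Conversely, the coordinate line through \<open>snd c p\<close>
  in a direction of \<open>E\<close> stays in the slice for a short time.\<close>

lemma tangent_slice:
  assumes c: "smooth_chart A c" "p \<in> dom_of c" and E: "subspace E" and N: "N \<inter> dom_of c = slice c E" and p: "p \<in> N"
  shows "tangent A N p = chart_deriv c (ref p) p ` E"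
proof (intro set_eqI iffI)
  fix u assume "u \<in> tangent A N p"
  then obtain \<gamma> \<epsilon> where g: "\<epsilon> > 0" "smooth_curve A {-\<epsilon><..<\<epsilon>} \<gamma>" "\<And>t. t \<in> {-\<epsilon><..<\<epsilon>} \<Longrightarrow> \<gamma> t \<in> N"
    "\<gamma> 0 = p" "has_velocity A \<gamma> u 0 {-\<epsilon><..<\<epsilon>}"
    unfolding tangent_def by blast
  define w where "w = chart_deriv (ref p) c p u"
  have u: "u = chart_deriv c (ref p) p w"
    unfolding w_def using chart_deriv_inverse[OF ref(3,2) c] by simp
  have "((\<lambda>s. snd c (\<gamma> s)) has_vector_derivative w) (at 0 within {-\<epsilon><..<\<epsilon>})"
    using has_velocity_chart[of c \<gamma> 0 "{-\<epsilon><..<\<epsilon>}" w] c g u by auto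
  then have d: "((\<lambda>s. snd c (\<gamma> s)) has_derivative (\<lambda>h. h *\<^sub>R w)) (at 0)"
    using g(1) at_within_open[of 0 "{-\<epsilon><..<\<epsilon>}"] by (simp add: has_vector_derivative_def)
  have "1 *\<^sub>R w \<in> E"
  proof (rule derivative_in_subspace[OF E d smooth_curve_chart(2)[OF g(2) _ c(1)] _ subspace_UNIV])
    show "snd c (\<gamma> s) \<in> E" if "s \<in> UNIV \<inter> {t \<in> {-\<epsilon><..<\<epsilon>}. \<gamma> t \<in> dom_of c}" for s
      using that g(3)[of s] N by (auto simp: slice_def)
  qed (use g c in auto)
  then show "u \<in> chart_deriv c (ref p) p ` E" using u by auto
next
  fix u assume "u \<in> chart_deriv c (ref p) p ` E"
  then obtain w where w: "w \<in> E" "u = chart_deriv c (ref p) p w" by blast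
  define x where "x = snd c p"
  have x: "x \<in> img_of c" using c by (simp add: x_def)
  have xE: "x \<in> E" using N p c by (auto simp: slice_def x_def)
  have "open ((\<lambda>t. x + t *\<^sub>R w) -` img_of c)" by (intro open_vimage chart_cont(4)[OF c(1)] continuous_intros)
  moreover have "0 \<in> (\<lambda>t. x + t *\<^sub>R w) -` img_of c" using x by auto
  ultimately obtain \<epsilon> where \<epsilon>: "\<epsilon> > 0" "ball 0 \<epsilon> \<subseteq> (\<lambda>t. x + t *\<^sub>R w) -` img_of c"
    using openE by blast
  let ?I = "{-\<epsilon><..<\<epsilon>}"
  have I: "x + t *\<^sub>R w \<in> img_of c" if "t \<in> ?I" for t using \<epsilon>(2) that by (auto simp: subset_iff)
  let ?g = "\<lambda>t. chart_inv c (x + t *\<^sub>R w)"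
  have g: "smooth_curve A ?I ?g" by (rule line_smooth_curve[OF c(1) _ I]) auto
  have g0: "?g 0 = p" using chart_simps(1)[OF c] by (simp add: x_def)
  have gN: "?g t \<in> N" if "t \<in> ?I" for t
  proof -
    have "x + t *\<^sub>R w \<in> E" using xE w E by (auto intro: subspace_add subspace_scale)
    then have "?g t \<in> slice c E" using chart_simps(2,3)[OF c(1) I[OF that]] by (simp add: slice_def)
    then show ?thesis using N by blast
  qed
  have "((\<lambda>t. x + t *\<^sub>R w) has_vector_derivative w) (at 0 within ?I)"
    by (auto intro!: derivative_eq_intros)
  then have "((\<lambda>t. snd c (?g t)) has_vector_derivative w) (at 0 within ?I)"
    by (rule has_vector_derivative_transform[rotated 2]) (use \<epsilon>(1) chart_simps(2)[OF c(1) I] in auto)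
  moreover have "continuous (at 0 within ?I) ?g"
    using g \<epsilon>(1) unfolding smooth_curve_def continuous_on_eq_continuous_within by auto
  ultimately have "has_velocity A ?g u 0 ?I"
    using has_velocity_chart[of c ?g 0 ?I w] c \<epsilon>(1) g0 w by auto
  then show "u \<in> tangent A N p"
    unfolding tangent_def using \<epsilon>(1) g gN g0 by (intro CollectI exI[of _ ?g] exI[of _ \<epsilon>]) auto
qed

end

section \<open>Coisotropic submanifolds and their leaves\<close>

text \<open>The operator representing a bilinear form with respect to the Euclidean inner product;
  nondegeneracy of the form becomes invertibility of a linear map.\<close>

definition form_op :: "('e::euclidean_space \<Rightarrow> 'e \<Rightarrow> real) \<Rightarrow> 'e \<Rightarrow> 'e" where
  "form_op \<beta> u = (\<Sum>b\<in>Basis. \<beta> u b *\<^sub>R b)"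

lemma form_op_inner:
  assumes "bilinear \<beta>"
  shows "form_op \<beta> u \<bullet> v = \<beta> u v"
proof -
  have "linear (\<beta> u)" using assms by (simp add: bilinear_def)
  then have "\<beta> u v = (\<Sum>b\<in>Basis. (v \<bullet> b) * \<beta> u b)" using linear_expand_Basis[of "\<beta> u" v] by simp
  then show ?thesis by (simp add: form_op_def inner_sum_left inner_commute[of v] mult.commute)
qed

lemma form_op_linear: "bilinear \<beta> \<Longrightarrow> linear (form_op \<beta>)"
  unfolding form_op_def
  by (intro linearI) (auto simp: bilinear_ladd bilinear_lmul scaleR_left_distrib sum.distrib scaleR_sum_right)

lemma form_op_bij:
  assumes bil: "bilinear \<beta>" and nondeg: "\<And>u. (\<And>v. \<beta> u v = 0) \<Longrightarrow> u = 0"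
  shows "inj (form_op \<beta>)" "surj (form_op \<beta>)"
proof -
  show inj: "inj (form_op \<beta>)"
  proof (rule linear_injective_0[OF form_op_linear[OF bil], THEN iffD2], intro allI impI)
    fix u assume "form_op \<beta> u = 0"
    then have "\<beta> u v = 0" for v using form_op_inner[OF bil, of u v] by simp
    then show "u = 0" by (rule nondeg)
  qed
  then show "surj (form_op \<beta>)" using linear_injective_imp_surjective[OF form_op_linear[OF bil]] by simp
qed

text \<open>The joint map \<open>(x, u) \<mapsto> R x u\<close> is Lipschitz near
  \<open>(x0, 0)\<close>. By linearity a vector may be rescaled to norm \<open>d / 4\<close>, which
  extends the bound to all \<open>u\<close> and explains the factor \<open>4 / d\<close>.\<close>

lemma smooth_bilinear_lipschitz:
  fixes R :: "'e::euclidean_space \<Rightarrow> 'e \<Rightarrow> 'b::real_normed_vector"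
  assumes S: "open S" and R: "\<And>u. smooth_on S (\<lambda>x. R x u)" and lin: "\<And>x. x \<in> S \<Longrightarrow> linear (R x)" and x0: "x0 \<in> S"
  obtains d K where "d > 0" "K > 0" "ball x0 d \<subseteq> S"
    "\<And>x y u. x \<in> ball x0 d \<Longrightarrow> y \<in> ball x0 d \<Longrightarrow> norm (R x u - R y u) \<le> K * norm (x - y) * norm u"
proof -
  let ?T = "S \<times> (UNIV :: 'e set)"
  have T: "open ?T" using S by (simp add: open_Times)
  let ?g = "\<lambda>q. R (fst q) (snd q)"
  have "smooth_on ?T (\<lambda>q. R (fst q) b)" for b
    by (rule smooth_on_compose[OF T S _ smooth_on_linear[OF bounded_linear_fst T] R]) auto
  then have "smooth_on ?T (\<lambda>q. \<Sum>b\<in>Basis. (snd q \<bullet> b) *\<^sub>R R (fst q) b)"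
    by (intro smooth_on_sum T smooth_on_bilinear[OF bounded_bilinear_scaleR]
      smooth_on_bounded_linear[OF bounded_linear_inner_left] smooth_on_linear[OF bounded_linear_snd])
  then have g: "smooth_on ?T ?g"
    by (rule smooth_on_cong[OF T, rotated]) (auto simp flip: linear_expand_Basis[OF lin])
  obtain d K where d: "d > 0" "K > 0" "ball (x0, 0) d \<subseteq> ?T"
    "\<And>p q. p \<in> ball (x0, 0) d \<Longrightarrow> q \<in> ball (x0, 0) d \<Longrightarrow> norm (?g p - ?g q) \<le> K * norm (p - q)"
    using smooth_on_locally_lipschitz[OF T g, of "(x0, 0)"] x0 by auto
  have in_ball: "(x, u) \<in> ball (x0, 0) d" if "x \<in> ball x0 (d / 2)" "norm u < d / 2" for x and u :: 'e
    using that norm_Pair_le[of "x0 - x" "0 - u"] by (auto simp: dist_norm)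
  have sub: "ball x0 (d / 2) \<subseteq> S"
  proof
    fix x assume "x \<in> ball x0 (d / 2)"
    then have "(x, 0 :: 'e) \<in> ball (x0, 0) d" using in_ball[of x 0] d by simp
    then show "x \<in> S" using d(3) by blast
  qed
  show thesis
  proof (rule that[of "d / 2" "K * (4 / d)"])
    fix x y u assume x: "x \<in> ball x0 (d / 2)" and y: "y \<in> ball x0 (d / 2)"
    show "norm (R x u - R y u) \<le> K * (4 / d) * norm (x - y) * norm u"
    proof (cases "u = 0")
      case True
      then show ?thesis using lin sub x y by (auto simp: subset_iff linear_0)
    next
      case False
      define s where "s = d / (4 * norm u)"
      have s: "s > 0" "norm (s *\<^sub>R u) = d / 4" using False d by (auto simp: s_def)
      have "norm (R x (s *\<^sub>R u) - R y (s *\<^sub>R u)) \<le> K * norm (x - y)"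
        using d(4)[OF in_ball[OF x] in_ball[OF y], of "s *\<^sub>R u" "s *\<^sub>R u"] s d by (simp add: norm_Pair)
      moreover have "R x (s *\<^sub>R u) - R y (s *\<^sub>R u) = s *\<^sub>R (R x u - R y u)"
        using x y sub lin by (simp add: subset_iff linear_scale scaleR_diff_right)
      ultimately have "s * norm (R x u - R y u) \<le> K * norm (x - y)" using s by simp
      then have "norm (R x u - R y u) \<le> K * norm (x - y) / s" using s by (simp add: field_simps)
      then show ?thesis by (simp add: s_def mult_ac)
    qed
  qed (use d sub in auto)
qed

section \<open>Curves tangent to the kernel distribution\<close>

lemma gronwall_zero:
  fixes w :: "real \<Rightarrow> 'b::real_normed_vector"
  assumes d: "\<delta> \<ge> 0" "K \<ge> 0" "K * \<delta> < 1" and w0: "w t0 = 0"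
    and w: "\<And>t. t \<in> cball t0 \<delta> \<Longrightarrow> (w has_vector_derivative w' t) (at t)"
    and w': "\<And>t. t \<in> cball t0 \<delta> \<Longrightarrow> norm (w' t) \<le> K * norm (w t)"
    and t: "t \<in> cball t0 \<delta>"
  shows "w t = 0"
proof -
  have "continuous_on (cball t0 \<delta>) (\<lambda>t. norm (w t))"
    by (intro continuous_on_norm continuous_at_imp_continuous_on ballI has_vector_derivative_continuous[OF w])
  then obtain t1 where t1: "t1 \<in> cball t0 \<delta>" "\<And>t. t \<in> cball t0 \<delta> \<Longrightarrow> norm (w t) \<le> norm (w t1)"
    using continuous_attains_sup[OF compact_cball, of t0 \<delta>] d by force
  \<comment> \<open>At the time \<open>t1\<close> of largest norm the mean value inequality bounds
    \<open>norm (w t1)\<close> by \<open>K * \<delta>\<close> times itself, and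
    \<open>K * \<delta> < 1\<close>. The shortness of the interval replaces the exponential of the
    usual Gronwall bound.\<close>
  have "norm (w t1 - w t0) \<le> (K * norm (w t1)) * norm (t1 - t0)"
  proof (rule differentiable_bound[OF convex_cball])
    fix s assume s: "s \<in> cball t0 \<delta>"
    show "(w has_derivative (\<lambda>h. h *\<^sub>R w' s)) (at s within cball t0 \<delta>)"
      using w[OF s] has_derivative_at_withinI unfolding has_vector_derivative_def by blast
    have "norm (w' s) \<le> K * norm (w t1)"
      using w'[OF s] t1(2)[OF s] d mult_left_mono order_trans by blast
    then show "onorm (\<lambda>h. h *\<^sub>R w' s) \<le> K * norm (w t1)"
      by (intro onorm_le) (simp add: mult.commute mult_left_mono)
  qed (use t1 d in auto)
  also have "\<dots> \<le> (K * norm (w t1)) * \<delta>"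
    using t1 d by (intro mult_left_mono) (auto simp: dist_norm norm_minus_commute)
  finally have "norm (w t1) \<le> (K * \<delta>) * norm (w t1)" using w0 by (simp add: mult_ac)
  then have "(1 - K * \<delta>) * norm (w t1) \<le> 0" by (simp add: algebra_simps)
  moreover have "1 - K * \<delta> > 0" using d by simp
  ultimately have "norm (w t1) \<le> 0" by (simp add: mult_le_0_iff)
  then show ?thesis using t1(2)[OF t] by simp
qed

text \<open>Near a point \<open>x'\<close> of \<open>E'\<close>, a vector \<open>u\<close> in the distribution \<open>{u. \<forall>y\<in>E. \<beta> x u y = 0}\<close> is
  \<open>O(norm (x - x') * norm u)\<close>-close to the distribution at \<open>x'\<close>, which is contained in \<open>E'\<close>; so the
  distance of the curve to \<open>E'\<close> satisfies a Gronwall inequality.\<close>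

lemma curve_stays_in_subspace:
  fixes \<beta> :: "'e::euclidean_space \<Rightarrow> 'e \<Rightarrow> 'e \<Rightarrow> real" and x :: "real \<Rightarrow> 'e"
  assumes S: "open S" and \<beta>: "\<And>u v. smooth_on S (\<lambda>x. \<beta> x u v)"
    and bil: "\<And>x. x \<in> S \<Longrightarrow> bilinear (\<beta> x)"
    and nondeg: "\<And>x u. x \<in> S \<Longrightarrow> (\<And>v. \<beta> x u v = 0) \<Longrightarrow> u = 0"
    and E': "subspace E'"
    and kernel: "\<And>x u. x \<in> E' \<inter> S \<Longrightarrow> (\<And>y. y \<in> E \<Longrightarrow> \<beta> x u y = 0) \<Longrightarrow> u \<in> E'"
    and I: "open I" "t0 \<in> I" and xS: "\<And>t. t \<in> I \<Longrightarrow> x t \<in> S" and x0: "x t0 \<in> E'"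
    and x: "\<And>t. t \<in> I \<Longrightarrow> (x has_vector_derivative x' t) (at t)" and x': "continuous_on I x'"
    and x\<beta>: "\<And>t y. t \<in> I \<Longrightarrow> y \<in> E \<Longrightarrow> \<beta> (x t) (x' t) y = 0"
  obtains \<delta> where "\<delta> > 0" "\<And>t. \<bar>t - t0\<bar> < \<delta> \<Longrightarrow> t \<in> I \<and> x t \<in> E'"
proof -
  define z where "z = x t0"
  have zS: "z \<in> S" using xS I by (simp add: z_def)
  define R where "R y = form_op (\<beta> y)" for y
  have R_inner: "R y u \<bullet> v = \<beta> y u v" if "y \<in> S" for y u v
    unfolding R_def by (rule form_op_inner[OF bil[OF that]])
  have R_lin: "linear (R y)" if "y \<in> S" for y
    unfolding R_def by (rule form_op_linear[OF bil[OF that]])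
  have R_bij: "inj (R y)" "surj (R y)" if "y \<in> S" for y
    using form_op_bij[OF bil[OF that] nondeg[OF that]] by (auto simp: R_def)
  have "smooth_on S (\<lambda>y. R y u)" for u
    unfolding R_def form_op_def by (intro smooth_on_sum S smooth_on_bounded_linear[OF bounded_linear_scaleR_left] \<beta>)
  from smooth_bilinear_lipschitz[OF S this R_lin zS] obtain d KR where d: "d > 0" "KR > 0" "ball z d \<subseteq> S"
    "\<And>x y u. x \<in> ball z d \<Longrightarrow> y \<in> ball z d \<Longrightarrow> norm (R x u - R y u) \<le> KR * norm (x - y) * norm u"
    by blast
  obtain B where B: "B > 0" "\<And>u. B * norm u \<le> norm (R z u)"
    using linear_inj_bounded_below_pos[OF R_lin[OF zS] R_bij(1)[OF zS]] by blast
  obtain Q :: "'e \<Rightarrow> 'e" where Q: "bounded_linear Q" "\<And>x. Q x = 0 \<longleftrightarrow> x \<in> E'" "\<And>x. x - Q x \<in> E'"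
    using subspace_projection[OF E'] by metis
  note Q_lin = bounded_linear.linear[OF Q(1)]
  obtain KQ where KQ: "KQ > 0" "\<And>v. norm (Q v) \<le> KQ * norm v"
    using bounded_linear_normE[OF Q(1)] by blast
  \<comment> \<open>Within this radius the operators \<open>R y\<close> keep half of the lower bound
    \<open>B\<close> of \<open>R z\<close>.\<close>
  define r where "r = min d (B / (2 * KR))"
  have r: "r > 0" "r \<le> d" "KR * r \<le> B / 2" using d B by (auto simp: r_def min_def field_simps)
  have below: "B / 2 * norm u \<le> norm (R y u)" if y: "y \<in> ball z r" for y u
  proof -
    have "norm (R z u - R y u) \<le> KR * norm (z - y) * norm u" using d(4)[of z y u] y r d by auto
    also have "\<dots> \<le> KR * r * norm u"
      using y d by (intro mult_right_mono mult_left_mono) (auto simp: dist_norm)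
    also have "\<dots> \<le> B / 2 * norm u" using r by (intro mult_right_mono) auto
    finally have "norm (R z u - R y u) \<le> B / 2 * norm u" .
    then show ?thesis using B(2)[of u] norm_triangle_sub[of "R z u" "R y u"] by linarith
  qed
  define K1 where "K1 = KQ * (2 * KR * KQ / B)"
  have Q_est: "norm (Q u) \<le> KQ * (2 * KR / B) * norm (Q y) * norm u"
    if y: "y \<in> ball z (r / (1 + KQ))" and u: "\<And>e. e \<in> E \<Longrightarrow> \<beta> y u e = 0" for y u
  proof -
    \<comment> \<open>\<open>p\<close> is the projection of \<open>y\<close> to \<open>E'\<close>.
      The vector \<open>u'\<close> chosen below represents at \<open>p\<close> the same covector as
      \<open>u\<close> does at \<open>y\<close>, hence satisfies the kernel condition at
      \<open>p\<close> and lies in \<open>E'\<close>; so \<open>Q u\<close> is controlled by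
      \<open>u - u'\<close>.\<close>
    define p where "p = y - Q y"
    have Qz: "Q z = 0" using Q(2) x0 by (simp add: z_def)
    have r1: "r / (1 + KQ) \<le> r" using KQ r by (simp add: field_simps)
    have yr: "y \<in> ball z r" using y r1 by auto
    have "norm (z - p) \<le> norm (z - y) + norm (Q (y - z))"
      using norm_triangle_ineq[of "z - y" "Q y"] Qz by (simp add: p_def linear_diff[OF Q_lin] algebra_simps)
    also have "\<dots> \<le> (1 + KQ) * norm (z - y)"
      using KQ(2)[of "y - z"] by (simp add: algebra_simps norm_minus_commute)
    also have "\<dots> < (1 + KQ) * (r / (1 + KQ))"
      using y KQ by (intro mult_strict_left_mono) (auto simp: dist_norm)
    also have "\<dots> = r" using KQ by simp
    finally have pr: "p \<in> ball z r" by (simp add: dist_norm)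
    have yS: "y \<in> S" and pS: "p \<in> S" using yr pr r d(3) by auto
    obtain u' where u': "R p u' = R y u" using R_bij(2)[OF pS] by (metis surjD)
    have "\<beta> p u' e = 0" if "e \<in> E" for e
      using u[OF that] R_inner[OF pS, of u' e] R_inner[OF yS, of u e] u' by simp
    then have "u' \<in> E'" using kernel[of p u'] Q(3) pS by (simp add: p_def)
    then have Qu: "Q u = Q (u - u')" using Q(2)[of u'] by (simp add: linear_diff[OF Q_lin])
    have "B / 2 * norm (u - u') \<le> norm (R p (u - u'))" by (rule below[OF pr])
    also have "R p (u - u') = R p u - R y u" using u' by (simp add: linear_diff[OF R_lin[OF pS]])
    also have "norm (R p u - R y u) \<le> KR * norm (p - y) * norm u" using d(4)[of p y u] pr yr r by auto
    also have "norm (p - y) = norm (Q y)" by (simp add: p_def)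
    finally have "norm (u - u') \<le> (2 * KR / B) * norm (Q y) * norm u" using B by (simp add: field_simps)
    then have "KQ * norm (u - u') \<le> KQ * ((2 * KR / B) * norm (Q y) * norm u)" using KQ by (intro mult_left_mono) auto
    then show ?thesis using KQ(2)[of "u - u'"] Qu by (simp add: mult_ac)
  qed
  have cont_x: "continuous_on I x"
    by (intro continuous_at_imp_continuous_on ballI has_vector_derivative_continuous[OF x])
  have "open (I \<inter> x -` ball z (r / (1 + KQ)))"
    by (intro continuous_open_preimage cont_x I open_ball)
  moreover have "t0 \<in> I \<inter> x -` ball z (r / (1 + KQ))" using I r KQ by (auto simp: z_def)
  ultimately obtain e1 where e1: "e1 > 0" "ball t0 e1 \<subseteq> I \<inter> x -` ball z (r / (1 + KQ))"
    using openE by blast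
  have "open (I \<inter> x' -` ball (x' t0) 1)"
    by (intro continuous_open_preimage x' I open_ball)
  moreover have "t0 \<in> I \<inter> x' -` ball (x' t0) 1" using I by auto
  ultimately obtain e2 where e2: "e2 > 0" "ball t0 e2 \<subseteq> I \<inter> x' -` ball (x' t0) 1"
    using openE by blast
  define Mx where "Mx = norm (x' t0) + 1"
  have Mx: "norm (x' t) \<le> Mx" if "t \<in> ball t0 e2" for t
    using that e2(2) norm_triangle_sub[of "x' t" "x' t0"] by (auto simp: Mx_def dist_norm norm_minus_commute)
  define K where "K = KQ * (2 * KR / B) * Mx"
  have K: "K \<ge> 0" using KQ d B by (auto simp: K_def Mx_def)
  define \<delta> where "\<delta> = min (min e1 e2 / 2) (1 / (2 * (K + 1)))"
  have \<delta>: "\<delta> > 0" "\<delta> < e1" "\<delta> < e2" using e1 e2 K by (auto simp: \<delta>_def)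
  have "K * \<delta> \<le> K * (1 / (2 * (K + 1)))" using K by (intro mult_left_mono) (auto simp: \<delta>_def)
  also have "\<dots> < 1" using K by (simp add: field_simps)
  finally have K\<delta>: "K * \<delta> < 1" .
  have e: "t \<in> I" "t \<in> ball t0 e1" "t \<in> ball t0 e2" if "t \<in> cball t0 \<delta>" for t
    using that \<delta> e1(2) by auto
  have "Q (x t) = 0" if "t \<in> cball t0 \<delta>" for t
  proof (rule gronwall_zero[where w="\<lambda>t. Q (x t)" and w'="\<lambda>t. Q (x' t)", OF _ K K\<delta> _ _ _ that])
    show "0 \<le> \<delta>" "Q (x t0) = 0" using \<delta> Q(2) x0 by auto
    fix s assume s: "s \<in> cball t0 \<delta>"
    show "((\<lambda>t. Q (x t)) has_vector_derivative Q (x' s)) (at s)"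
      by (rule bounded_linear.has_vector_derivative[OF Q(1) x[OF e(1)[OF s]]])
    have "norm (Q (x' s)) \<le> KQ * (2 * KR / B) * norm (Q (x s)) * norm (x' s)"
      by (rule Q_est) (use e[OF s] e1(2) x\<beta> in auto)
    also have "\<dots> \<le> KQ * (2 * KR / B) * norm (Q (x s)) * Mx"
      using Mx e(3)[OF s] KQ d B by (intro mult_left_mono) auto
    finally show "norm (Q (x' s)) \<le> K * norm (Q (x s))" by (simp add: K_def mult_ac)
  qed
  then show thesis using that[of \<delta>] \<delta> e Q(2) by (auto simp: dist_real_def abs_minus_commute)
qed

context atlas
begin

lemma restrict_chart:
  assumes c: "smooth_chart A c" and U: "open U"
  shows "smooth_chart A (dom_of c \<inter> U, snd c)"
    and "p \<in> dom_of c \<inter> U \<Longrightarrow> chart_inv (dom_of c \<inter> U, snd c) (snd c p) = p"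
proof -
  let ?c = "(dom_of c \<inter> U, snd c)"
  have inj: "inj_on (snd c) (dom_of c)"
    using chart_simps(1)[OF c] by (metis inj_on_inverseI)
  then have inj': "inj_on (snd c) (dom_of c \<inter> U)" by (rule inj_on_subset) auto
  have inv: "chart_inv ?c (snd c p) = p" if "p \<in> dom_of c \<inter> U" for p
    using inv_into_f_f[OF inj' that] by simp
  then show "p \<in> dom_of c \<inter> U \<Longrightarrow> chart_inv ?c (snd c p) = p" .
  have inv': "chart_inv ?c x = chart_inv c x" if "x \<in> snd c ` (dom_of c \<inter> U)" for x
    using that inv chart_simps(1)[OF c] by auto
  have op: "open (snd c ` (dom_of c \<inter> U))" by (rule chart_open[OF c U])
  have "homeomorphism (dom_of c \<inter> U) (snd c ` (dom_of c \<inter> U)) (snd c) (chart_inv ?c)"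
  proof -
    have "continuous_on (snd c ` (dom_of c \<inter> U)) (chart_inv ?c)"
      by (rule continuous_on_eq[OF continuous_on_subset[OF chart_cont(2)[OF c]]]) (use inv' in auto)
    moreover have "continuous_on (dom_of c \<inter> U) (snd c)"
      using chart_cont(1)[OF c] continuous_on_subset by blast
    moreover have "chart_inv ?c ` (snd c ` (dom_of c \<inter> U)) = dom_of c \<inter> U"
      unfolding image_image by (simp add: inv[simplified] cong: image_cong_simp)
    ultimately show ?thesis using inv by (auto simp: homeomorphism_def)
  qed
  then have "is_chart ?c" using op chart_cont(3)[OF c] U by (auto simp: is_chart_def)
  moreover have "compatible ?c d" if d: "d \<in> A" for d
  proof -
    have ds: "smooth_chart A d" using atlas_smooth_chart d by blast
    let ?S = "snd c ` (dom_of c \<inter> U \<inter> dom_of d)"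
    have S: "open ?S" using chart_open[OF c open_Int[OF U chart_cont(3)[OF ds]]] by (simp add: Int_assoc)
    have "smooth_on ?S (\<lambda>x. snd d (chart_inv c x))"
      by (rule smooth_on_subset[OF transition_smooth[OF c ds]]) auto
    then have "smooth_on ?S (\<lambda>x. snd d (chart_inv ?c x))"
      by (rule smooth_on_cong[OF S, rotated]) (use inv' in auto)
    moreover have "smooth_on (snd d ` (dom_of c \<inter> U \<inter> dom_of d)) (\<lambda>x. snd c (chart_inv d x))"
      by (rule smooth_on_subset[OF transition_smooth[OF ds c]]) auto
    ultimately show ?thesis by (simp add: compatible_def o_def)
  qed
  ultimately show "smooth_chart A ?c" by (simp add: smooth_chart_def)
qed

lemma submanifold_curve_velocity:
  assumes N: "submanifold A N" and \<gamma>: "smooth_curve A I \<gamma>" and I: "open I" and \<gamma>N: "\<And>t. t \<in> I \<Longrightarrow> \<gamma> t \<in> N"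
    and t: "t \<in> I"
  obtains u where "u \<in> tangent A N (\<gamma> t)" "has_velocity A \<gamma> u t I"
proof -
  obtain c E where c: "smooth_chart A c" "subspace E" "\<gamma> t \<in> dom_of c" "N \<inter> dom_of c = slice c E"
    using N \<gamma>N[OF t] unfolding submanifold_def by blast
  let ?J = "{t \<in> I. \<gamma> t \<in> dom_of c}"
  have sm: "smooth_on ?J (\<lambda>t. snd c (\<gamma> t))" "open ?J" by (rule smooth_curve_chart[OF \<gamma> I c(1)])+
  have tJ: "t \<in> ?J" using t c by simp
  define w where "w = frechet_derivative (\<lambda>t. snd c (\<gamma> t)) (at t) 1"
  have w: "((\<lambda>t. snd c (\<gamma> t)) has_vector_derivative w) (at t)"
    unfolding w_def by (rule smooth_on_has_vector_derivative[OF sm(1) tJ])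
  have "1 *\<^sub>R w \<in> E"
    by (rule derivative_in_subspace[OF c(2) w[unfolded has_vector_derivative_def] sm(2) tJ subspace_UNIV])
      (use \<gamma>N c(4) in \<open>auto simp: slice_def\<close>)
  then have "w \<in> E" by simp
  moreover have "((\<lambda>t. snd c (\<gamma> t)) has_vector_derivative w) (at t within I)"
    using w by (rule has_vector_derivative_at_within)
  moreover have "continuous (at t within I) \<gamma>"
    using \<gamma> t unfolding smooth_curve_def continuous_on_eq_continuous_within by blast
  ultimately have "has_velocity A \<gamma> (chart_deriv c (ref (\<gamma> t)) (\<gamma> t) w) t I"
    "chart_deriv c (ref (\<gamma> t)) (\<gamma> t) w \<in> tangent A N (\<gamma> t)"
    using has_velocity_chart[of c \<gamma> t I w, OF c(1,3) t] tangent_slice[OF c(1,3,2,4) \<gamma>N[OF t]] by auto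
  then show thesis using that by blast
qed

end

section \<open>Integral manifolds, leaf topology and fibres\<close>

locale coisotropic_submanifold = atlas A
  for A :: "('p::topological_space, 'e::euclidean_space) chart set" +
  fixes \<omega> :: "'p \<Rightarrow> 'e \<Rightarrow> 'e \<Rightarrow> real" and M :: "'p set"
  assumes \<omega>: "symplectic_form A \<omega>" and coiso: "coisotropic A \<omega> M"
begin

lemma \<omega>_tensor: "smooth_2tensor A \<omega>" and \<omega>_bilinear: "bilinear (\<omega> p)"
  using \<omega> by (auto simp: symplectic_form_def smooth_2tensor_def)

lemma \<omega>_nondegenerate: "(\<And>v. \<omega> p u v = 0) \<Longrightarrow> u = 0"
  using \<omega> unfolding symplectic_form_def by blast

lemma \<omega>_sym: "\<omega> p u v = - \<omega> p v u"
proof -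
  have "\<omega> p (u + v) (u + v) = 0" "\<omega> p u u = 0" "\<omega> p v v = 0" using \<omega> by (auto simp: symplectic_form_def)
  then show ?thesis by (simp add: bilinear_ladd[OF \<omega>_bilinear] bilinear_radd[OF \<omega>_bilinear])
qed

lemma slice_chart:
  assumes "p \<in> M"
  obtains c E where "smooth_chart A c" "subspace E" "p \<in> dom_of c" "M \<inter> dom_of c = slice c E"
  using coiso assms unfolding coisotropic_def submanifold_def by blast

text \<open>Coisotropy makes tangency automatic, so the kernel is cut out by the linear conditions
  alone.\<close>

lemma kernel_eq: "p \<in> M \<Longrightarrow> ker_pullback A \<omega> M p = {u. \<forall>v\<in>tangent A M p. \<omega> p u v = 0}"
  using coiso unfolding coisotropic_def ker_pullback_def by blast

text \<open>The kernel condition is written with two slice charts, \<open>c\<close> of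
  \<open>N\<close> for the velocity and \<open>cM\<close> of \<open>M\<close> for the test vectors,
  which brings it into the form of \<open>curve_stays_in_subspace\<close>. The lemma plays the role
  of uniqueness of leaves, without foliated charts.\<close>

lemma integral_manifold_absorbs_curve:
  assumes N: "integral_manifold A \<omega> M N" and \<gamma>: "smooth_curve A I \<gamma>" and I: "open I"
    and \<gamma>M: "\<And>t. t \<in> I \<Longrightarrow> \<gamma> t \<in> M"
    and vel: "\<And>t. t \<in> I \<Longrightarrow> \<exists>u\<in>ker_pullback A \<omega> M (\<gamma> t). has_velocity A \<gamma> u t I"
    and t0: "t0 \<in> I" "\<gamma> t0 \<in> N"
  obtains \<delta> where "\<delta> > 0" "\<And>t. \<bar>t - t0\<bar> < \<delta> \<Longrightarrow> t \<in> I \<and> \<gamma> t \<in> N"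
proof -
  have NM: "N \<subseteq> M" and subN: "submanifold A N"
    and tanN: "\<And>z. z \<in> N \<Longrightarrow> tangent A N z = ker_pullback A \<omega> M z"
    using N by (auto simp: integral_manifold_def)
  obtain c E' where c: "smooth_chart A c" "subspace E'" "\<gamma> t0 \<in> dom_of c" "N \<inter> dom_of c = slice c E'"
    using subN t0 unfolding submanifold_def by blast
  obtain cM E where cM: "smooth_chart A cM" "subspace E" "\<gamma> t0 \<in> dom_of cM" "M \<inter> dom_of cM = slice cM E"
    using slice_chart \<gamma>M t0 by metis
  define S where "S = snd c ` (dom_of c \<inter> dom_of cM)"
  have S: "open S" unfolding S_def by (rule transition_open[OF c(1) cM(1)])
  have Sp: "x = snd c (chart_inv c x) \<and> chart_inv c x \<in> dom_of c \<and> chart_inv c x \<in> dom_of cM" if "x \<in> S" for x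
    using that chart_simps(1)[OF c(1)] by (auto simp: S_def)
  define \<beta> where "\<beta> x u v = (let p = chart_inv c x in
    \<omega> p (chart_deriv c (ref p) p u) (chart_deriv cM (ref p) p v))" for x u v
  define J where "J = {t \<in> I. \<gamma> t \<in> dom_of c} \<inter> {t \<in> I. \<gamma> t \<in> dom_of cM}"
  have J: "open J" unfolding J_def
    by (intro open_Int smooth_curve_chart(2)[OF \<gamma> I] c cM)
  have sm: "smooth_on J (\<lambda>t. snd c (\<gamma> t))"
    by (rule smooth_on_subset[OF smooth_curve_chart(1)[OF \<gamma> I c(1)]]) (auto simp: J_def)
  define x' where "x' t = frechet_derivative (\<lambda>t. snd c (\<gamma> t)) (at t) 1" for t
  have x: "((\<lambda>t. snd c (\<gamma> t)) has_vector_derivative x' t) (at t)" if "t \<in> J" for t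
    unfolding x'_def by (rule smooth_on_has_vector_derivative[OF sm that])
  obtain \<delta> where \<delta>: "\<delta> > 0" "\<And>t. \<bar>t - t0\<bar> < \<delta> \<Longrightarrow> t \<in> J \<and> snd c (\<gamma> t) \<in> E'"
  proof (rule curve_stays_in_subspace[OF S, where \<beta>=\<beta> and E'=E' and E=E and I=J and ?t0.0=t0
        and x="\<lambda>t. snd c (\<gamma> t)" and x'=x'])
    show "smooth_on S (\<lambda>x. \<beta> x u v)" for u v
      unfolding \<beta>_def S_def
      by (rule smooth_on_subset[OF tensor_mixed_smooth[OF \<omega>_tensor c(1) cM(1) c(1)]]) auto
    fix x assume xS: "x \<in> S"
    define p where "p = chart_inv c x"
    have p: "p \<in> dom_of c" "p \<in> dom_of cM" "x = snd c p" using Sp[OF xS] by (auto simp: p_def)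
    have \<beta>x: "\<beta> x u v = \<omega> p (chart_deriv c (ref p) p u) (chart_deriv cM (ref p) p v)" for u v
      by (simp add: \<beta>_def p_def Let_def)
    note lin1 = chart_deriv_linear[OF c(1) ref(3) p(1) ref(2)]
    note lin2 = chart_deriv_linear[OF cM(1) ref(3) p(2) ref(2)]
    have "linear (\<beta> x u)" for u
      unfolding \<beta>x using linear_compose[OF lin2, of "\<omega> p (chart_deriv c (ref p) p u)"] \<omega>_bilinear
      by (simp add: bilinear_def o_def)
    moreover have "linear (\<lambda>u. \<beta> x u v)" for v
      unfolding \<beta>x using linear_compose[OF lin1, of "\<lambda>u. \<omega> p u (chart_deriv cM (ref p) p v)"] \<omega>_bilinear
      by (simp add: bilinear_def o_def)
    ultimately show "bilinear (\<beta> x)" by (simp add: bilinear_def)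
    show "u = 0" if "\<And>v. \<beta> x u v = 0" for u
    proof -
      have "\<omega> p (chart_deriv c (ref p) p u) v = 0" for v
        using that[of "chart_deriv (ref p) cM p v"] chart_deriv_inverse[OF ref(3,2) cM(1) p(2)] by (simp add: \<beta>x)
      then have "chart_deriv c (ref p) p u = 0" by (rule \<omega>_nondegenerate)
      then show ?thesis
        using chart_deriv_inverse[OF c(1) p(1) ref(3,2), of u]
          linear_0[OF chart_deriv_linear[OF ref(3) c(1) ref(2) p(1)]] by simp
    qed
  next
    fix x u assume xS: "x \<in> E' \<inter> S" and u: "\<And>y. y \<in> E \<Longrightarrow> \<beta> x u y = 0"
    define p where "p = chart_inv c x"
    have p: "p \<in> dom_of c" "p \<in> dom_of cM" "x = snd c p" using Sp[of x] xS by (auto simp: p_def)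
    have pN: "p \<in> N" using c(4) p xS by (auto simp: slice_def)
    then have "p \<in> M" using NM by blast
    then have "chart_deriv c (ref p) p u \<in> ker_pullback A \<omega> M p"
      unfolding kernel_eq[OF \<open>p \<in> M\<close>] tangent_slice[OF cM(1) p(2) cM(2) cM(4) \<open>p \<in> M\<close>]
      using u by (auto simp: \<beta>_def Let_def p_def)
    then obtain v where v: "v \<in> E'" "chart_deriv c (ref p) p u = chart_deriv c (ref p) p v"
      using tanN[OF pN] tangent_slice[OF c(1) p(1) c(2) c(4) pN] by auto
    then have "u = v" using chart_deriv_inverse[OF c(1) p(1) ref(3,2)] by metis
    then show "u \<in> E'" using v by simp
  next
    fix t y assume t: "t \<in> J" and y: "y \<in> E"
    have tI: "t \<in> I" "\<gamma> t \<in> dom_of c" "\<gamma> t \<in> dom_of cM" using t by (auto simp: J_def)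
    have \<gamma>t: "\<gamma> t \<in> M" using \<gamma>M tI by blast
    obtain u where u: "u \<in> ker_pullback A \<omega> M (\<gamma> t)" "has_velocity A \<gamma> u t I" using vel[OF tI(1)] by blast
    define w where "w = chart_deriv (ref (\<gamma> t)) c (\<gamma> t) u"
    have uw: "u = chart_deriv c (ref (\<gamma> t)) (\<gamma> t) w"
      using chart_deriv_inverse[OF ref(3,2) c(1) tI(2)] by (simp add: w_def)
    then have "((\<lambda>t. snd c (\<gamma> t)) has_vector_derivative w) (at t within I)"
      using has_velocity_chart[of c \<gamma> t I w, OF c(1) tI(2,1)] u by simp
    then have "((\<lambda>t. snd c (\<gamma> t)) has_vector_derivative w) (at t)"
      using at_within_open[OF tI(1) I] by simp
    then have "w = x' t" using x[OF t] vector_derivative_unique_at by blast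
    then show "\<beta> (snd c (\<gamma> t)) (x' t) y = 0"
      using u(1) uw y by (auto simp: \<beta>_def Let_def chart_simps(1)[OF c(1) tI(2)] kernel_eq[OF \<gamma>t]
        tangent_slice[OF cM(1) tI(3) cM(2) cM(4) \<gamma>t])
  next
    show "continuous_on J x'"
      unfolding x'_def by (rule smooth_on_imp_continuous_on[OF smooth_on_frechet[OF sm]])
  qed (use c cM t0 J x in \<open>auto simp: J_def S_def slice_def\<close>)
  have "\<gamma> t \<in> N" if "\<bar>t - t0\<bar> < \<delta>" for t
    using \<delta>(2)[OF that] c(4) by (auto simp: J_def slice_def)
  then show thesis using that[of \<delta>] \<delta> by (auto simp: J_def)
qed

text \<open>The leaf topology is generated by all integral manifolds, so continuity of a curve in one of them
  requires that its intersection with every other one be relatively open.\<close>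

lemma leaf_continuous_curve:
  assumes N: "integral_manifold A \<omega> M N" and \<gamma>: "smooth_curve A I \<gamma>" and I: "open I"
    and \<gamma>N: "\<And>t. t \<in> I \<Longrightarrow> \<gamma> t \<in> N"
  shows "continuous_map (top_of_set I) (leaf_topology A \<omega> M) \<gamma>"
  unfolding leaf_topology_def
proof (rule continuous_on_generated_topo)
  have NM: "N \<subseteq> M" and subN: "submanifold A N"
    and tanN: "\<And>z. z \<in> N \<Longrightarrow> tangent A N z = ker_pullback A \<omega> M z"
    using N by (auto simp: integral_manifold_def)
  show "\<gamma> ` topspace (top_of_set I) \<subseteq> \<Union> {N. integral_manifold A \<omega> M N}"
    using N \<gamma>N by auto
  fix N' assume "N' \<in> {N. integral_manifold A \<omega> M N}"
  then have N': "integral_manifold A \<omega> M N'" by simp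
  \<comment> \<open>Openness is checked at each time at which the curve meets \<open>N'\<close>: its
    velocity lies in the kernel, so \<open>N'\<close> absorbs it for a short time.\<close>
  have "\<exists>e>0. \<forall>s. dist s t < e \<longrightarrow> s \<in> \<gamma> -` N' \<inter> I" if t: "t \<in> \<gamma> -` N' \<inter> I" for t
  proof -
    have "\<exists>u\<in>ker_pullback A \<omega> M (\<gamma> s). has_velocity A \<gamma> u s I" if "s \<in> I" for s
      using submanifold_curve_velocity[OF subN \<gamma> I \<gamma>N that] tanN \<gamma>N[OF that] by metis
    from integral_manifold_absorbs_curve[OF N' \<gamma> I _ this] \<gamma>N NM t
    obtain \<delta> where "\<delta> > 0" "\<And>s. \<bar>s - t\<bar> < \<delta> \<Longrightarrow> s \<in> I \<and> \<gamma> s \<in> N'" by blast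
    then show ?thesis by (auto simp: dist_real_def)
  qed
  then have "open (\<gamma> -` N' \<inter> I)" unfolding open_dist by blast
  then show "openin (top_of_set I) (\<gamma> -` N' \<inter> topspace (top_of_set I))"
    using I by (simp add: openin_open_eq)
qed

text \<open>The image of \<open>J\<close> is connected in the leaf topology by
  \<open>leaf_continuous_curve\<close>. If it also lies in \<open>W\<close>, it is connected in the
  subspace whose components are the local fibres.\<close>

lemma curve_in_fibre:
  assumes N: "integral_manifold A \<omega> M N" and \<gamma>: "smooth_curve A I \<gamma>" and I: "open I"
    and \<gamma>N: "\<And>t. t \<in> I \<Longrightarrow> \<gamma> t \<in> N" and J: "connected J" "J \<subseteq> I" and s: "s \<in> J" "t \<in> J"
  shows "\<gamma> t \<in> fibre A \<omega> M (\<gamma> s)" and "\<gamma> ` J \<subseteq> W \<Longrightarrow> \<gamma> t \<in> local_fibre A \<omega> M W (\<gamma> s)"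
proof -
  have conn: "connectedin (leaf_topology A \<omega> M) (\<gamma> ` J)"
    by (rule connectedin_continuous_map_image[OF leaf_continuous_curve[OF N \<gamma> I \<gamma>N]])
      (use J in \<open>auto simp: connectedin_subtopology\<close>)
  have sub: "\<gamma> ` J \<subseteq> fibre A \<omega> M (\<gamma> s)"
    unfolding fibre_def by (rule connected_component_of_maximal[OF conn]) (use s in auto)
  then show "\<gamma> t \<in> fibre A \<omega> M (\<gamma> s)" using s by auto
  assume W: "\<gamma> ` J \<subseteq> W"
  have "connectedin (subtopology (leaf_topology A \<omega> M) (fibre A \<omega> M (\<gamma> s) \<inter> W)) (\<gamma> ` J)"
    using conn sub W by (simp add: connectedin_subtopology)
  from connected_component_of_maximal[OF this, of "\<gamma> s"] s
  show "\<gamma> t \<in> local_fibre A \<omega> M W (\<gamma> s)" unfolding local_fibre_def by blast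
qed

text \<open>Two levels of components are involved: membership first gives equal fibres, hence the
  same subspace topology, and then equal components in it. It also forces \<open>x\<close> into the
  underlying space of the leaf topology, since the component of an outside point is empty.\<close>

lemma local_fibre_same:
  assumes "y \<in> local_fibre A \<omega> M W x"
  shows "local_fibre A \<omega> M W y = local_fibre A \<omega> M W x" "y \<in> W" "x \<in> local_fibre A \<omega> M W x"
    "y \<in> fibre A \<omega> M x" "x \<in> topspace (leaf_topology A \<omega> M)"
proof -
  let ?T = "subtopology (leaf_topology A \<omega> M) (fibre A \<omega> M x \<inter> W)"
  have xy: "connected_component_of ?T x y" using assms by (simp add: local_fibre_def)
  then have top: "x \<in> topspace ?T" "y \<in> topspace ?T" and eq: "connected_component_of ?T x = connected_component_of ?T y"
    using connected_component_of_equiv by metis+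
  then show "y \<in> W" "y \<in> fibre A \<omega> M x" "x \<in> topspace (leaf_topology A \<omega> M)" by auto
  have "connected_component_of (leaf_topology A \<omega> M) x y" using top by (simp add: fibre_def)
  then have "fibre A \<omega> M y = fibre A \<omega> M x"
    using connected_component_of_equiv unfolding fibre_def by metis
  then show "local_fibre A \<omega> M W y = local_fibre A \<omega> M W x" by (simp add: local_fibre_def eq)
  show "x \<in> local_fibre A \<omega> M W x" using top by (simp add: local_fibre_def connected_component_of_refl)
qed

lemma leaf_topspace: "x \<in> topspace (leaf_topology A \<omega> M) \<longleftrightarrow> (\<exists>N. integral_manifold A \<omega> M N \<and> x \<in> N)"
  by (auto simp: leaf_topology_def)

text \<open>The slice chart is shrunk until its image is a ball. The coordinate segment from
  \<open>p\<close> to any point of the plaque then stays in the plaque, which places the whole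
  plaque in a single fibre.\<close>

lemma fibre_chart_exists:
  assumes N: "integral_manifold A \<omega> M N" and p: "p \<in> N"
  obtains c E where "fibre_chart A \<omega> M p c E" "p \<in> slice c E"
    "tangent A (slice c E) p = ker_pullback A \<omega> M p"
proof -
  have NM: "N \<subseteq> M" and subN: "submanifold A N"
    and tanN: "\<And>z. z \<in> N \<Longrightarrow> tangent A N z = ker_pullback A \<omega> M z"
    using N by (auto simp: integral_manifold_def)
  obtain c0 E where c0: "smooth_chart A c0" "subspace E" "p \<in> dom_of c0" "N \<inter> dom_of c0 = slice c0 E"
    using subN p unfolding submanifold_def by blast
  define x where "x = snd c0 p"
  have "x \<in> img_of c0" using c0 by (simp add: x_def)
  then obtain r where r: "r > 0" "ball x r \<subseteq> img_of c0" using chart_cont(4)[OF c0(1)] openE by blast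
  define U where "U = dom_of c0 \<inter> snd c0 -` ball x r"
  have U: "open U" unfolding U_def
    by (intro continuous_open_preimage chart_cont(1,3)[OF c0(1)] open_ball)
  define c where "c = (dom_of c0 \<inter> U, snd c0)"
  have c: "smooth_chart A c" unfolding c_def by (rule restrict_chart(1)[OF c0(1) U])
  have dom: "dom_of c \<subseteq> dom_of c0" "snd c = snd c0" by (auto simp: c_def)
  have img: "img_of c = ball x r"
  proof
    show "ball x r \<subseteq> img_of c"
    proof
      fix y assume y: "y \<in> ball x r"
      then have "y \<in> img_of c0" using r by blast
      then show "y \<in> img_of c" using y by (auto simp: c_def U_def image_iff)
    qed
  qed (auto simp: c_def U_def)
  have pc: "p \<in> dom_of c" using c0 r by (auto simp: c_def U_def x_def)
  have sl: "N \<inter> dom_of c = slice c E" using c0(4) dom by (auto simp: slice_def)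
  have ps: "p \<in> slice c E" using p pc sl by blast
  have tan: "tangent A (slice c E) q = ker_pullback A \<omega> M q" if q: "q \<in> slice c E" for q
  proof -
    have qc: "q \<in> dom_of c" "q \<in> N" using q sl by (auto simp: slice_def)
    have "slice c E \<inter> dom_of c = slice c E" by (auto simp: slice_def)
    then have "tangent A (slice c E) q = chart_deriv c (ref q) q ` E"
      by (rule tangent_slice[OF c qc(1) c0(2) _ q])
    also have "\<dots> = tangent A N q" by (rule tangent_slice[OF c qc(1) c0(2) sl qc(2), symmetric])
    finally show ?thesis using tanN qc by simp
  qed
  have "submanifold A (slice c E)" unfolding submanifold_def
  proof
    fix q assume "q \<in> slice c E"
    then show "\<exists>d F. smooth_chart A d \<and> subspace F \<and> q \<in> dom_of d \<and> slice c E \<inter> dom_of d = slice d F"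
      using c c0(2) by (intro exI[of _ c] exI[of _ E]) (auto simp: slice_def)
  qed
  moreover have "slice c E \<subseteq> M" using sl NM by blast
  ultimately have im: "integral_manifold A \<omega> M (slice c E)" using tan by (simp add: integral_manifold_def)
  have "q \<in> fibre A \<omega> M p" if q: "q \<in> slice c E" for q
  proof -
    define v where "v = snd c q - x"
    define I where "I = {t. x + t *\<^sub>R v \<in> ball x r}"
    have I: "open I"
    proof -
      have "open ((\<lambda>t. x + t *\<^sub>R v) -` ball x r)" by (intro open_vimage open_ball continuous_intros)
      then show ?thesis by (simp add: I_def vimage_def)
    qed
    have inI: "x + t *\<^sub>R v \<in> img_of c" if "t \<in> I" for t using that img by (simp add: I_def)
    let ?g = "\<lambda>t. chart_inv c (x + t *\<^sub>R v)"
    have g: "smooth_curve A I ?g" by (rule line_smooth_curve[OF c I inI])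
    have xE: "x \<in> E" "snd c q \<in> E" using ps q dom by (auto simp: slice_def x_def)
    have gN: "?g t \<in> slice c E" if "t \<in> I" for t
    proof -
      have "x + t *\<^sub>R v \<in> E" using xE c0(2) by (auto simp: v_def intro: subspace_add subspace_scale subspace_diff)
      then show ?thesis using chart_simps(2,3)[OF c inI[OF that]] by (simp add: slice_def)
    qed
    have "snd c q \<in> ball x r" using q img by (auto simp: slice_def)
    then have nv: "norm v < r" by (simp add: v_def dist_norm norm_minus_commute)
    have J: "{0..1} \<subseteq> I"
    proof
      fix t :: real assume "t \<in> {0..1}"
      then have "\<bar>t\<bar> * norm v \<le> 1 * norm v" by (intro mult_right_mono) auto
      then show "t \<in> I" using nv by (simp add: I_def dist_norm)
    qed
    have "?g 1 \<in> fibre A \<omega> M (?g 0)"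
      by (rule curve_in_fibre(1)[OF im g I gN _ J]) auto
    moreover have "?g 0 = p" using chart_simps(1)[OF c pc] dom by (simp add: x_def)
    moreover have "?g 1 = q" using chart_simps(1)[OF c, of q] q by (simp add: v_def slice_def)
    ultimately show ?thesis by simp
  qed
  then have "fibre_chart A \<omega> M p c E" using c c0(2) im by (auto simp: fibre_chart_def)
  then show thesis using that ps tan[OF ps] by blast
qed

end

text \<open>Through the representing operator the first part is Riesz representation and the second
  the dimension formula for Euclidean orthogonal complements. They provide the Hamiltonian field and
  the relation between the kernel and the codimension of \<open>M\<close>.\<close>

lemma nondegenerate_form:
  fixes \<beta> :: "'e::euclidean_space \<Rightarrow> 'e \<Rightarrow> real"
  assumes bil: "bilinear \<beta>" and nondeg: "\<And>u. (\<And>v. \<beta> u v = 0) \<Longrightarrow> u = 0"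
  shows "linear l \<Longrightarrow> \<exists>!u. \<forall>v. \<beta> u v = l v"
    and "subspace E \<Longrightarrow> dim {u. \<forall>v\<in>E. \<beta> u v = 0} + dim E = DIM('e)"
proof -
  define R where "R = form_op \<beta>"
  have inner: "R u \<bullet> v = \<beta> u v" for u v unfolding R_def by (rule form_op_inner[OF bil])
  have lin: "linear R" unfolding R_def by (rule form_op_linear[OF bil])
  have inj: "inj R" and surj: "surj R" using form_op_bij[OF bil nondeg] by (auto simp: R_def)
  show "\<exists>!u. \<forall>v. \<beta> u v = l v" if l: "linear l"
  proof -
    obtain u where u: "R u = (\<Sum>b\<in>Basis. l b *\<^sub>R b)" using surj by (metis surjD)
    have "\<beta> u v = l v" for v
    proof -
      have "\<beta> u v = (\<Sum>b\<in>Basis. l b * (b \<bullet> v))" using inner[of u v] u by (simp add: inner_sum_left)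
      also have "\<dots> = l v" using linear_expand_Basis[OF l, of v] by (simp add: inner_commute[of v] mult.commute)
      finally show ?thesis .
    qed
    moreover have "u' = u" if "\<forall>v. \<beta> u' v = l v" for u'
    proof -
      have "R u' \<bullet> v = R u \<bullet> v" for v using that \<open>\<And>v. \<beta> u v = l v\<close> inner by simp
      then have "R u' = R u" using vector_eq_ldot[of "R u'" "R u"] by (simp add: inner_commute)
      then show ?thesis using inj by (simp add: inj_eq)
    qed
    ultimately show ?thesis by blast
  qed
  show "dim {u. \<forall>v\<in>E. \<beta> u v = 0} + dim E = DIM('e)" if E: "subspace E"
  proof -
    let ?D = "{u. \<forall>v\<in>E. \<beta> u v = 0}" and ?P = "{y \<in> UNIV. \<forall>x\<in>E. orthogonal x y}"
    have "R ` ?D = ?P"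
    proof (intro set_eqI iffI)
      fix y assume y: "y \<in> ?P"
      obtain u where "y = R u" using surj by blast
      then show "y \<in> R ` ?D" using y inner[of u] by (auto simp: orthogonal_def inner_commute)
    next
      fix y assume "y \<in> R ` ?D"
      then obtain u where "y = R u" "\<And>v. v \<in> E \<Longrightarrow> \<beta> u v = 0" by auto
      then have "x \<bullet> y = 0" if "x \<in> E" for x using inner[of u x] that by (simp add: inner_commute)
      then show "y \<in> ?P" by (simp add: orthogonal_def)
    qed
    moreover have "dim (R ` ?D) = dim ?D"
      by (rule dim_image_eq[OF lin]) (use inj in \<open>auto intro: inj_on_subset\<close>)
    ultimately show ?thesis using dim_subspace_orthogonal_to_vectors[OF E subspace_UNIV] by simp
  qed
qed

section \<open>The method in a slice chart\<close>

locale shake_rattle = coisotropic_submanifold A \<omega> M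
  for A :: "('p::topological_space, 'e::euclidean_space) chart set" and \<omega> M +
  fixes H :: "'p \<Rightarrow> real" and I :: "real set" and \<phi> :: "real \<Rightarrow> 'p \<Rightarrow> 'p" and W :: "'p set" and h0 :: real
  assumes H: "smooth_fun A H"
    and nondegenerate: "\<And>z x. z \<in> M \<Longrightarrow> critical_on_fibre A \<omega> M H z x \<Longrightarrow> nondegenerate_on_fibre A \<omega> M H z x"
    and consistent: "consistent_method A (hamiltonian_field A \<omega> H) I \<phi>"
    and W: "openin (top_of_set M) W" and MHW: "hidden_constraint A \<omega> M H \<subseteq> W"
    and h0: "h0 > 0" and wd: "shake_rattle_well_defined A \<omega> M H \<phi> W h0"
begin

abbreviation "MH \<equiv> hidden_constraint A \<omega> M H"
abbreviation "\<pi> \<equiv> fibre_projection A \<omega> M H W"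
abbreviation "\<Gamma> \<equiv> shake_shift A \<omega> M \<phi> W"
abbreviation "LF \<equiv> local_fibre A \<omega> M W"
abbreviation "XH \<equiv> hamiltonian_field A \<omega> H"
abbreviation "SH \<equiv> shake A \<omega> M \<phi> W"
abbreviation "RH \<equiv> rattle A \<omega> M H \<phi> W"

lemma I: "open I" "0 \<in> I" and \<phi>: "smooth_family A I \<phi>" and \<phi>_0: "\<phi> 0 z = z"
  and \<phi>_velocity: "has_velocity A (\<lambda>h. \<phi> h z) (XH z) 0 I"
  using consistent by (auto simp: consistent_method_def)

lemma mderiv_H_linear: "linear (mderiv A H p)"
proof -
  have "(\<lambda>x. H (chart_inv (ref p) x)) = H \<circ> chart_inv (ref p)" by auto
  then show ?thesis
    using smooth_on_linear_frechet[OF smooth_fun_chart[OF H ref(3)], of "snd (ref p) p" p] ref(2)[of p]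
    by (simp add: mderiv_def)
qed

lemma XH: "\<omega> p (XH p) v = mderiv A H p v"
proof -
  have "\<exists>!u. \<forall>v. \<omega> p u v = mderiv A H p v"
    using nondegenerate_form(1)[OF \<omega>_bilinear \<omega>_nondegenerate mderiv_H_linear] .
  from theI'[OF this] show ?thesis unfolding hamiltonian_field_def by blast
qed

lemma WM: "W \<subseteq> M"
  using W openin_imp_subset by auto

lemma MHM: "MH \<subseteq> M"
  by (auto simp: hidden_constraint_def)

text \<open>A tangent vector solving the equation of the hidden constraint differs from
  \<open>XH p\<close> by an element of the \<omega>-orthogonal of the tangent space, which by
  coisotropy is itself tangent.\<close>

lemma MH_iff:
  assumes p: "p \<in> M"
  shows "p \<in> MH \<longleftrightarrow> XH p \<in> tangent A M p"
proof
  assume "p \<in> MH"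
  then obtain u where u: "u \<in> tangent A M p" "\<forall>v\<in>tangent A M p. mderiv A H p v = \<omega> p u v"
    by (auto simp: hidden_constraint_def)
  then have "XH p - u \<in> ker_pullback A \<omega> M p"
    unfolding kernel_eq[OF p] using XH[of p] by (auto simp: bilinear_lsub[OF \<omega>_bilinear])
  then have "XH p - u \<in> tangent A M p" by (simp add: ker_pullback_def)
  moreover obtain c E where c: "smooth_chart A c" "subspace E" "p \<in> dom_of c" "M \<inter> dom_of c = slice c E"
    using slice_chart p by blast
  have "subspace (tangent A M p)"
    unfolding tangent_slice[OF c(1,3,2,4) p]
    by (rule linear_subspace_image[OF chart_deriv_linear[OF c(1) ref(3) c(3) ref(2)] c(2)])
  ultimately show "XH p \<in> tangent A M p" using u(1) subspace_add[of _ "XH p - u" u] by simp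
next
  assume "XH p \<in> tangent A M p"
  moreover have "\<forall>v\<in>tangent A M p. mderiv A H p v = \<omega> p (XH p) v" by (simp add: XH)
  ultimately show "p \<in> MH" using p unfolding hidden_constraint_def by blast
qed

lemma \<pi>_in: "x \<in> W \<Longrightarrow> \<pi> x \<in> LF x \<inter> MH"
  and \<pi>_unique: "x \<in> W \<Longrightarrow> p \<in> LF x \<inter> MH \<Longrightarrow> \<pi> x = p"
proof -
  assume "x \<in> W"
  then have "\<exists>!p. p \<in> LF x \<inter> MH" using wd unfolding shake_rattle_well_defined_def by blast
  note ex1 = this
  show "\<pi> x \<in> LF x \<inter> MH" unfolding fibre_projection_def by (rule theI'[OF ex1])
  show "\<pi> x = p" if "p \<in> LF x \<inter> MH"
    unfolding fibre_projection_def by (rule the1_equality[OF ex1 that])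
qed

lemma W_self: "x \<in> W \<Longrightarrow> x \<in> LF x"
  using \<pi>_in local_fibre_same(3) by blast

lemma \<pi>_MH: "x \<in> MH \<Longrightarrow> \<pi> x = x"
  using \<pi>_unique W_self MHW by blast

lemma \<pi>_cong: "LF x = LF y \<Longrightarrow> \<pi> x = \<pi> y"
  by (simp add: fibre_projection_def)

lemma LF_\<pi>: "x \<in> W \<Longrightarrow> LF (\<pi> x) = LF x"
  using \<pi>_in local_fibre_same(1) by blast

lemma \<Gamma>_eqI:
  assumes "z \<in> W" "0 < h" "h < h0" "y \<in> LF z" "\<phi> h y \<in> M"
  shows "\<Gamma> h z = y"
proof -
  have "\<exists>!p. p \<in> LF z \<and> \<phi> h p \<in> M" using wd assms unfolding shake_rattle_well_defined_def by simp
  from the1_equality[OF this] show ?thesis using assms unfolding shake_shift_def by blast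
qed

lemma \<Gamma>_cong: "LF x = LF y \<Longrightarrow> \<Gamma> h x = \<Gamma> h y"
  by (simp add: shake_shift_def)

lemma SH_W: "0 < h \<Longrightarrow> h < h0 \<Longrightarrow> z \<in> W \<Longrightarrow> SH h z \<in> W"
  using wd unfolding shake_rattle_well_defined_def shake_def by simp

lemma SH_\<pi>: "z \<in> W \<Longrightarrow> SH h (\<pi> z) = SH h z"
  using \<Gamma>_cong[OF LF_\<pi>] by (simp add: shake_def)

text \<open>A SHAKE step depends on its starting point only through the local fibre, so
  \<open>SH h (\<pi> z) = SH h z\<close>. By induction \<pi> carries SHAKE iterates to RATTLE
  iterates, and the next SHAKE step may start from either.\<close>

lemma iterates:
  assumes h: "0 < h" "h < h0" and z: "z \<in> MH"
  shows "(RH h ^^ k) z \<in> MH" "(SH h ^^ Suc k) z = SH h ((RH h ^^ k) z)"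
proof -
  have *: "(SH h ^^ k) z \<in> W \<and> \<pi> ((SH h ^^ k) z) = (RH h ^^ k) z" for k
  proof (induction k)
    case 0
    then show ?case using z MHW \<pi>_MH by auto
  next
    case (Suc k)
    then show ?case using SH_W[OF h] SH_\<pi>[of "(SH h ^^ k) z" h] by (simp add: rattle_def)
  qed
  then show "(RH h ^^ k) z \<in> MH" using \<pi>_in[of "(SH h ^^ k) z"] by (metis IntD2)
  show "(SH h ^^ Suc k) z = SH h ((RH h ^^ k) z)"
    using * SH_\<pi>[of "(SH h ^^ k) z" h] by simp
qed

text \<open>Frobenius' theorem is not needed: since \<open>\<pi>\<close> is well defined, every point of \<open>W\<close> lies in the
  leaf topology and hence on an integral manifold.\<close>

lemma W_integral_manifold:
  assumes "p \<in> W" obtains N where "integral_manifold A \<omega> M N" "p \<in> N"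
  using W_self[OF assms] local_fibre_same(5) leaf_topspace by blast

end

text \<open>\<open>F0\<close> is a smooth extension of \<pi> near \<open>z\<close>, and
  \<open>W0\<close> an open set of the ambient space with trace \<open>W\<close> on
  \<open>M\<close>. On \<open>U\<close> the extension is available and stays in the chart, and the
  points of \<open>E\<close> represent points of \<open>W\<close>. \<open>X\<close> is defined as
  the h-derivative of the method, so that its smoothness comes from \<phi>; \<open>X_chart\<close>
  identifies it with the Hamiltonian field.\<close>

locale slice_at = shake_rattle A \<omega> M H I \<phi> W h0
  for A :: "('p::topological_space, 'e::euclidean_space) chart set" and \<omega> M H I \<phi> W h0 +
  fixes z :: 'p and c :: "('p, 'e) chart" and E :: "'e set" and F0 :: "'p \<Rightarrow> 'p" and U0 W0 :: "'p set"
    and Om :: "(real \<times> 'e) set" and f :: "real \<times> 'e \<Rightarrow> 'e" and U :: "'e set" and F X :: "'e \<Rightarrow> 'e"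
  defines "Om \<equiv> {(h, x). h \<in> I \<and> x \<in> img_of c \<and> \<phi> h (chart_inv c x) \<in> dom_of c}"
    and "f \<equiv> \<lambda>(h, x). snd c (\<phi> h (chart_inv c x))"
    and "U \<equiv> snd c ` {p \<in> dom_of c \<inter> U0. F0 p \<in> dom_of c} \<inter> snd c ` (dom_of c \<inter> W0)"
    and "F \<equiv> \<lambda>x. snd c (F0 (chart_inv c x))"
    and "X \<equiv> \<lambda>x. frechet_derivative f (at (0, x)) (1, 0)"
  assumes z: "z \<in> MH" and c: "smooth_chart A c" "z \<in> dom_of c" and E: "subspace E" and ME: "M \<inter> dom_of c = slice c E"
    and U0: "open U0" "z \<in> U0" and F0: "smooth_map A U0 F0" and F0_\<pi>: "\<And>q. q \<in> W \<inter> U0 \<Longrightarrow> F0 q = \<pi> q"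
    and W0: "open W0" "W = M \<inter> W0"
begin

lemma Om: "open Om" "smooth_on Om f"
  unfolding Om_def f_def by (rule smooth_family_chart[OF \<phi> I(1) c(1) c(1)])+

lemma U: "open U" "smooth_on U F"
proof -
  show "open U" unfolding U_def
    by (intro open_Int smooth_map_chart(2)[OF F0 U0(1) c(1) c(1)] chart_open[OF c(1) W0(1)])
  show "smooth_on U F"
    unfolding F_def by (rule smooth_on_subset[OF smooth_map_chart(1)[OF F0 U0(1) c(1) c(1)]]) (auto simp: U_def)
qed

lemma U_point:
  assumes "x \<in> U"
  shows "chart_inv c x \<in> dom_of c" "snd c (chart_inv c x) = x" "chart_inv c x \<in> U0" "chart_inv c x \<in> W0"
    "F0 (chart_inv c x) \<in> dom_of c" "x \<in> img_of c"
proof -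
  obtain p q where p: "x = snd c p" "p \<in> dom_of c" "p \<in> U0" "F0 p \<in> dom_of c" and q: "x = snd c q" "q \<in> dom_of c" "q \<in> W0"
    using assms unfolding U_def by blast
  have "chart_inv c x = p" using p(1,2) chart_simps(1)[OF c(1)] by simp
  moreover have "chart_inv c x = q" using q(1,2) chart_simps(1)[OF c(1)] by simp
  ultimately show "chart_inv c x \<in> dom_of c" "snd c (chart_inv c x) = x" "chart_inv c x \<in> U0" "chart_inv c x \<in> W0"
    "F0 (chart_inv c x) \<in> dom_of c" "x \<in> img_of c" using p q by auto
qed

lemma U_E_point:
  assumes "x \<in> E \<inter> U"
  shows "chart_inv c x \<in> W" "F x = snd c (\<pi> (chart_inv c x))" "\<pi> (chart_inv c x) \<in> dom_of c"
proof -
  have "chart_inv c x \<in> slice c E" using U_point[of x] assms by (auto simp: slice_def)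
  then show "chart_inv c x \<in> W" using ME U_point(4)[of x] assms W0(2) by blast
  then have "F0 (chart_inv c x) = \<pi> (chart_inv c x)" using F0_\<pi> U_point(3)[of x] assms by blast
  then show "F x = snd c (\<pi> (chart_inv c x))" "\<pi> (chart_inv c x) \<in> dom_of c"
    using U_point(5)[of x] assms by (auto simp: F_def)
qed

lemma X_chart:
  assumes q: "q \<in> dom_of c"
  shows "chart_deriv c (ref q) q (X (snd c q)) = XH q"
proof -
  have om: "(0, snd c q) \<in> Om" using q I chart_simps(1)[OF c(1) q] by (auto simp: Om_def \<phi>_0)
  have "((\<lambda>h. (h, snd c q)) has_derivative (\<lambda>h. (h, 0))) (at (0::real))" by (auto intro!: derivative_eq_intros)
  from has_derivative_compose[OF this smooth_on_has_derivative[OF Om(2) om]]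
  have "((\<lambda>h. f (h, snd c q)) has_derivative (\<lambda>h. frechet_derivative f (at (0, snd c q)) (h, 0))) (at 0)" .
  moreover have "frechet_derivative f (at (0, snd c q)) (h, 0) = h *\<^sub>R X (snd c q)" for h
    using linear_scale[OF smooth_on_linear_frechet[OF Om(2) om], of h "(1, 0)"] by (simp add: X_def)
  ultimately have 1: "((\<lambda>h. snd c (\<phi> h q)) has_vector_derivative X (snd c q)) (at 0)"
    by (simp add: has_vector_derivative_def f_def chart_simps(1)[OF c(1) q])
  define w where "w = chart_deriv (ref q) c q (XH q)"
  have XHw: "XH q = chart_deriv c (ref q) q w"
    using chart_deriv_inverse[OF ref(3,2) c(1) q] by (simp add: w_def)
  have "((\<lambda>h. snd c (\<phi> h q)) has_vector_derivative w) (at 0 within I)"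
    using has_velocity_chart[OF c(1), of "\<lambda>h. \<phi> h q" 0 I w] \<phi>_velocity[of q] q I(2) XHw by (simp add: \<phi>_0)
  then have "((\<lambda>h. snd c (\<phi> h q)) has_vector_derivative w) (at 0)"
    using at_within_open[OF I(2,1)] by simp
  then have "w = X (snd c q)" using 1 vector_derivative_unique_at by blast
  then show ?thesis using XHw by simp
qed

lemma chart_deriv_inj:
  assumes "q \<in> dom_of c" "chart_deriv c (ref q) q u = chart_deriv c (ref q) q v"
  shows "u = v"
  using chart_deriv_inverse[OF c(1) assms(1) ref(3,2)] assms(2) by metis

lemma tangent_M: "q \<in> M \<Longrightarrow> q \<in> dom_of c \<Longrightarrow> tangent A M q = chart_deriv c (ref q) q ` E"
  using tangent_slice[OF c(1) _ E ME] by blast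

lemma MH_chart: "q \<in> M \<Longrightarrow> q \<in> dom_of c \<Longrightarrow> q \<in> MH \<longleftrightarrow> X (snd c q) \<in> E"
  unfolding MH_iff X_chart[symmetric] tangent_M using chart_deriv_inj by (metis (no_types, lifting) X_chart image_iff)

text \<open>A kernel vector is the velocity of a curve in an integral manifold; as long as the curve
  stays in \<open>W\<close> it runs in one local fibre. The statement is made at every
  \<open>q\<close> in the coordinate region and not at \<open>z\<close> alone, because
  \<open>solution_derivative\<close> applies it along the solution.\<close>

lemma F_kernel:
  assumes q: "q \<in> MH" "q \<in> dom_of c" "snd c q \<in> U" and u: "chart_deriv c (ref q) q u \<in> ker_pullback A \<omega> M q"
  shows "frechet_derivative F (at (snd c q)) u = 0"
proof -
  have qW: "q \<in> W" using q MHW by blast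
  obtain N where N: "integral_manifold A \<omega> M N" "q \<in> N" using W_integral_manifold[OF qW] by blast
  have NM: "N \<subseteq> M" and tanN: "tangent A N q = ker_pullback A \<omega> M q"
    using N by (auto simp: integral_manifold_def)
  obtain \<gamma> \<epsilon> where g: "\<epsilon> > 0" "smooth_curve A {-\<epsilon><..<\<epsilon>} \<gamma>" "\<And>t. t \<in> {-\<epsilon><..<\<epsilon>} \<Longrightarrow> \<gamma> t \<in> N"
    "\<gamma> 0 = q" "has_velocity A \<gamma> (chart_deriv c (ref q) q u) 0 {-\<epsilon><..<\<epsilon>}"
    using u unfolding tanN[symmetric] tangent_def by blast
  let ?I = "{-\<epsilon><..<\<epsilon>}" and ?x = "\<lambda>t. snd c (\<gamma> t)"
  have "(?x has_vector_derivative u) (at 0 within ?I)"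
    using has_velocity_chart[OF c(1), of \<gamma> 0 ?I u] g q by simp
  then have xu: "(?x has_derivative (\<lambda>h. h *\<^sub>R u)) (at 0)"
    using at_within_open[of 0 ?I] g(1) by (simp add: has_vector_derivative_def)
  let ?J = "{t \<in> ?I. \<gamma> t \<in> dom_of c}"
  have "continuous_on ?J ?x" "open ?J"
    using smooth_on_imp_continuous_on smooth_curve_chart[OF g(2) _ c(1)] by auto
  then have "open (?J \<inter> ?x -` U)" using U(1) continuous_open_preimage by blast
  moreover have "0 \<in> ?J \<inter> ?x -` U" using g q by auto
  ultimately obtain \<delta> where \<delta>: "\<delta> > 0" "ball 0 \<delta> \<subseteq> ?J \<inter> ?x -` U" using openE by blast
  have gW: "\<gamma> t \<in> W \<and> chart_inv c (?x t) = \<gamma> t" if "t \<in> ball 0 \<delta>" for t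
  proof -
    have t: "t \<in> ?J" "?x t \<in> U" using that \<delta> by blast+
    then have "chart_inv c (?x t) = \<gamma> t" using chart_simps(1)[OF c(1)] by blast
    then show ?thesis using U_point(4)[OF t(2)] W0 g(3)[of t] NM t(1) by auto
  qed
  have "F (?x t) = snd c q" if t: "t \<in> ball 0 \<delta>" for t
  proof -
    have "\<gamma> t \<in> LF (\<gamma> 0)"
    proof (rule curve_in_fibre(2)[OF N(1) g(2) _ g(3), of "ball 0 \<delta>"])
      show "connected (ball (0::real) \<delta>)" by simp
      show "ball 0 \<delta> \<subseteq> ?I" using \<delta>(2) by blast
    qed (use t \<delta> gW in auto)
    then have "\<pi> (\<gamma> t) = \<pi> q" using local_fibre_same(1) \<pi>_cong g(4) by metis
    then have "\<pi> (\<gamma> t) = q" using \<pi>_MH q by simp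
    moreover have "?x t \<in> E \<inter> U"
    proof -
      have "t \<in> ?J" "?x t \<in> U" using t \<delta> by blast+
      then show ?thesis using g(3)[of t] NM ME by (auto simp: slice_def)
    qed
    ultimately show ?thesis using U_E_point(2) gW[OF t] by simp
  qed
  then have const: "((\<lambda>t. F (?x t)) has_derivative (\<lambda>h. 0)) (at 0)"
    using has_derivative_transform_within_open[OF has_derivative_const open_ball, of 0 0 \<delta> "snd c q" "\<lambda>t. F (?x t)"] \<delta>(1)
    by simp
  have "((\<lambda>t. F (?x t)) has_derivative (\<lambda>h. frechet_derivative F (at (snd c q)) (h *\<^sub>R u))) (at 0)"
    by (rule has_derivative_compose[OF xu]) (use smooth_on_has_derivative[OF U(2) q(3)] g(4) in simp)
  from fun_cong[OF has_derivative_unique[OF this const], of 1] show ?thesis by simp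
qed

lemma Om_0: "x \<in> img_of c \<Longrightarrow> (0, x) \<in> Om" and f_0: "x \<in> img_of c \<Longrightarrow> f (0, x) = x"
  using chart_simps[OF c(1)] I by (auto simp: Om_def f_def \<phi>_0)

lemma X_smooth: "smooth_on (img_of c) X"
  unfolding X_def
  by (rule smooth_on_compose[OF chart_cont(4)[OF c(1)] Om(1) _ _ smooth_on_frechet[OF Om(2)]])
    (auto intro!: smooth_on_Pair smooth_on_const smooth_on_id chart_cont(4)[OF c(1)] Om_0)

text \<open>On a leaf through \<open>z\<close> the derivatives of \<open>H\<close> along the leaf are
  \<open>dH(b) = - \<omega>(b, X) = - \<omega>(b, Q X)\<close>, so a vector \<open>u\<close> with \<open>Q (DX u) = 0\<close> annihilates the Hessian.\<close>

lemma nondegenerate_X: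
  assumes u: "chart_deriv c (ref z) z u \<in> ker_pullback A \<omega> M z" and Xu: "frechet_derivative X (at (snd c z)) u \<in> E"
  shows "u = 0"
proof -
  have zM: "z \<in> M" using z MHM by blast
  obtain N where N: "integral_manifold A \<omega> M N" "z \<in> N" using W_integral_manifold z MHW by blast
  obtain c' E' where fc: "fibre_chart A \<omega> M z c' E'" and zs: "z \<in> slice c' E'"
    using fibre_chart_exists[OF N] by metis
  have c': "smooth_chart A c'" "subspace E'" and im: "integral_manifold A \<omega> M (slice c' E')"
    and fib: "slice c' E' \<subseteq> fibre A \<omega> M z" using fc by (auto simp: fibre_chart_def)
  have zc': "z \<in> dom_of c'" using zs by (simp add: slice_def)
  have sl: "slice c' E' \<inter> dom_of c' = slice c' E'" by (auto simp: slice_def)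
  have tan': "chart_deriv c' (ref q) q ` E' = ker_pullback A \<omega> M q" if "q \<in> slice c' E'" for q
    using im tangent_slice[OF c'(1) _ c'(2) sl that] that by (auto simp: integral_manifold_def slice_def)
  \<comment> \<open>Criticality at \<open>z\<close>: the field \<open>XH z\<close> is tangent to
    \<open>M\<close>, and kernel vectors are \<omega>-orthogonal to all tangent vectors.\<close>
  have "mderiv A H z v = 0" if "v \<in> ker_pullback A \<omega> M z" for v
  proof -
    have "\<omega> z v (XH z) = 0" using that z MH_iff[OF zM] by (simp add: ker_pullback_def)
    then show ?thesis using XH[of z v] \<omega>_sym[of z "XH z" v] by simp
  qed
  then have "critical_on_fibre A \<omega> M H z z" using fib zs by (auto simp: critical_on_fibre_def)
  then have nd: "\<forall>a\<in>E'. (\<forall>b\<in>E'. second_deriv (H \<circ> chart_inv c') (snd c' z) a b = 0) \<longrightarrow> a = 0"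
    using nondegenerate[OF zM] fc zs unfolding nondegenerate_on_fibre_def by blast
  \<comment> \<open>\<open>a\<close> is the vector \<open>u\<close> in the coordinates of the fibre
    chart, in which the Hessian is taken.\<close>
  define a where "a = chart_deriv c c' z u"
  have aE: "a \<in> E'"
  proof -
    obtain v where v: "v \<in> E'" "chart_deriv c (ref z) z u = chart_deriv c' (ref z) z v"
      using u tan'[OF zs] by blast
    have "a = chart_deriv (ref z) c' z (chart_deriv c (ref z) z u)"
      unfolding a_def using chart_deriv_cocycle[OF c ref(3,2) c'(1) zc'] by simp
    also have "\<dots> = v" using v chart_deriv_inverse[OF c'(1) zc' ref(3,2)] by simp
    finally show ?thesis using v by simp
  qed
  define \<rho> where "\<rho> y = snd c (chart_inv c' y)" for y
  define S where "S = snd c' ` (dom_of c' \<inter> dom_of c)"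
  define y0 where "y0 = snd c' z"
  have S: "open S" "y0 \<in> S" unfolding S_def y0_def using transition_open[OF c'(1) c(1)] zc' c by auto
  have \<rho>0: "\<rho> y0 = snd c z" using chart_simps(1)[OF c'(1) zc'] by (simp add: \<rho>_def y0_def)
  obtain Q :: "'e \<Rightarrow> 'e" where Q: "bounded_linear Q" "\<And>x. Q x = 0 \<longleftrightarrow> x \<in> E" "\<And>x. x - Q x \<in> E"
    using subspace_projection[OF E] by metis
  \<comment> \<open>\<open>g\<close> is the normal part of the field as a function of the fibre
    coordinates; it vanishes at \<open>y0\<close>, and its derivative there vanishes in the
    direction \<open>a\<close>.\<close>
  define g where "g y = Q (X (\<rho> y))" for y
  define g' where "g' v = Q (frechet_derivative X (at (snd c z)) (chart_deriv c' c z v))" for v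
  have "(\<rho> has_derivative chart_deriv c' c z) (at y0)"
    unfolding \<rho>_def[abs_def] y0_def by (rule chart_deriv[OF c'(1) c(1) zc' c(2)])
  moreover have "(X has_derivative frechet_derivative X (at (snd c z))) (at (\<rho> y0))"
    unfolding \<rho>0 by (rule smooth_on_has_derivative[OF X_smooth]) (use c in simp)
  ultimately have "((\<lambda>y. X (\<rho> y)) has_derivative (\<lambda>v. frechet_derivative X (at (snd c z)) (chart_deriv c' c z v))) (at y0)"
    by (rule has_derivative_compose)
  from bounded_linear.has_derivative[OF Q(1) this]
  have g: "(g has_derivative g') (at y0)" by (simp add: g_def[abs_def] g'_def[abs_def])
  have g0: "g y0 = 0" using MH_chart[OF zM c(2)] z Q(2) by (simp add: g_def \<rho>0)
  have g'a: "g' a = 0" using Xu Q(2) chart_deriv_inverse[OF c c'(1) zc'] by (simp add: g'_def a_def)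
  have "second_deriv (H \<circ> chart_inv c') y0 a b = 0" if b: "b \<in> E'" for b
  proof -
    define \<beta> where "\<beta> y v = (let p = chart_inv c' y in
      \<omega> p (chart_deriv c' (ref p) p b) (chart_deriv c (ref p) p v))" for y v
    have \<beta>: "smooth_on S (\<lambda>y. \<beta> y v)" for v
      unfolding \<beta>_def S_def
      by (rule smooth_on_subset[OF tensor_mixed_smooth[OF \<omega>_tensor c'(1) c(1) c'(1)]]) auto
    \<comment> \<open>The pairing of \<open>b\<close> with the normal part of the field, as a sum of
      products. In its derivative along \<open>a\<close> the derivatives of \<beta> are multiplied
      by \<open>g y0 = 0\<close>, and the remaining terms contain \<open>g' a = 0\<close>.\<close>
    define k where "k y = (\<Sum>e\<in>Basis. (g y \<bullet> e) * \<beta> y e)" for y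
    define k' where "k' v = (\<Sum>e\<in>Basis. (g y0 \<bullet> e) * frechet_derivative (\<lambda>y. \<beta> y e) (at y0) v + (g' v \<bullet> e) * \<beta> y0 e)" for v
    have k: "(k has_derivative k') (at y0)"
      unfolding k_def[abs_def] k'_def[abs_def]
      by (intro has_derivative_sum has_derivative_mult bounded_linear.has_derivative[OF bounded_linear_inner_left]
          g smooth_on_has_derivative[OF \<beta>] S)
    have k'a: "k' a = 0" by (simp add: k'_def g0 g'a)
    define h where "h y = frechet_derivative (\<lambda>y. H (chart_inv c' y)) (at y) b" for y
    have "smooth_on (img_of c') h"
      unfolding h_def by (rule smooth_on_frechet[OF smooth_fun_chart[OF H c'(1)]])
    then have h: "(h has_derivative frechet_derivative h (at y0)) (at y0)"
      by (rule smooth_on_has_derivative) (use zc' in \<open>simp add: y0_def\<close>)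
    \<comment> \<open>At points of the plaque \<open>b\<close> represents a kernel vector and
      \<open>X - Q X\<close> a tangent vector of \<open>M\<close>; their pairing vanishes and only
      \<open>g\<close> is left.\<close>
    have hk: "h y + k y = 0" if y: "y \<in> E' \<inter> S" for y
    proof -
      obtain p where p: "y = snd c' p" "p \<in> dom_of c'" "p \<in> dom_of c" using y by (auto simp: S_def)
      have inv: "chart_inv c' y = p" using chart_simps(1)[OF c'(1) p(2)] p(1) by simp
      have ps: "p \<in> slice c' E'" using p y by (simp add: slice_def)
      then have pM: "p \<in> M" using im by (auto simp: integral_manifold_def)
      have bK: "chart_deriv c' (ref p) p b \<in> ker_pullback A \<omega> M p" using tan'[OF ps] b by blast
      have lin\<beta>: "linear (\<beta> y)"
        using linear_compose[OF chart_deriv_linear[OF c(1) ref(3) p(3) ref(2)], of "\<omega> p (chart_deriv c' (ref p) p b)"] \<omega>_bilinear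
        by (simp add: \<beta>_def[abs_def] inv bilinear_def o_def)
      have \<beta>E: "\<beta> y v = 0" if "v \<in> E" for v
        using bK that tangent_M[OF pM p(3)] by (auto simp: \<beta>_def inv kernel_eq[OF pM])
      have "h y = mderiv A H p (chart_deriv c' (ref p) p b)"
        using mderiv_chart[OF H c'(1) p(2)] by (simp add: h_def p(1))
      also have "\<dots> = - \<omega> p (chart_deriv c' (ref p) p b) (XH p)"
        using XH[of p] \<omega>_sym[of p] by metis
      also have "\<dots> = - \<beta> y (X (\<rho> y))" using X_chart[OF p(3)] by (simp add: \<beta>_def \<rho>_def inv)
      also have "\<beta> y (X (\<rho> y)) = \<beta> y (g y)"
        using \<beta>E[OF Q(3), of "X (\<rho> y)"] by (simp add: linear_diff[OF lin\<beta>] g_def)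
      also have "\<dots> = k y" using linear_expand_Basis[OF lin\<beta>, of "g y"] by (simp add: k_def)
      finally show ?thesis by simp
    qed
    \<comment> \<open>The sum \<open>h + k\<close> is known to vanish on \<open>E'\<close> only; it
      is differentiated along \<open>a\<close>, which lies in \<open>E'\<close>.\<close>
    have "frechet_derivative h (at y0) a + k' a \<in> {0}"
    proof (rule derivative_in_subspace[OF subspace_single_0 has_derivative_add[OF h k] S c'(2) _ _ aE])
      show "y0 \<in> E'" using zs by (simp add: slice_def y0_def)
    qed (use hk in auto)
    then show ?thesis using k'a by (simp add: second_deriv_def h_def[abs_def] o_def)
  qed
  then have "a = 0" using nd aE by (simp add: y0_def)
  then show "u = 0"
    using chart_deriv_inverse[OF c c'(1) zc', of u] linear_0[OF chart_deriv_linear[OF c'(1) c(1) zc' c(2)]]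
    by (simp add: a_def)
qed

section \<open>The constrained field and one step in the slice chart\<close>

definition Y :: "'e \<Rightarrow> 'e" where
  "Y x = frechet_derivative F (at x) (X x)"

lemma F_fixes: "q \<in> MH \<Longrightarrow> q \<in> dom_of c \<Longrightarrow> snd c q \<in> U \<Longrightarrow> F (snd c q) = snd c q"
  using F0_\<pi>[of q] \<pi>_MH[of q] U_point(3)[of "snd c q"] MHW chart_simps(1)[OF c(1)] by (auto simp: F_def)

lemma U_z: "snd c z \<in> U"
proof -
  have zW: "z \<in> W" using z MHW by blast
  have "F0 z = \<pi> z" using F0_\<pi>[of z] zW U0 by blast
  then have "F0 z = z" using \<pi>_MH[OF z] by simp
  then show ?thesis using c U0 zW W0 by (auto simp: U_def)
qed

lemma solution_derivative:
  assumes sol: "constrained_solution A \<omega> M H T \<gamma>" and t: "t \<in> {0..T}" and \<gamma>t: "\<gamma> t \<in> dom_of c" "snd c (\<gamma> t) \<in> U"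
  shows "((\<lambda>s. snd c (\<gamma> s)) has_vector_derivative Y (snd c (\<gamma> t))) (at t within {0..T})"
proof -
  let ?x = "\<lambda>s. snd c (\<gamma> s)"
  have MHt: "\<gamma> s \<in> MH" if "s \<in> {0..T}" for s using sol that by (simp add: constrained_solution_def)
  obtain u where u: "u \<in> tangent A M (\<gamma> t)" "has_velocity A \<gamma> u t {0..T}"
      "\<forall>v\<in>tangent A M (\<gamma> t). \<omega> (\<gamma> t) u v = mderiv A H (\<gamma> t) v"
    using sol t unfolding constrained_solution_def by blast
  have \<gamma>M: "\<gamma> t \<in> M" using MHt t MHM by blast
  define w where "w = chart_deriv (ref (\<gamma> t)) c (\<gamma> t) u"
  have uw: "u = chart_deriv c (ref (\<gamma> t)) (\<gamma> t) w"
    using chart_deriv_inverse[OF ref(3,2) c(1) \<gamma>t(1)] by (simp add: w_def)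
  have xw: "continuous (at t within {0..T}) \<gamma>" "(?x has_vector_derivative w) (at t within {0..T})"
    using has_velocity_chart[of c \<gamma> t "{0..T}" w, OF c(1) \<gamma>t(1) t] u(2) uw by auto
  have lin: "linear (chart_deriv c (ref (\<gamma> t)) (\<gamma> t))"
    by (rule chart_deriv_linear[OF c(1) ref(3) \<gamma>t(1) ref(2)])
  \<comment> \<open>Velocity and Hamiltonian field pair equally with all tangent vectors of
    \<open>M\<close>, so their difference satisfies the kernel condition.\<close>
  have "chart_deriv c (ref (\<gamma> t)) (\<gamma> t) (w - X (?x t)) \<in> ker_pullback A \<omega> M (\<gamma> t)"
    using u(3) XH[of "\<gamma> t"]
    by (simp add: kernel_eq[OF \<gamma>M] linear_diff[OF lin] X_chart[OF \<gamma>t(1)] bilinear_lsub[OF \<omega>_bilinear] flip: uw)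
  from F_kernel[OF MHt[OF t] \<gamma>t this]
  have DFw: "frechet_derivative F (at (?x t)) w = Y (?x t)"
    using linear_diff[OF smooth_on_linear_frechet[OF U(2) \<gamma>t(2)]] by (simp add: Y_def)
  have "((\<lambda>s. F (?x s)) has_derivative (\<lambda>h. frechet_derivative F (at (?x t)) (h *\<^sub>R w))) (at t within {0..T})"
    by (rule has_derivative_compose[OF xw(2)[unfolded has_vector_derivative_def] smooth_on_has_derivative[OF U(2) \<gamma>t(2)]])
  then have 1: "((\<lambda>s. F (?x s)) has_derivative (\<lambda>h. h *\<^sub>R Y (?x t))) (at t within {0..T})"
    by (simp add: linear_scale[OF smooth_on_linear_frechet[OF U(2) \<gamma>t(2)]] DFw)
  have "\<forall>\<^sub>F s in at t within {0..T}. \<gamma> s \<in> dom_of c"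
    using xw(1) chart_cont(3)[OF c(1)] \<gamma>t(1) unfolding continuous_within tendsto_def by blast
  moreover have "continuous (at t within {0..T}) ?x"
    using xw(2) has_vector_derivative_continuous by blast
  then have "\<forall>\<^sub>F s in at t within {0..T}. ?x s \<in> U"
    using U(1) \<gamma>t(2) unfolding continuous_within tendsto_def by blast
  moreover have "\<forall>\<^sub>F s in at t within {0..T}. s \<in> {0..T}"
    by (simp add: eventually_at_filter)
  ultimately have 2: "\<forall>\<^sub>F s in at t within {0..T}. F (?x s) = ?x s"
    by eventually_elim (use MHt F_fixes in blast)
  show ?thesis
    unfolding has_vector_derivative_def
    by (rule has_derivative_transform_eventually[OF 1 2 F_fixes[OF MHt[OF t] \<gamma>t] t])
qed

text \<open>The subspace \<open>D\<close> of the coordinate model consists of the kernel vectors at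
  \<open>z\<close> in the chart \<open>c\<close>. Coisotropy identifies it with the full
  \<omega>-orthogonal of \<open>E\<close>, whence the complementary dimension.\<close>

lemma constrained_step_chart:
  assumes "bounded_linear Q" "\<And>x. Q x = 0 \<longleftrightarrow> x \<in> E" "\<And>x. x - Q x \<in> E" "\<And>x y. y \<in> E \<Longrightarrow> orthogonal y (Q x)"
  shows "constrained_step E {u. chart_deriv c (ref z) z u \<in> ker_pullback A \<omega> M z} (snd c ` (MH \<inter> dom_of c)) U Om f F Q (snd c z)"
proof -
  let ?d = "chart_deriv c (ref z) z"
  define D where "D = {u. ?d u \<in> ker_pullback A \<omega> M z}"
  have zM: "z \<in> M" using z MHM by blast
  have lin: "linear ?d" by (rule chart_deriv_linear[OF c(1) ref(3) c(2) ref(2)])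
  define \<beta> where "\<beta> u v = \<omega> z (?d u) (?d v)" for u v
  have bil: "bilinear \<beta>"
    using \<omega>_bilinear[of z] linear_compose[OF lin] by (auto simp: \<beta>_def[abs_def] bilinear_def o_def)
  have nd: "u = 0" if "\<And>v. \<beta> u v = 0" for u
  proof -
    have "\<omega> z (?d u) v = 0" for v
      using that[of "chart_deriv (ref z) c z v"] chart_deriv_inverse[OF ref(3,2) c] by (simp add: \<beta>_def)
    then have "?d u = 0" by (rule \<omega>_nondegenerate)
    then show ?thesis using chart_deriv_inj[OF c(2), of u 0] linear_0[OF lin] by simp
  qed
  have D_eq: "D = {u. \<forall>v\<in>E. \<beta> u v = 0}"
    unfolding D_def kernel_eq[OF zM] tangent_M[OF zM c(2)] by (auto simp: \<beta>_def)
  have DE: "D \<subseteq> E"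
  proof
    fix u assume "u \<in> D"
    then have "?d u \<in> ?d ` E" using tangent_M[OF zM c(2)] by (auto simp: D_def ker_pullback_def)
    then show "u \<in> E" using chart_deriv_inj[OF c(2)] by auto
  qed
  have D: "subspace D"
    unfolding D_eq subspace_def by (auto simp: bilinear_lzero[OF bil] bilinear_ladd[OF bil] bilinear_lmul[OF bil])
  have dim: "dim D + dim E = DIM('e)" unfolding D_eq by (rule nondegenerate_form(2)[OF bil nd E])
  have MHE: "snd c ` (MH \<inter> dom_of c) \<subseteq> E" using MHM ME by (auto simp: slice_def)
  have MH_iff': "x \<in> snd c ` (MH \<inter> dom_of c) \<longleftrightarrow> frechet_derivative f (at (0, x)) (1, 0) \<in> E" if "x \<in> E \<inter> U" for x
  proof -
    have q: "chart_inv c x \<in> M" "chart_inv c x \<in> dom_of c" "snd c (chart_inv c x) = x"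
      using U_E_point(1)[OF that] WM U_point[of x] that by auto
    have "x \<in> snd c ` (MH \<inter> dom_of c) \<longleftrightarrow> chart_inv c x \<in> MH"
    proof
      assume "x \<in> snd c ` (MH \<inter> dom_of c)"
      then obtain p where p: "x = snd c p" "p \<in> MH" "p \<in> dom_of c" by blast
      then show "chart_inv c x \<in> MH" using chart_simps(1)[OF c(1)] by simp
    next
      assume "chart_inv c x \<in> MH"
      then show "x \<in> snd c ` (MH \<inter> dom_of c)" using q(2,3) by (metis IntI image_eqI)
    qed
    then show ?thesis using MH_chart[OF q(1,2)] q(3) by (simp add: X_def)
  qed
  have "constrained_step E D (snd c ` (MH \<inter> dom_of c)) U Om f F Q (snd c z)"
  proof (rule constrained_step.intro)
    show "(0, x) \<in> Om" if "x \<in> U" for x using that U_point(6) Om_0 by blast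
    show "F x \<in> snd c ` (MH \<inter> dom_of c)" if "x \<in> E \<inter> U" for x
      using U_E_point[OF that] \<pi>_in by auto
    show "F x = x" if "x \<in> snd c ` (MH \<inter> dom_of c) \<inter> U" for x
      using that F_fixes by auto
    show "frechet_derivative F (at (snd c z)) u = 0" if "u \<in> D" for u
      using F_kernel[OF z c(2) U_z] that by (simp add: D_def)
    show "u = 0" if "u \<in> D" "frechet_derivative (\<lambda>x. frechet_derivative f (at (0, x)) (1, 0)) (at (snd c z)) u \<in> E" for u
      using nondegenerate_X[of u] that by (simp add: D_def X_def)
  qed (use E D DE dim assms Om U U_z U_point(6) Om_0 f_0 MHE MH_iff' z c in \<open>auto simp: Om_def\<close>)
  then show ?thesis by (simp add: D_def)
qed

lemma model:
  obtains \<delta> C K where "\<delta> > 0" "C > 0" "K > 0" "\<delta> \<le> h0" "ball (snd c z) \<delta> \<subseteq> U"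
    "\<And>x y. x \<in> ball (snd c z) \<delta> \<Longrightarrow> y \<in> ball (snd c z) \<delta> \<Longrightarrow> norm (Y x - Y y) \<le> K * norm (x - y)"
    "\<And>p h. p \<in> MH \<Longrightarrow> p \<in> dom_of c \<Longrightarrow> snd c p \<in> ball (snd c z) \<delta> \<Longrightarrow> 0 < h \<Longrightarrow> h < \<delta> \<Longrightarrow>
      SH h p \<in> dom_of c \<and> RH h p \<in> dom_of c \<and> norm (snd c (SH h p) - snd c p) \<le> C * h \<and>
      norm (snd c (RH h p) - snd c p - h *\<^sub>R Y (snd c p)) \<le> C * h\<^sup>2"
proof -
  obtain Q :: "'e \<Rightarrow> 'e" where Q: "bounded_linear Q" "\<And>x. Q x = 0 \<longleftrightarrow> x \<in> E" "\<And>x. x - Q x \<in> E"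
      "\<And>x y. y \<in> E \<Longrightarrow> orthogonal y (Q x)"
    using subspace_projection[OF E] by metis
  have Y: "frechet_derivative F (at x) (frechet_derivative f (at (0, x)) (1, 0)) = Y x" for x
    by (simp add: Y_def X_def)
  obtain d C K where d: "d > 0" "C > 0" "K > 0" "ball (snd c z) d \<subseteq> U"
    "\<And>x y. x \<in> ball (snd c z) d \<Longrightarrow> y \<in> ball (snd c z) d \<Longrightarrow> norm (Y x - Y y) \<le> K * norm (x - y)"
    "\<And>x h. x \<in> snd c ` (MH \<inter> dom_of c) \<Longrightarrow> x \<in> ball (snd c z) d \<Longrightarrow> 0 < h \<Longrightarrow> h < d \<Longrightarrow>
      \<exists>y\<in>E \<inter> U. (h, y) \<in> Om \<and> F y = x \<and> f (h, y) \<in> E \<inter> U \<and>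
        norm (f (h, y) - x) \<le> C * h \<and> norm (F (f (h, y)) - x - h *\<^sub>R Y x) \<le> C * h\<^sup>2"
    using constrained_step.one_step[OF constrained_step_chart[OF Q], unfolded Y] by blast
  show thesis
  proof (rule that[of "min d h0" C K])
    fix p h assume p: "p \<in> MH" "p \<in> dom_of c" "snd c p \<in> ball (snd c z) (min d h0)" and h: "0 < h" "h < min d h0"
    obtain y where y: "y \<in> E \<inter> U" "(h, y) \<in> Om" "F y = snd c p" "f (h, y) \<in> E \<inter> U"
        "norm (f (h, y) - snd c p) \<le> C * h" "norm (F (f (h, y)) - snd c p - h *\<^sub>R Y (snd c p)) \<le> C * h\<^sup>2"
      using d(6)[of "snd c p" h] p h by auto
    define q where "q = chart_inv c y"
    have qW: "q \<in> W" and \<pi>q: "\<pi> q \<in> dom_of c" "snd c p = snd c (\<pi> q)"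
      using U_E_point[OF y(1)] y(3) by (auto simp: q_def)
    \<comment> \<open>The equation for \<open>F\<close> says that \<pi> sends \<open>q\<close> to
      \<open>p\<close>, so \<open>q\<close> lies in the local fibre of \<open>p\<close>. With
      \<open>\<phi> h q \<in> M\<close> this makes \<open>q\<close> the shifted point.\<close>
    have "\<pi> q = p" using \<pi>q p(2) chart_simps(1)[OF c(1)] by metis
    then have "q \<in> LF p" using LF_\<pi>[OF qW] W_self[OF qW] by simp
    moreover have \<phi>q: "\<phi> h q \<in> dom_of c" "f (h, y) = snd c (\<phi> h q)"
      using y(2) by (auto simp: Om_def f_def q_def)
    moreover have "\<phi> h q \<in> M"
      using y(4) \<phi>q ME by (auto simp: slice_def)
    ultimately have "\<Gamma> h p = q" using \<Gamma>_eqI[of p h q] p(1) MHW h by auto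
    then have S: "SH h p = \<phi> h q" by (simp add: shake_def)
    have "chart_inv c (f (h, y)) = SH h p" using \<phi>q chart_simps(1)[OF c(1)] S by simp
    then have R: "F (f (h, y)) = snd c (RH h p)" "RH h p \<in> dom_of c"
      using U_E_point(2,3)[OF y(4)] by (auto simp: rattle_def)
    show "SH h p \<in> dom_of c \<and> RH h p \<in> dom_of c \<and> norm (snd c (SH h p) - snd c p) \<le> C * h \<and>
      norm (snd c (RH h p) - snd c p - h *\<^sub>R Y (snd c p)) \<le> C * h\<^sup>2"
      using y(5,6) R S \<phi>q by simp
  qed (use d h0 in \<open>auto simp: subset_iff\<close>)
qed

end

context shake_rattle
begin

text \<open>Here slices, leaves and forms disappear: for the convergence argument there remain a
  chart, a Lipschitz field, one-step bounds uniform over the ball and over small h, and the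
  differential equation of solutions.\<close>

lemma local_model:
  assumes z: "z \<in> MH"
  obtains c \<delta> C K Y where "smooth_chart A c" "z \<in> dom_of c" "\<delta> > 0" "C > 0" "K > 0" "\<delta> \<le> h0" "ball (snd c z) \<delta> \<subseteq> img_of c"
    "\<And>x y. x \<in> ball (snd c z) \<delta> \<Longrightarrow> y \<in> ball (snd c z) \<delta> \<Longrightarrow> norm (Y x - Y y) \<le> K * norm (x - y)"
    "\<And>p h. p \<in> MH \<Longrightarrow> p \<in> dom_of c \<Longrightarrow> snd c p \<in> ball (snd c z) \<delta> \<Longrightarrow> 0 < h \<Longrightarrow> h < \<delta> \<Longrightarrow>
      SH h p \<in> dom_of c \<and> RH h p \<in> dom_of c \<and> norm (snd c (SH h p) - snd c p) \<le> C * h \<and>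
      norm (snd c (RH h p) - snd c p - h *\<^sub>R Y (snd c p)) \<le> C * h\<^sup>2"
    "\<And>T \<gamma> t. constrained_solution A \<omega> M H T \<gamma> \<Longrightarrow> t \<in> {0..T} \<Longrightarrow> \<gamma> t \<in> dom_of c \<Longrightarrow> snd c (\<gamma> t) \<in> ball (snd c z) \<delta> \<Longrightarrow>
      ((\<lambda>s. snd c (\<gamma> s)) has_vector_derivative Y (snd c (\<gamma> t))) (at t within {0..T})"
proof -
  obtain c E where cE: "smooth_chart A c" "subspace E" "z \<in> dom_of c" "M \<inter> dom_of c = slice c E"
    using slice_chart z MHM by blast
  have "smooth_map_on_subset A W \<pi>" using wd by (simp add: shake_rattle_well_defined_def)
  then obtain U0 F0 where F0: "open U0" "z \<in> U0" "smooth_map A U0 F0" "\<forall>q\<in>W \<inter> U0. F0 q = \<pi> q"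
    using z MHW unfolding smooth_map_on_subset_def by blast
  obtain W0 where W0: "open W0" "W = M \<inter> W0" using W unfolding openin_open by blast
  interpret slice_at A \<omega> M H I \<phi> W h0 z c E F0 U0 W0
    "{(h, x). h \<in> I \<and> x \<in> img_of c \<and> \<phi> h (chart_inv c x) \<in> dom_of c}"
    "\<lambda>(h, x). snd c (\<phi> h (chart_inv c x))"
    "snd c ` {p \<in> dom_of c \<inter> U0. F0 p \<in> dom_of c} \<inter> snd c ` (dom_of c \<inter> W0)"
    "\<lambda>x. snd c (F0 (chart_inv c x))"
    "\<lambda>x. frechet_derivative (\<lambda>(h, x). snd c (\<phi> h (chart_inv c x))) (at (0, x)) (1, 0)"
    by unfold_locales (use z cE F0 W0 in auto)
  from model obtain \<delta> C K where m: "\<delta> > 0" "C > 0" "K > 0" "\<delta> \<le> h0"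
    "ball (snd c z) \<delta> \<subseteq> snd c ` {p \<in> dom_of c \<inter> U0. F0 p \<in> dom_of c} \<inter> snd c ` (dom_of c \<inter> W0)"
    "\<And>x y. x \<in> ball (snd c z) \<delta> \<Longrightarrow> y \<in> ball (snd c z) \<delta> \<Longrightarrow> norm (Y x - Y y) \<le> K * norm (x - y)"
    "\<And>p h. p \<in> MH \<Longrightarrow> p \<in> dom_of c \<Longrightarrow> snd c p \<in> ball (snd c z) \<delta> \<Longrightarrow> 0 < h \<Longrightarrow> h < \<delta> \<Longrightarrow>
      SH h p \<in> dom_of c \<and> RH h p \<in> dom_of c \<and> norm (snd c (SH h p) - snd c p) \<le> C * h \<and>
      norm (snd c (RH h p) - snd c p - h *\<^sub>R Y (snd c p)) \<le> C * h\<^sup>2"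
    by blast
  show thesis
  proof (rule that[OF cE(1,3) m(1-4) _ m(6,7)])
    show "ball (snd c z) \<delta> \<subseteq> img_of c" using m(5) by blast
    show "((\<lambda>s. snd c (\<gamma> s)) has_vector_derivative Y (snd c (\<gamma> t))) (at t within {0..T})"
      if "constrained_solution A \<omega> M H T \<gamma>" "t \<in> {0..T}" "\<gamma> t \<in> dom_of c" "snd c (\<gamma> t) \<in> ball (snd c z) \<delta>" for T \<gamma> t
      using solution_derivative[OF that(1-3)] that(4) m(5) by blast
  qed
qed

end

section \<open>Riemannian distance in a chart\<close>

context atlas
begin

text \<open>The distance is at most the length of the coordinate segment, and the coefficients of
  the metric are bounded near \<open>p0\<close>. Errors estimated in a chart are transferred to the
  distance by this bound.\<close>

lemma riemannian_dist_chart: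
  assumes g: "riemannian_metric A g" and c: "smooth_chart A c" "p0 \<in> dom_of c"
  obtains r L where "r > 0" "L > 0"
    "\<And>p q. p \<in> dom_of c \<Longrightarrow> q \<in> dom_of c \<Longrightarrow> snd c p \<in> ball (snd c p0) r \<Longrightarrow> snd c q \<in> ball (snd c p0) r \<Longrightarrow>
      riemannian_dist A g p q \<le> ennreal (L * norm (snd c p - snd c q))"
proof -
  have gt: "smooth_2tensor A g" using g by (simp add: riemannian_metric_def)
  define G where "G x u v = (let p = chart_inv c x in g p (chart_deriv c (ref p) p u) (chart_deriv c (ref p) p v))" for x u v
  have G_smooth: "smooth_on (img_of c) (\<lambda>x. G x u v)" for u v
    using tensor_mixed_smooth[OF gt c(1) c(1) c(1)] by (simp add: G_def)
  have G_bil: "bilinear (G x)" if x: "x \<in> img_of c" for x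
  proof -
    define p where "p = chart_inv c x"
    have "p \<in> dom_of c" using chart_simps(3)[OF c(1) x] by (simp add: p_def)
    then have lin: "linear (chart_deriv c (ref p) p)" by (rule chart_deriv_linear[OF c(1) ref(3) _ ref(2)])
    have "bilinear (g p)" using gt by (simp add: smooth_2tensor_def)
    then show ?thesis
      using linear_compose[OF lin] by (auto simp: bilinear_def G_def[abs_def] o_def p_def Let_def)
  qed
  define R where "R x = form_op (G x)" for x
  have R_inner: "R x u \<bullet> v = G x u v" if "x \<in> img_of c" for x u v
    unfolding R_def by (rule form_op_inner[OF G_bil[OF that]])
  have R_lin: "linear (R x)" if "x \<in> img_of c" for x
    unfolding R_def by (rule form_op_linear[OF G_bil[OF that]])
  have img: "open (img_of c)" by (rule chart_cont(4)[OF c(1)])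
  have R_smooth: "smooth_on (img_of c) (\<lambda>x. R x u)" for u
    unfolding R_def form_op_def by (intro smooth_on_sum img smooth_on_bounded_linear[OF bounded_linear_scaleR_left] G_smooth)
  define x0 where "x0 = snd c p0"
  have x0: "x0 \<in> img_of c" using c by (simp add: x0_def)
  obtain d K where d: "d > 0" "K > 0" "ball x0 d \<subseteq> img_of c"
    "\<And>x y u. x \<in> ball x0 d \<Longrightarrow> y \<in> ball x0 d \<Longrightarrow> norm (R x u - R y u) \<le> K * norm (x - y) * norm u"
    using smooth_bilinear_lipschitz[OF img R_smooth R_lin x0] by blast
  obtain K0 where K0: "K0 > 0" "\<And>u. norm (R x0 u) \<le> K0 * norm u"
    using bounded_linear_normE R_lin[OF x0] linear_conv_bounded_linear by blast
  \<comment> \<open>A bound for the operator representing the metric on the ball: its norm at the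
    centre plus the Lipschitz variation.\<close>
  define B where "B = K0 + K * d"
  have B: "B > 0" using d K0 by (simp add: B_def add_pos_pos)
  have G_bound: "G x u u \<le> B * (norm u)\<^sup>2" if x: "x \<in> ball x0 d" for x u
  proof -
    have "norm (R x u - R x0 u) \<le> K * norm (x - x0) * norm u" using d(1) d(4)[of x x0 u] x by simp
    also have "\<dots> \<le> K * d * norm u"
      using x d by (intro mult_right_mono mult_left_mono) (auto simp: dist_norm norm_minus_commute)
    finally have "norm (R x u) \<le> B * norm u"
      using K0(2)[of u] norm_triangle_sub[of "R x u" "R x0 u"] by (simp add: B_def algebra_simps)
    then have "norm (R x u) * norm u \<le> B * norm u * norm u" by (intro mult_right_mono) auto
    moreover have "G x u u \<le> norm (R x u) * norm u"
      using R_inner[of x u u] norm_cauchy_schwarz[of "R x u" u] x d by (simp add: subset_iff)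
    ultimately show ?thesis by (simp add: power2_eq_square mult_ac)
  qed
  show thesis
  proof (rule that[of d "sqrt B"])
    show "d > 0" "sqrt B > 0" using d B by auto
    fix p q assume p: "p \<in> dom_of c" "snd c p \<in> ball (snd c p0) d" and q: "q \<in> dom_of c" "snd c q \<in> ball (snd c p0) d"
    define x where "x = snd c p"
    define v where "v = snd c q - snd c p"
    define J where "J = {t. x + t *\<^sub>R v \<in> ball x0 d}"
    have J: "open J"
    proof -
      have "open ((\<lambda>t. x + t *\<^sub>R v) -` ball x0 d)" by (intro open_vimage open_ball continuous_intros)
      then show ?thesis by (simp add: J_def vimage_def)
    qed
    have inJ: "x + t *\<^sub>R v \<in> img_of c" if "t \<in> J" for t using that d by (auto simp: J_def)
    have J01: "{0..1} \<subseteq> J"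
    proof
      fix t :: real assume t: "t \<in> {0..1}"
      have "(1 - t) *\<^sub>R snd c p + t *\<^sub>R snd c q \<in> ball x0 d"
        using convexD[OF convex_ball, of "snd c p" x0 d "snd c q" "1 - t" t] p q t by (simp add: x0_def)
      moreover have "(1 - t) *\<^sub>R snd c p + t *\<^sub>R snd c q = x + t *\<^sub>R v" by (simp add: x_def v_def algebra_simps)
      ultimately show "t \<in> J" by (simp add: J_def)
    qed
    let ?g = "\<lambda>t. chart_inv c (x + t *\<^sub>R v)"
    have curve: "smooth_curve A J ?g" by (rule line_smooth_curve[OF c(1) J inJ])
    have ends: "?g 0 = p" "?g 1 = q" using chart_simps(1)[OF c(1)] p q by (auto simp: x_def v_def)
    have "piecewise_C1_curve A ?g" unfolding piecewise_C1_curve_def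
    proof (intro conjI exI[of _ "{}"] ballI)
      show "continuous_on {0..1} ?g"
        using curve J01 continuous_on_subset unfolding smooth_curve_def by blast
      fix a assume a: "a \<in> A"
      let ?S = "{t \<in> J. ?g t \<in> dom_of a}"
      have sm: "smooth_on ?S (\<lambda>t. snd a (?g t))"
        by (rule smooth_curve_chart(1)[OF curve J atlas_smooth_chart[OF a]])
      note vd = smooth_on_has_vector_derivative[OF sm]
      have "continuous_on ?S (\<lambda>t. frechet_derivative (\<lambda>t. snd a (?g t)) (at t) 1)"
        by (rule smooth_on_imp_continuous_on[OF smooth_on_frechet[OF sm]])
      then have "continuous_on ({t \<in> {0..1}. ?g t \<in> dom_of a} - {}) (\<lambda>t. frechet_derivative (\<lambda>t. snd a (?g t)) (at t) 1)"
        by (rule continuous_on_subset) (use J01 in auto)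
      then show "(snd a \<circ> ?g) C1_differentiable_on {t \<in> {0..1}. ?g t \<in> dom_of a} - {}"
        unfolding C1_differentiable_on_def o_def using vd J01
        by (intro exI[of _ "\<lambda>t. frechet_derivative (\<lambda>t. snd a (?g t)) (at t) 1"] conjI ballI) auto
    qed simp
    then have "riemannian_dist A g p q \<le> curve_length A g ?g"
      unfolding riemannian_dist_def using ends by (intro INF_lower) simp
    also have "\<dots> \<le> (\<integral>\<^sup>+ t. ennreal (sqrt B * norm v) * indicator {0..1::real} t \<partial>lborel)"
      unfolding curve_length_def
    proof (rule nn_integral_mono)
      fix t :: real
      show "(let u = vector_derivative (snd (ref (?g t)) \<circ> ?g) (at t) in ennreal (sqrt (g (?g t) u u))) * indicator {0..1} t
          \<le> ennreal (sqrt B * norm v) * indicator {0..1} t"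
      proof (cases "t \<in> {0..1}")
        case True
        then have tJ: "t \<in> J" using J01 by blast
        define w where "w = ?g t"
        have wc: "w \<in> dom_of c" "snd c w = x + t *\<^sub>R v"
          using chart_simps(2,3)[OF c(1) inJ[OF tJ]] by (auto simp: w_def)
        have "((\<lambda>t. x + t *\<^sub>R v) has_vector_derivative v) (at t)"
          by (auto intro!: derivative_eq_intros)
        then have "((\<lambda>t. snd c (?g t)) has_vector_derivative v) (at t)"
          unfolding has_vector_derivative_def
          by (rule has_derivative_transform_within_open[OF _ J tJ]) (simp add: chart_simps(2)[OF c(1) inJ])
        moreover have "isCont ?g t"
          using curve J tJ continuous_on_eq_continuous_at unfolding smooth_curve_def by blast
        ultimately have "((\<lambda>t. snd (ref w) (?g t)) has_vector_derivative chart_deriv c (ref w) w v) (at t)"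
          using velocity_change_chart[of t UNIV ?g c "ref w" v] c(1) wc ref by (simp add: w_def)
        then have "vector_derivative (snd (ref w) \<circ> ?g) (at t) = chart_deriv c (ref w) w v"
          by (simp add: o_def vector_derivative_at)
        moreover have "g w (chart_deriv c (ref w) w v) (chart_deriv c (ref w) w v) = G (x + t *\<^sub>R v) v v"
          by (simp add: G_def w_def Let_def)
        moreover have "sqrt (G (x + t *\<^sub>R v) v v) \<le> sqrt B * norm v"
        proof -
          have "sqrt (G (x + t *\<^sub>R v) v v) \<le> sqrt (B * (norm v)\<^sup>2)"
            using G_bound[of "x + t *\<^sub>R v" v] tJ by (simp add: J_def)
          then show ?thesis by (simp add: real_sqrt_mult)
        qed
        ultimately show ?thesis using True by (simp add: w_def Let_def ennreal_leI)
      qed simp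
    qed
    also have "\<dots> = ennreal (sqrt B * norm v)"
      by (subst nn_integral_cmult_indicator) auto
    finally show "riemannian_dist A g p q \<le> ennreal (sqrt B * norm (snd c p - snd c q))"
      by (simp add: v_def norm_minus_commute)
  qed
qed

end

section \<open>Convergence\<close>

locale shake_rattle_solution = shake_rattle A \<omega> M H I \<phi> W h0
  for A :: "('p::topological_space, 'e::euclidean_space) chart set" and \<omega> M H I \<phi> W h0 +
  fixes T :: real and \<gamma> :: "real \<Rightarrow> 'p" and z0 :: 'p
  assumes T: "T \<ge> 0" and sol: "constrained_solution A \<omega> M H T \<gamma>" and \<gamma>0: "\<gamma> 0 = z0"
begin

lemma \<gamma>_MH: "t \<in> {0..T} \<Longrightarrow> \<gamma> t \<in> MH"
  using sol by (simp add: constrained_solution_def)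

lemma z0_MH: "z0 \<in> MH"
  using \<gamma>_MH[of 0] T \<gamma>0 by simp

lemma \<gamma>_continuous: "continuous_on {0..T} \<gamma>"
  using sol unfolding constrained_solution_def continuous_on_eq_continuous_within has_velocity_def by blast

lemma \<gamma>_near:
  assumes c: "smooth_chart A c" and t: "t \<in> {0..T}" "\<gamma> t \<in> dom_of c" and \<epsilon>: "\<epsilon> > 0"
  obtains \<eta> where "\<eta> > 0"
    "\<And>s. s \<in> {0..T} \<Longrightarrow> \<bar>s - t\<bar> < \<eta> \<Longrightarrow> \<gamma> s \<in> dom_of c \<and> snd c (\<gamma> s) \<in> ball (snd c (\<gamma> t)) \<epsilon>"
proof -
  let ?B = "dom_of c \<inter> snd c -` ball (snd c (\<gamma> t)) \<epsilon>"
  have "open ?B" by (intro continuous_open_preimage chart_cont(1,3)[OF c] open_ball)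
  then have "openin (top_of_set {0..T}) ({0..T} \<inter> \<gamma> -` ?B)"
    using \<gamma>_continuous by (intro continuous_openin_preimage_gen)
  moreover have "t \<in> {0..T} \<inter> \<gamma> -` ?B" using t \<epsilon> by simp
  ultimately obtain \<eta> where "\<eta> > 0" "ball t \<eta> \<inter> {0..T} \<subseteq> {0..T} \<inter> \<gamma> -` ?B"
    unfolding openin_contains_ball by metis
  then show thesis using that[of \<eta>] by (auto simp: subset_iff dist_real_def abs_minus_commute)
qed

section \<open>Error propagation inside one chart\<close>

abbreviation zR :: "real \<Rightarrow> nat \<Rightarrow> 'p" where "zR h k \<equiv> (RH h ^^ k) z0"
abbreviation zS :: "real \<Rightarrow> nat \<Rightarrow> 'p" where "zS h k \<equiv> (SH h ^^ k) z0"

text \<open>Domain membership is included, since coordinates of points outside the chart domain say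
  nothing. RATTLE iterates alone are tracked; each SHAKE iterate is compared with the preceding one
  of them.\<close>

definition tracks :: "('p, 'e) chart \<Rightarrow> real \<Rightarrow> real \<Rightarrow> nat \<Rightarrow> bool" where
  "tracks c C h k \<longleftrightarrow> zR h k \<in> dom_of c \<and> norm (snd c (zR h k) - snd c (\<gamma> (real k * h))) \<le> C * h"

text \<open>The width \<open>\<eta>\<close> is independent of the error constant \<open>C0\<close>
  at entry; the new constant \<open>C1\<close> and the step bound \<open>h1\<close> depend on it.
  Constants may therefore grow from window to window while the windows are fixed beforehand.\<close>

lemma window:
  assumes s: "s \<in> {0..T}"
  obtains c \<eta> where "smooth_chart A c" "\<eta> > 0"
    "\<And>t. t \<in> {0..T} \<Longrightarrow> \<bar>t - s\<bar> < \<eta> \<Longrightarrow> \<gamma> t \<in> dom_of c"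
    "\<And>C0. C0 \<ge> 0 \<Longrightarrow> \<exists>C1>0. \<exists>h1>0. \<forall>h k0 j. 0 < h \<and> h < h1 \<and> \<bar>real k0 * h - s\<bar> < \<eta> \<and>
      \<bar>real (k0 + j) * h - s\<bar> < \<eta> \<and> real (k0 + j) * h \<le> T \<and> tracks c C0 h k0 \<longrightarrow>
      tracks c C1 h (k0 + j)"
    "\<And>C0. C0 \<ge> 0 \<Longrightarrow> \<exists>C1>0. \<exists>h1>0. \<forall>h k. 0 < h \<and> h < h1 \<and> \<bar>real k * h - s\<bar> < \<eta> \<and>
      \<bar>real (Suc k) * h - s\<bar> < \<eta> \<and> real (Suc k) * h \<le> T \<and> tracks c C0 h k \<longrightarrow>
      zS h (Suc k) \<in> dom_of c \<and> norm (snd c (zS h (Suc k)) - snd c (\<gamma> (real (Suc k) * h))) \<le> C1 * h"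
proof -
  obtain c \<delta> C K Y where c: "smooth_chart A c" "\<gamma> s \<in> dom_of c" and \<delta>: "\<delta> > 0" "C > 0" "K > 0" "\<delta> \<le> h0"
      "ball (snd c (\<gamma> s)) \<delta> \<subseteq> img_of c"
    and Y: "\<And>x y. x \<in> ball (snd c (\<gamma> s)) \<delta> \<Longrightarrow> y \<in> ball (snd c (\<gamma> s)) \<delta> \<Longrightarrow> norm (Y x - Y y) \<le> K * norm (x - y)"
    and step: "\<And>p h. p \<in> MH \<Longrightarrow> p \<in> dom_of c \<Longrightarrow> snd c p \<in> ball (snd c (\<gamma> s)) \<delta> \<Longrightarrow> 0 < h \<Longrightarrow> h < \<delta> \<Longrightarrow>
      SH h p \<in> dom_of c \<and> RH h p \<in> dom_of c \<and> norm (snd c (SH h p) - snd c p) \<le> C * h \<and>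
      norm (snd c (RH h p) - snd c p - h *\<^sub>R Y (snd c p)) \<le> C * h\<^sup>2"
    and der: "\<And>T \<gamma>' t. constrained_solution A \<omega> M H T \<gamma>' \<Longrightarrow> t \<in> {0..T} \<Longrightarrow> \<gamma>' t \<in> dom_of c \<Longrightarrow> snd c (\<gamma>' t) \<in> ball (snd c (\<gamma> s)) \<delta> \<Longrightarrow>
      ((\<lambda>s. snd c (\<gamma>' s)) has_vector_derivative Y (snd c (\<gamma>' t))) (at t within {0..T})"
    by (rule local_model[OF \<gamma>_MH[OF s]]) (rule that; assumption)
  define x0 where "x0 = snd c (\<gamma> s)"
  define y where "y t = snd c (\<gamma> t)" for t
  \<comment> \<open>The solution keeps to the inner half of the ball on which the one-step bounds
    hold; the outer half is left for the error.\<close>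
  obtain \<eta> where \<eta>: "\<eta> > 0"
    "\<And>t. t \<in> {0..T} \<Longrightarrow> \<bar>t - s\<bar> < \<eta> \<Longrightarrow> \<gamma> t \<in> dom_of c \<and> y t \<in> ball x0 (\<delta> / 2)"
    using \<gamma>_near[OF c(1) s c(2), of "\<delta> / 2"] \<delta> unfolding x0_def y_def by (metis half_gt_zero)
  define I' where "I' = {0..T} \<inter> ball s \<eta>"
  have I': "convex I'" unfolding I'_def by (intro convex_Int convex_closed_interval convex_ball)
  have yI: "\<gamma> t \<in> dom_of c" "y t \<in> ball x0 (\<delta> / 2)" "y t \<in> ball x0 \<delta>" if "t \<in> I'" for t
    using \<eta>(2)[of t] that \<delta> by (auto simp: I'_def dist_real_def abs_minus_commute)
  have y': "(y has_derivative (\<lambda>h. h *\<^sub>R Y (y t))) (at t within I')" if t: "t \<in> I'" for t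
  proof -
    have "(y has_vector_derivative Y (y t)) (at t within {0..T})"
      using der[OF sol, of t] t yI[OF t] by (simp add: I'_def y_def[abs_def] x0_def)
    then show ?thesis unfolding has_vector_derivative_def
      by (rule has_derivative_subset) (auto simp: I'_def)
  qed
  define B where "B = norm (Y x0) + K * \<delta>"
  have B: "B \<ge> 0" using \<delta> by (simp add: B_def)
  have YB: "norm (Y (y t)) \<le> B" if "t \<in> I'" for t
  proof -
    have "norm (Y (y t) - Y x0) \<le> K * norm (y t - x0)"
      using Y[of "y t" x0] yI(3)[OF that] \<delta> by (simp add: x0_def)
    also have "\<dots> \<le> K * \<delta>" using yI(3)[OF that] \<delta> by (intro mult_left_mono) (auto simp: dist_norm norm_minus_commute)
    finally show ?thesis using norm_triangle_sub[of "Y (y t)" "Y x0"] by (simp add: B_def)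
  qed
  have y_lip: "norm (y t - y t') \<le> B * \<bar>t - t'\<bar>" if "t \<in> I'" "t' \<in> I'" for t t'
  proof -
    have "norm (y t - y t') \<le> B * norm (t - t')"
      by (rule differentiable_bound[OF I' y' _ that])
        (auto intro!: onorm_le mult_left_mono YB simp: mult.commute[of B])
    then show ?thesis by simp
  qed
  have y_step: "norm (y (t + h) - y t - h *\<^sub>R Y (y t)) \<le> K * B * h\<^sup>2" if t: "t \<in> I'" "t + h \<in> I'" "0 < h" for t h
  proof -
    have sub: "{t..t + h} \<subseteq> I'"
      using I' t by (auto simp: I'_def dist_real_def)
    have "norm ((y (t + h) - (t + h) *\<^sub>R Y (y t)) - (y t - t *\<^sub>R Y (y t))) \<le> (K * B * h) * norm (t + h - t)"
    proof (rule differentiable_bound[of "{t..t + h}"])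
      fix r assume r: "r \<in> {t..t + h}"
      then have rI: "r \<in> I'" using sub by blast
      show "((\<lambda>r. y r - r *\<^sub>R Y (y t)) has_derivative (\<lambda>h. h *\<^sub>R Y (y r) - h *\<^sub>R Y (y t))) (at r within {t..t + h})"
        by (intro has_derivative_diff has_derivative_subset[OF y'[OF rI] sub] has_derivative_scaleR_left has_derivative_ident)
      have "norm (Y (y r) - Y (y t)) \<le> K * norm (y r - y t)"
        using Y yI(3) rI t by (simp add: x0_def)
      also have "\<dots> \<le> K * (B * \<bar>r - t\<bar>)" using y_lip[OF rI t(1)] \<delta> by (intro mult_left_mono) auto
      also have "\<dots> \<le> K * (B * h)" using r \<delta> B by (intro mult_left_mono) auto
      finally have b: "norm (Y (y r) - Y (y t)) \<le> K * B * h" by simp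
      show "onorm (\<lambda>h. h *\<^sub>R Y (y r) - h *\<^sub>R Y (y t)) \<le> K * B * h"
      proof (rule onorm_le)
        fix a :: real
        have "norm (a *\<^sub>R Y (y r) - a *\<^sub>R Y (y t)) = \<bar>a\<bar> * norm (Y (y r) - Y (y t))"
          by (simp flip: scaleR_diff_right)
        also have "\<dots> \<le> \<bar>a\<bar> * (K * B * h)" using b by (intro mult_left_mono) auto
        finally show "norm (a *\<^sub>R Y (y r) - a *\<^sub>R Y (y t)) \<le> K * B * h * norm a" by (simp add: mult.commute)
      qed
    qed (use t in auto)
    then show ?thesis using t by (simp add: algebra_simps power2_eq_square)
  qed
  \<comment> \<open>The local error constant: \<open>C\<close> from the RATTLE step,
    \<open>K * B\<close> from the remainder of the solution over one step.\<close>
  define C2 where "C2 = C + K * B"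
  have C2: "C2 > 0" using \<delta> B by (simp add: C2_def add_pos_nonneg)
  have in_I': "real k * h \<in> I'" if "0 < h" "\<bar>real k * h - s\<bar> < \<eta>" "real k * h \<le> T" for h k
    using that by (auto simp: I'_def dist_real_def abs_minus_commute)
  have e_step: "zR h (Suc k) \<in> dom_of c \<and> norm (snd c (zR h (Suc k)) - y (real (Suc k) * h)) \<le>
      (1 + K * h) * norm (snd c (zR h k) - y (real k * h)) + C2 * h\<^sup>2"
    if h: "0 < h" "h < \<delta>" and k: "real k * h \<in> I'" "real (Suc k) * h \<in> I'"
      and z: "zR h k \<in> dom_of c" "snd c (zR h k) \<in> ball x0 \<delta>" for h k
  proof -
    have zMH: "zR h k \<in> MH" using iterates(1)[OF _ _ z0_MH] h \<delta> by simp
    have st: "RH h (zR h k) \<in> dom_of c"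
      "norm (snd c (RH h (zR h k)) - snd c (zR h k) - h *\<^sub>R Y (snd c (zR h k))) \<le> C * h\<^sup>2"
      using step[OF zMH z(1)] z(2) h by (auto simp: x0_def)
    define a where "a = snd c (zR h k)"
    define b where "b = y (real k * h)"
    have "norm (Y a - Y b) \<le> K * norm (a - b)" using Y[of a b] z(2) yI(3)[OF k(1)] by (simp add: a_def b_def x0_def)
    then have 2: "norm (h *\<^sub>R (Y a - Y b)) \<le> K * h * norm (a - b)" using h by simp
    have "real (Suc k) * h = real k * h + h" by (simp add: algebra_simps)
    then have 3: "norm (y (real (Suc k) * h) - b - h *\<^sub>R Y b) \<le> K * B * h\<^sup>2"
      using y_step[OF k(1) _ h(1)] k(2) by (simp add: b_def)
    define p where "p = snd c (RH h (zR h k)) - a - h *\<^sub>R Y a"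
    define q where "q = y (real (Suc k) * h) - b - h *\<^sub>R Y b"
    have "snd c (zR h (Suc k)) - y (real (Suc k) * h) = p + (a - b) + h *\<^sub>R (Y a - Y b) - q"
      by (simp add: p_def q_def algebra_simps)
    also have "norm \<dots> \<le> C * h\<^sup>2 + norm (a - b) + K * h * norm (a - b) + K * B * h\<^sup>2"
      using st(2)[folded a_def, folded p_def] 2 3[folded q_def] norm_triangle_ineq[of p "a - b"]
        norm_triangle_ineq[of "p + (a - b)" "h *\<^sub>R (Y a - Y b)"]
        norm_triangle_ineq4[of "p + (a - b) + h *\<^sub>R (Y a - Y b)" q] by linarith
    finally show ?thesis using st(1) by (simp add: a_def b_def C2_def algebra_simps)
  qed
  show thesis
  proof (rule that[OF c(1) \<eta>(1)])
    show "\<gamma> t \<in> dom_of c" if "t \<in> {0..T}" "\<bar>t - s\<bar> < \<eta>" for t using \<eta>(2)[OF that] by blast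
    fix C0 :: real assume C0: "C0 \<ge> 0"
    \<comment> \<open>Discrete Gronwall bound: the entry error and at most \<open>T / h\<close>
      local errors \<open>C2 * h\<^sup>2\<close>, amplified by at most \<open>exp (K * T)\<close>.
      The summand 1 keeps the constant positive.\<close>
    define C1 where "C1 = (C0 + T * C2) * exp (K * T) + 1"
    have C1: "C1 > 0" using C0 T C2 by (simp add: C1_def add_nonneg_pos)
    \<comment> \<open>With \<open>C1 * h < \<delta> / 2\<close> the iterates stay in the ball and
      the one-step bound can be applied again.\<close>
    define h1 where "h1 = min \<delta> (\<delta> / (2 * C1))"
    have h1: "h1 > 0" using \<delta> C1 by (simp add: h1_def)
    have h1C: "C1 * h < \<delta> / 2" if "0 < h" "h < h1" for h
    proof -
      have "C1 * h < C1 * (\<delta> / (2 * C1))" using that C1 by (intro mult_strict_left_mono) (auto simp: h1_def)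
      also have "\<dots> = \<delta> / 2" using C1 by simp
      finally show ?thesis .
    qed
    have bound: "tracks c C1 h (k0 + j)"
      if h: "0 < h" "h < h1" and k0: "\<bar>real k0 * h - s\<bar> < \<eta>" and kj: "\<bar>real (k0 + j) * h - s\<bar> < \<eta>" "real (k0 + j) * h \<le> T"
        and z0: "tracks c C0 h k0" for h k0 j
    proof -
      have z: "zR h k0 \<in> dom_of c" "norm (snd c (zR h k0) - y (real k0 * h)) \<le> C0 * h"
        using z0 by (auto simp: tracks_def y_def)
      have h\<delta>: "h < \<delta>" using h by (simp add: h1_def)
      have inI: "real (k0 + i) * h \<in> I'" if "i \<le> j" for i
      proof (rule in_I')
        have "real k0 * h \<le> real (k0 + i) * h" "real (k0 + i) * h \<le> real (k0 + j) * h"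
          using that h by (auto intro!: mult_right_mono)
        then show "\<bar>real (k0 + i) * h - s\<bar> < \<eta>" "real (k0 + i) * h \<le> T" using k0 kj by auto
      qed (use h in simp)
      have bd: "(C0 + real i * h * C2) * h * exp (K * (real i * h)) \<le> C1 * h" if "i \<le> j" for i
      proof -
        have "real i * h \<le> real (k0 + i) * h" using h by (intro mult_right_mono) auto
        also have "\<dots> \<le> T" using inI[OF that] by (simp add: I'_def)
        finally have iT: "real i * h \<le> T" .
        have "(C0 + real i * h * C2) * exp (K * (real i * h)) \<le> (C0 + T * C2) * exp (K * T)"
          using iT h C0 C2 \<delta> T by (intro mult_mono add_mono mult_right_mono) (auto intro!: mult_left_mono add_nonneg_nonneg)
        then have "(C0 + real i * h * C2) * exp (K * (real i * h)) * h \<le> C1 * h"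
          using h by (intro mult_right_mono) (auto simp: C1_def)
        then show ?thesis by (simp add: mult_ac)
      qed
      \<comment> \<open>Domain and error bound go through the induction together: the bound at step
        \<open>i\<close> puts the iterate into the ball in which the next step is
        controlled.\<close>
      have "i \<le> j \<Longrightarrow> zR h (k0 + i) \<in> dom_of c \<and>
        norm (snd c (zR h (k0 + i)) - y (real (k0 + i) * h)) \<le> (C0 + real i * h * C2) * h * exp (K * (real i * h))" for i
      proof (induction i)
        case 0
        then show ?case using z by simp
      next
        case (Suc i)
        then have IH: "zR h (k0 + i) \<in> dom_of c"
          "norm (snd c (zR h (k0 + i)) - y (real (k0 + i) * h)) \<le> (C0 + real i * h * C2) * h * exp (K * (real i * h))"
          and ij: "i \<le> j" by auto
        define e where "e = norm (snd c (zR h (k0 + i)) - y (real (k0 + i) * h))"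
        have "e \<le> C1 * h" using IH(2) bd[OF ij] by (simp add: e_def)
        then have "e < \<delta> / 2" using h1C[OF h] by simp
        moreover have "norm (x0 - y (real (k0 + i) * h)) < \<delta> / 2" using yI(2)[OF inI[OF ij]] by (simp add: dist_norm)
        ultimately have "snd c (zR h (k0 + i)) \<in> ball x0 \<delta>"
          using norm_triangle_ineq4[of "x0 - y (real (k0 + i) * h)" "snd c (zR h (k0 + i)) - y (real (k0 + i) * h)"]
          by (simp add: dist_norm e_def)
        from e_step[OF h(1) h\<delta> inI[OF ij] _ IH(1) this] inI[OF Suc.prems]
        have 1: "zR h (k0 + Suc i) \<in> dom_of c"
          "norm (snd c (zR h (k0 + Suc i)) - y (real (k0 + Suc i) * h)) \<le> (1 + K * h) * e + C2 * h\<^sup>2"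
          by (simp_all add: e_def)
        define a where "a = (C0 + real i * h * C2) * h"
        have a: "a \<ge> 0" using C0 C2 h by (simp add: a_def)
        define X where "X = exp (K * (real i * h))"
        have X: "X \<ge> 1" using h \<delta> by (simp add: X_def)
        have Kh: "1 + K * h \<le> exp (K * h)" by (rule exp_ge_add_one_self)
        have XX: "exp (K * (real (Suc i) * h)) = exp (K * h) * X"
          by (simp add: X_def algebra_simps flip: exp_add)
        have "(1 + K * h) * e \<le> exp (K * h) * (a * X)"
          using IH(2) Kh h \<delta> a X by (intro mult_mono) (auto simp: e_def a_def X_def)
        moreover have "C2 * h\<^sup>2 \<le> C2 * h\<^sup>2 * (exp (K * h) * X)"
        proof -
          have "1 * 1 \<le> exp (K * h) * X" using X h \<delta> by (intro mult_mono) auto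
          then show ?thesis using C2 mult_left_mono[of 1 "exp (K * h) * X" "C2 * h\<^sup>2"] by simp
        qed
        ultimately have "(1 + K * h) * e + C2 * h\<^sup>2 \<le> (a + C2 * h\<^sup>2) * (exp (K * h) * X)"
          by (simp add: algebra_simps)
        also have "\<dots> = (C0 + real (Suc i) * h * C2) * h * exp (K * (real (Suc i) * h))"
          unfolding XX by (simp add: a_def algebra_simps power2_eq_square)
        finally show ?case using 1 by linarith
      qed
      from this[of j] bd[of j] show ?thesis by (auto simp: tracks_def y_def)
    qed
    show "\<exists>C1>0. \<exists>h1>0. \<forall>h k0 j. 0 < h \<and> h < h1 \<and> \<bar>real k0 * h - s\<bar> < \<eta> \<and>
      \<bar>real (k0 + j) * h - s\<bar> < \<eta> \<and> real (k0 + j) * h \<le> T \<and> tracks c C0 h k0 \<longrightarrow>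
      tracks c C1 h (k0 + j)"
    proof (intro exI conjI allI impI)
      fix h k0 j
      assume *: "0 < h \<and> h < h1 \<and> \<bar>real k0 * h - s\<bar> < \<eta> \<and>
        \<bar>real (k0 + j) * h - s\<bar> < \<eta> \<and> real (k0 + j) * h \<le> T \<and> tracks c C0 h k0"
      show "tracks c C1 h (k0 + j)" by (rule bound) (use * in blast)+
    qed (fact C1 h1)+
    have shake: "zS h (Suc k) \<in> dom_of c \<and> norm (snd c (zS h (Suc k)) - y (real (Suc k) * h)) \<le> (C + C1 + B) * h"
      if h: "0 < h" "h < h1" and k: "\<bar>real k * h - s\<bar> < \<eta>" "\<bar>real (Suc k) * h - s\<bar> < \<eta>" "real (Suc k) * h \<le> T"
        and z0: "tracks c C0 h k" for h k
    proof -
      have h\<delta>: "h < \<delta>" using h by (simp add: h1_def)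
      have kT: "real k * h \<le> T" using k(3) h by (simp add: algebra_simps)
      \<comment> \<open>The case \<open>j = 0\<close> of the RATTLE bound passes from
        \<open>C0\<close> to \<open>C1\<close>, the constant for which \<open>h1\<close> was
        chosen.\<close>
      have z: "zR h k \<in> dom_of c" and e1: "norm (snd c (zR h k) - y (real k * h)) \<le> C1 * h"
        using bound[OF h k(1), of 0] k(1) kT z0 by (simp_all add: tracks_def y_def)
      have "norm (x0 - y (real k * h)) < \<delta> / 2"
        using yI(2)[OF in_I'[OF h(1) k(1) kT]] by (simp add: dist_norm)
      then have "snd c (zR h k) \<in> ball x0 \<delta>"
        using norm_triangle_ineq4[of "x0 - y (real k * h)" "snd c (zR h k) - y (real k * h)"] e1 h1C[OF h]
        by (simp add: dist_norm)
      moreover have zMH: "zR h k \<in> MH" using iterates(1)[OF _ _ z0_MH] h h\<delta> \<delta> by simp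
      ultimately have st: "SH h (zR h k) \<in> dom_of c" "norm (snd c (SH h (zR h k)) - snd c (zR h k)) \<le> C * h"
        using step[OF zMH z] h h\<delta> by (auto simp: x0_def)
      have "norm (y (real k * h) - y (real (Suc k) * h)) \<le> B * h"
        using y_lip[OF in_I'[OF h(1) k(1) kT] in_I'[OF h(1) k(2,3)]] h by (simp add: algebra_simps)
      then have "norm ((snd c (SH h (zR h k)) - snd c (zR h k)) + (snd c (zR h k) - y (real k * h)) +
          (y (real k * h) - y (real (Suc k) * h))) \<le> C * h + C1 * h + B * h"
        using st(2) e1 by (intro norm_triangle_le add_mono) auto
      moreover have "zS h (Suc k) = SH h (zR h k)"
        using iterates(2)[OF _ _ z0_MH] h h\<delta> \<delta> by simp
      ultimately show ?thesis using st by (simp add: algebra_simps)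
    qed
    show "\<exists>C1>0. \<exists>h1>0. \<forall>h k. 0 < h \<and> h < h1 \<and> \<bar>real k * h - s\<bar> < \<eta> \<and>
      \<bar>real (Suc k) * h - s\<bar> < \<eta> \<and> real (Suc k) * h \<le> T \<and> tracks c C0 h k \<longrightarrow>
      zS h (Suc k) \<in> dom_of c \<and> norm (snd c (zS h (Suc k)) - snd c (\<gamma> (real (Suc k) * h))) \<le> C1 * h"
    proof (intro exI conjI allI impI)
      show "C + C1 + B > 0" using C1 \<delta> B by simp
      fix h k
      assume *: "0 < h \<and> h < h1 \<and> \<bar>real k * h - s\<bar> < \<eta> \<and>
        \<bar>real (Suc k) * h - s\<bar> < \<eta> \<and> real (Suc k) * h \<le> T \<and> tracks c C0 h k"
      note b = shake[of h k, unfolded y_def]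
      show "zS h (Suc k) \<in> dom_of c" by (rule b[THEN conjunct1]) (use * in blast)+
      show "norm (snd c (zS h (Suc k)) - snd c (\<gamma> (real (Suc k) * h))) \<le> (C + C1 + B) * h"
        by (rule b[THEN conjunct2]) (use * in blast)+
    qed (fact h1)
  qed
qed

end

section \<open>Propagation of the error bound along the whole solution\<close>

context shake_rattle_solution
begin

text \<open>All steps at times close to \<open>t\<close> are required at once, with constants
  uniform in h, because \<open>t\<close> itself is in general no multiple of h.\<close>

definition near :: "('p, 'e) chart \<Rightarrow> real \<Rightarrow> bool" where
  "near c t \<longleftrightarrow> (\<exists>C>0. \<exists>h1>0. \<exists>\<eta>>0. \<forall>h k. 0 < h \<and> h < h1 \<and> \<bar>real k * h - t\<bar> < \<eta> \<and> real k * h \<le> T \<longrightarrow>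
     tracks c C h k \<and> \<gamma> (real k * h) \<in> dom_of c)"

text \<open>The transition map is Lipschitz near the point of the solution; a smaller bound on h and
  a shorter time interval bring both points into the region where this holds.\<close>

lemma near_change_chart:
  assumes near: "near c t" and t: "t \<in> {0..T}" and c: "smooth_chart A c" "\<gamma> t \<in> dom_of c"
    and d: "smooth_chart A d" "\<gamma> t \<in> dom_of d"
  shows "near d t"
proof -
  obtain C h1 \<eta> where n: "C > 0" "h1 > 0" "\<eta> > 0"
    "\<And>h k. 0 < h \<Longrightarrow> h < h1 \<Longrightarrow> \<bar>real k * h - t\<bar> < \<eta> \<Longrightarrow> real k * h \<le> T \<Longrightarrow>
     tracks c C h k \<and> \<gamma> (real k * h) \<in> dom_of c"
    using near unfolding near_def by blast
  let ?S = "snd c ` (dom_of c \<inter> dom_of d)"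
  have "snd c (\<gamma> t) \<in> ?S" using c d by blast
  from smooth_on_locally_lipschitz[OF transition_open[OF c(1) d(1)] transition_smooth[OF c(1) d(1)] this]
  obtain r K where r: "r > 0" "K > 0" "ball (snd c (\<gamma> t)) r \<subseteq> ?S"
    "\<And>x y. x \<in> ball (snd c (\<gamma> t)) r \<Longrightarrow> y \<in> ball (snd c (\<gamma> t)) r \<Longrightarrow>
      norm (snd d (chart_inv c x) - snd d (chart_inv c y)) \<le> K * norm (x - y)" by blast
  obtain \<eta>1 where \<eta>1: "\<eta>1 > 0" "\<And>s. s \<in> {0..T} \<Longrightarrow> \<bar>s - t\<bar> < \<eta>1 \<Longrightarrow>
      \<gamma> s \<in> dom_of c \<and> snd c (\<gamma> s) \<in> ball (snd c (\<gamma> t)) (r / 2)"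
    using \<gamma>_near[OF c(1) t c(2), of "r / 2"] r by (metis half_gt_zero)
  have dom: "p \<in> dom_of d" if "p \<in> dom_of c" "snd c p \<in> ball (snd c (\<gamma> t)) r" for p
  proof -
    have "snd c p \<in> ?S" using that(2) r(3) by blast
    then obtain q where "snd c p = snd c q" "q \<in> dom_of c" "q \<in> dom_of d" by blast
    then show ?thesis using chart_simps(1)[OF c(1)] that(1) by metis
  qed
  show ?thesis unfolding near_def
  proof (intro exI conjI allI impI)
    show "K * C > 0" "min h1 (r / (2 * C)) > 0" "min \<eta> \<eta>1 > 0" using n r \<eta>1 by auto
    fix h k assume hk: "0 < h \<and> h < min h1 (r / (2 * C)) \<and> \<bar>real k * h - t\<bar> < min \<eta> \<eta>1 \<and> real k * h \<le> T"
    then have e: "zR h k \<in> dom_of c" "\<gamma> (real k * h) \<in> dom_of c"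
      "norm (snd c (zR h k) - snd c (\<gamma> (real k * h))) \<le> C * h" using n(4)[of h k] by (auto simp: tracks_def)
    have kh: "real k * h \<in> {0..T}" using hk by simp
    have b1: "snd c (\<gamma> (real k * h)) \<in> ball (snd c (\<gamma> t)) (r / 2)" using \<eta>1(2)[OF kh] hk by simp
    have "C * h < C * (r / (2 * C))" using hk n by (intro mult_strict_left_mono) auto
    then have "C * h < r / 2" using n by simp
    then have b2: "snd c (zR h k) \<in> ball (snd c (\<gamma> t)) r"
      using b1 e(3) dist_triangle[of "snd c (\<gamma> t)" "snd c (zR h k)" "snd c (\<gamma> (real k * h))"]
      by (simp add: dist_norm norm_minus_commute)
    have b1': "snd c (\<gamma> (real k * h)) \<in> ball (snd c (\<gamma> t)) r" using b1 r by auto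
    show "\<gamma> (real k * h) \<in> dom_of d" using dom e b1' by auto
    have "norm (snd d (zR h k) - snd d (\<gamma> (real k * h))) \<le> K * norm (snd c (zR h k) - snd c (\<gamma> (real k * h)))"
      using r(4)[OF b2 b1'] e chart_simps(1)[OF c(1)] by simp
    also have "\<dots> \<le> K * (C * h)" using e r by (intro mult_left_mono) auto
    finally show "tracks d (K * C) h k" using dom[OF e(1) b2] by (simp add: tracks_def)
  qed
qed

text \<open>Propagation goes forward in time: the bound at \<open>t\<close> supplies, for every
  small h, an index \<open>k0\<close> in the window from which \<open>window\<close> takes over. At
  \<open>t = 0\<close> the start is exact, with \<open>k0 = 0\<close> and
  \<open>C0 = 0\<close>.\<close>

lemma near_window:
  assumes s: "s \<in> {0..T}"
  obtains c \<eta> where "smooth_chart A c" "\<eta> > 0" "\<And>t. t \<in> {0..T} \<Longrightarrow> \<bar>t - s\<bar> < \<eta> \<Longrightarrow> \<gamma> t \<in> dom_of c"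
    "\<And>t t'. t \<in> {0..T} \<Longrightarrow> t' \<in> {0..T} \<Longrightarrow> \<bar>t - s\<bar> < \<eta> \<Longrightarrow> \<bar>t' - s\<bar> < \<eta> \<Longrightarrow> t = 0 \<or> near c t \<Longrightarrow>
      t < t' \<or> t = 0 \<and> t' = 0 \<Longrightarrow> near c t'"
proof -
  obtain c \<eta> where c: "smooth_chart A c" and \<eta>: "\<eta> > 0" and dom: "\<And>t. t \<in> {0..T} \<Longrightarrow> \<bar>t - s\<bar> < \<eta> \<Longrightarrow> \<gamma> t \<in> dom_of c"
    and bound: "\<And>C0. C0 \<ge> 0 \<Longrightarrow> \<exists>C1>0. \<exists>h1>0. \<forall>h k0 j. 0 < h \<and> h < h1 \<and> \<bar>real k0 * h - s\<bar> < \<eta> \<and>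
      \<bar>real (k0 + j) * h - s\<bar> < \<eta> \<and> real (k0 + j) * h \<le> T \<and> tracks c C0 h k0 \<longrightarrow>
      tracks c C1 h (k0 + j)"
    by (rule window[OF s]) blast
  show thesis
  proof (rule that[OF c \<eta> dom])
    fix t t' assume t: "t \<in> {0..T}" "\<bar>t - s\<bar> < \<eta>" and t': "t' \<in> {0..T}" "\<bar>t' - s\<bar> < \<eta>"
      and start: "t = 0 \<or> near c t" and less: "t < t' \<or> t = 0 \<and> t' = 0"
    have "\<exists>C0\<ge>0. \<exists>h1>0. \<forall>h. 0 < h \<and> h < h1 \<longrightarrow> (\<exists>k0. real k0 * h \<le> t \<and> \<bar>real k0 * h - s\<bar> < \<eta> \<and>
      tracks c C0 h k0)"
    proof (cases "t = 0")
      case True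
      have "z0 \<in> dom_of c" using dom[OF t] True \<gamma>0 by simp
      then show ?thesis using True t \<gamma>0
        by (intro exI[of _ 0] conjI exI[of _ 1] allI impI exI[of _ "0::nat"]) (auto simp: tracks_def)
    next
      case False
      then obtain C h1 \<eta>' where n: "C > 0" "h1 > 0" "\<eta>' > 0"
        "\<And>h k. 0 < h \<Longrightarrow> h < h1 \<Longrightarrow> \<bar>real k * h - t\<bar> < \<eta>' \<Longrightarrow> real k * h \<le> T \<Longrightarrow>
         tracks c C h k \<and> \<gamma> (real k * h) \<in> dom_of c"
        using start unfolding near_def by blast
      define h2 where "h2 = min h1 (min \<eta>' (\<eta> - \<bar>t - s\<bar>))"
      have "\<exists>k0. real k0 * h \<le> t \<and> \<bar>real k0 * h - s\<bar> < \<eta> \<and>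
        tracks c C h k0" if h: "0 < h" "h < h2" for h
      proof -
        \<comment> \<open>The last step not after \<open>t\<close>; since h is below
          \<open>\<eta> - \<bar>t - s\<bar>\<close>, it still lies in the window.\<close>
        define k0 where "k0 = nat \<lfloor>t / h\<rfloor>"
        have "real k0 = of_int \<lfloor>t / h\<rfloor>" using t h by (simp add: k0_def)
        then have "real k0 \<le> t / h" "t / h < real k0 + 1" by linarith+
        then have k: "real k0 * h \<le> t" "t < real k0 * h + h" using h by (auto simp: field_simps)
        have "tracks c C h k0"
          using n(4)[of h k0] k h t by (simp add: h2_def)
        moreover have "h < \<eta> - \<bar>t - s\<bar>" using h by (simp add: h2_def)
        then have "\<bar>real k0 * h - s\<bar> < \<eta>" using k by linarith
        ultimately show ?thesis using k by blast
      qed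
      then show ?thesis using n t by (intro exI[of _ C] conjI exI[of _ h2]) (auto simp: h2_def)
    qed
    then obtain C0 h1 where C0: "C0 \<ge> 0" "h1 > 0" "\<And>h. 0 < h \<Longrightarrow> h < h1 \<Longrightarrow> \<exists>k0. real k0 * h \<le> t \<and> \<bar>real k0 * h - s\<bar> < \<eta> \<and>
      tracks c C0 h k0"
      by blast
    obtain C1 h2 where C1: "C1 > 0" "h2 > 0" "\<And>h k0 j. 0 < h \<and> h < h2 \<and> \<bar>real k0 * h - s\<bar> < \<eta> \<and>
      \<bar>real (k0 + j) * h - s\<bar> < \<eta> \<and> real (k0 + j) * h \<le> T \<and> tracks c C0 h k0 \<Longrightarrow>
      tracks c C1 h (k0 + j)"
      using bound[OF C0(1)] by blast
    \<comment> \<open>Steps counted as close to \<open>t'\<close> must not precede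
      \<open>k0\<close>, so the distance to \<open>t'\<close> is kept below \<open>t' - t\<close>.
      If both times are 0, then \<open>k0 = 0\<close> and the value 1 is an arbitrary positive
      choice.\<close>
    define \<eta>2 where "\<eta>2 = min (\<eta> - \<bar>t' - s\<bar>) (if t < t' then t' - t else 1)"
    show "near c t'" unfolding near_def
    proof (intro exI conjI allI impI)
      show "C1 > 0" "min h1 h2 > 0" "\<eta>2 > 0" using C0 C1 t' by (auto simp: \<eta>2_def)
      fix h k assume hk: "0 < h \<and> h < min h1 h2 \<and> \<bar>real k * h - t'\<bar> < \<eta>2 \<and> real k * h \<le> T"
      obtain k0 where k0: "real k0 * h \<le> t" "\<bar>real k0 * h - s\<bar> < \<eta>"
        "tracks c C0 h k0"
        using C0(3)[of h] hk by auto
      have ks: "\<bar>real k * h - s\<bar> < \<eta>" using hk by (auto simp: \<eta>2_def)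
      have "k0 \<le> k"
      proof (cases "t < t'")
        case True
        then have "\<bar>real k * h - t'\<bar> < t' - t" using hk by (simp add: \<eta>2_def)
        then have "real k0 * h < real k * h" using k0(1) by linarith
        then have "real k0 < real k" by (rule mult_right_less_imp_less) (use hk in simp)
        then show ?thesis by simp
      next
        case False
        then have "real k0 * h \<le> 0" using less k0(1) by auto
        then show ?thesis using hk by (simp add: mult_le_0_iff)
      qed
      then obtain j where j: "k = k0 + j" using le_Suc_ex by blast
      show "tracks c C1 h k"
        using C1(3)[of h k0 j] k0 hk ks j by auto
      show "\<gamma> (real k * h) \<in> dom_of c" using dom[OF _ ks] hk by simp
    qed
  qed
qed

lemma near_solution:
  assumes t: "t \<in> {0..T}" and c: "smooth_chart A c" "\<gamma> t \<in> dom_of c"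
  shows "near c t"
proof -
  \<comment> \<open>Connectedness requires the property to pass between nearby times in both
    directions. Covering all times up to \<open>t\<close> makes the backward direction trivial, so
    that forward propagation suffices. Reference charts are used because each window has its own
    chart.\<close>
  define P where "P t \<longleftrightarrow> (\<forall>r\<in>{0..t}. near (ref (\<gamma> r)) r)" for t
  have "P T"
  proof (rule connected_induction_simple[of "{0..T}" 0])
    show "connected {0..T}" "0 \<in> {0..T}" "T \<in> {0..T}" using T by auto
    obtain c \<eta> where w: "smooth_chart A c" "\<eta> > 0" "\<And>t. t \<in> {0..T} \<Longrightarrow> \<bar>t - 0\<bar> < \<eta> \<Longrightarrow> \<gamma> t \<in> dom_of c"
      "\<And>t t'. t \<in> {0..T} \<Longrightarrow> t' \<in> {0..T} \<Longrightarrow> \<bar>t - 0\<bar> < \<eta> \<Longrightarrow> \<bar>t' - 0\<bar> < \<eta> \<Longrightarrow> t = 0 \<or> near c t \<Longrightarrow>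
        t < t' \<or> t = 0 \<and> t' = 0 \<Longrightarrow> near c t'"
      using near_window[of 0] T by auto
    have "near c 0" using w(4)[of 0 0] w(2) T by simp
    then have "near (ref (\<gamma> 0)) 0"
      by (rule near_change_chart) (use w T ref in auto)
    then show "P 0" by (simp add: P_def)
  next
    fix s assume s: "s \<in> {0..T}"
    obtain c \<eta> where w: "smooth_chart A c" "\<eta> > 0" "\<And>t. t \<in> {0..T} \<Longrightarrow> \<bar>t - s\<bar> < \<eta> \<Longrightarrow> \<gamma> t \<in> dom_of c"
      "\<And>t t'. t \<in> {0..T} \<Longrightarrow> t' \<in> {0..T} \<Longrightarrow> \<bar>t - s\<bar> < \<eta> \<Longrightarrow> \<bar>t' - s\<bar> < \<eta> \<Longrightarrow> t = 0 \<or> near c t \<Longrightarrow>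
        t < t' \<or> t = 0 \<and> t' = 0 \<Longrightarrow> near c t'"
      using near_window[OF s] by blast
    have *: "P y" if x: "x \<in> {0..T}" "\<bar>x - s\<bar> < \<eta>" and y: "y \<in> {0..T}" "\<bar>y - s\<bar> < \<eta>" and Px: "P x" for x y
      unfolding P_def
    proof
      fix r assume r: "r \<in> {0..y}"
      show "near (ref (\<gamma> r)) r"
      proof (cases "r \<le> x")
        case True
        then show ?thesis using Px r by (simp add: P_def)
      next
        case False
        have r': "r \<in> {0..T}" "\<bar>r - s\<bar> < \<eta>" using r y x False by auto
        have "near (ref (\<gamma> x)) x" using Px x by (simp add: P_def)
        then have "near c x" by (rule near_change_chart) (use x w ref in auto)
        then have "near c r" using w(4)[OF x(1) r'(1) x(2) r'(2)] False by simp
        then show ?thesis by (rule near_change_chart) (use r' w ref in auto)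
      qed
    qed
    show "\<exists>U. openin (top_of_set {0..T}) U \<and> s \<in> U \<and> (\<forall>x\<in>U. \<forall>y\<in>U. P x \<longrightarrow> P y)"
    proof (intro exI conjI ballI impI)
      show "openin (top_of_set {0..T}) ({0..T} \<inter> ball s \<eta>)" by (simp add: openin_open_Int)
      show "s \<in> {0..T} \<inter> ball s \<eta>" using s w(2) by simp
      show "P y" if "x \<in> {0..T} \<inter> ball s \<eta>" "y \<in> {0..T} \<inter> ball s \<eta>" "P x" for x y
        by (rule *[of x y]) (use that in \<open>auto simp: dist_real_def abs_minus_commute\<close>)
    qed
  qed
  then have "near (ref (\<gamma> t)) t" using t by (simp add: P_def)
  then show ?thesis by (rule near_change_chart) (use t c ref in auto)
qed

section \<open>From coordinate errors to the Riemannian distance\<close>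

lemma convergence_local:
  assumes g: "riemannian_metric A g" and t: "t \<in> {0..T}"
  obtains C h1 \<eta> where "C > 0" "h1 > 0" "\<eta> > 0"
    "\<And>h k. 0 < h \<Longrightarrow> h < h1 \<Longrightarrow> \<bar>real k * h - t\<bar> < \<eta> \<Longrightarrow> real k * h \<le> T \<Longrightarrow>
      riemannian_dist A g (zR h k) (\<gamma> (real k * h)) \<le> ennreal (C * h) \<and>
      riemannian_dist A g (zS h k) (\<gamma> (real k * h)) \<le> ennreal (C * h)"
proof -
  obtain c \<eta> where c: "smooth_chart A c" and \<eta>: "\<eta> > 0" and dom: "\<And>r. r \<in> {0..T} \<Longrightarrow> \<bar>r - t\<bar> < \<eta> \<Longrightarrow> \<gamma> r \<in> dom_of c"
    and shake: "\<And>C0. C0 \<ge> 0 \<Longrightarrow> \<exists>C1>0. \<exists>h1>0. \<forall>h k. 0 < h \<and> h < h1 \<and> \<bar>real k * h - t\<bar> < \<eta> \<and>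
      \<bar>real (Suc k) * h - t\<bar> < \<eta> \<and> real (Suc k) * h \<le> T \<and> tracks c C0 h k \<longrightarrow>
      zS h (Suc k) \<in> dom_of c \<and> norm (snd c (zS h (Suc k)) - snd c (\<gamma> (real (Suc k) * h))) \<le> C1 * h"
    by (rule window[OF t]) blast
  have ct: "\<gamma> t \<in> dom_of c" using dom[OF t] \<eta> by simp
  obtain C0 h2 \<eta>2 where n: "C0 > 0" "h2 > 0" "\<eta>2 > 0"
    "\<And>h k. 0 < h \<Longrightarrow> h < h2 \<Longrightarrow> \<bar>real k * h - t\<bar> < \<eta>2 \<Longrightarrow> real k * h \<le> T \<Longrightarrow>
     tracks c C0 h k \<and> \<gamma> (real k * h) \<in> dom_of c"
    using near_solution[OF t c ct] unfolding near_def by blast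
  obtain C1 h3 where C1: "C1 > 0" "h3 > 0" "\<And>h k. 0 < h \<and> h < h3 \<and> \<bar>real k * h - t\<bar> < \<eta> \<and>
      \<bar>real (Suc k) * h - t\<bar> < \<eta> \<and> real (Suc k) * h \<le> T \<and> tracks c C0 h k \<Longrightarrow>
      zS h (Suc k) \<in> dom_of c \<and> norm (snd c (zS h (Suc k)) - snd c (\<gamma> (real (Suc k) * h))) \<le> C1 * h"
    using shake[of C0] n(1) by (metis less_imp_le)
  obtain r L where r: "r > 0" "L > 0"
    "\<And>p q. p \<in> dom_of c \<Longrightarrow> q \<in> dom_of c \<Longrightarrow> snd c p \<in> ball (snd c (\<gamma> t)) r \<Longrightarrow> snd c q \<in> ball (snd c (\<gamma> t)) r \<Longrightarrow>
      riemannian_dist A g p q \<le> ennreal (L * norm (snd c p - snd c q))"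
    using riemannian_dist_chart[OF g c ct] by blast
  obtain \<eta>3 where \<eta>3: "\<eta>3 > 0"
    "\<And>s. s \<in> {0..T} \<Longrightarrow> \<bar>s - t\<bar> < \<eta>3 \<Longrightarrow> \<gamma> s \<in> dom_of c \<and> snd c (\<gamma> s) \<in> ball (snd c (\<gamma> t)) (r / 2)"
    using \<gamma>_near[OF c t ct, of "r / 2"] r by (metis half_gt_zero)
  define B where "B = max C0 C1"
  have B: "B > 0" "C0 \<le> B" "C1 \<le> B" using n by (auto simp: B_def)
  have dist: "riemannian_dist A g p (\<gamma> s) \<le> ennreal (L * B * h)"
    if "s \<in> {0..T}" "\<bar>s - t\<bar> < \<eta>3" "p \<in> dom_of c" "norm (snd c p - snd c (\<gamma> s)) \<le> B * h" "B * h < r / 2" for p s h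
  proof -
    have s: "\<gamma> s \<in> dom_of c" "snd c (\<gamma> s) \<in> ball (snd c (\<gamma> t)) (r / 2)" using \<eta>3(2) that by auto
    then have "snd c p \<in> ball (snd c (\<gamma> t)) r"
      using that dist_triangle[of "snd c (\<gamma> t)" "snd c p" "snd c (\<gamma> s)"] by (simp add: dist_norm norm_minus_commute)
    then have "riemannian_dist A g p (\<gamma> s) \<le> ennreal (L * norm (snd c p - snd c (\<gamma> s)))"
      using r(1) s that by (intro r(3)) auto
    also have "\<dots> \<le> ennreal (L * B * h)"
      using mult_left_mono[OF that(4), of L] r by (intro ennreal_leI) (simp add: mult_ac)
    finally show ?thesis .
  qed
  \<comment> \<open>Halving leaves room for the step before \<open>k\<close>, from which the SHAKE
    estimate starts: \<open>h < \<eta>4\<close> keeps it within \<open>2 * \<eta>4\<close> of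
    \<open>t\<close>.\<close>
  define \<eta>4 where "\<eta>4 = min \<eta> (min \<eta>2 \<eta>3) / 2"
  define h1 where "h1 = min (min h2 h3) (min \<eta>4 (r / (2 * B)))"
  show thesis
  proof (rule that[of "L * B" h1 \<eta>4])
    show "L * B > 0" "h1 > 0" "\<eta>4 > 0" using r B n C1 \<eta> \<eta>3 by (auto simp: h1_def \<eta>4_def)
    fix h k assume h: "0 < h" "h < h1" and k: "\<bar>real k * h - t\<bar> < \<eta>4" "real k * h \<le> T"
    have h': "h < h2" "h < h3" "h < \<eta>4" using h by (auto simp: h1_def)
    have "B * h < B * (r / (2 * B))" using h B by (intro mult_strict_left_mono) (auto simp: h1_def)
    then have Bh: "B * h < r / 2" using B by simp
    have kT: "real k * h \<in> {0..T}" using h k by simp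
    have k3: "\<bar>real k * h - t\<bar> < \<eta>3" using k(1) \<eta> n \<eta>3 by (auto simp: \<eta>4_def)
    have kn: "tracks c C0 h k' \<and> \<bar>real k' * h - t\<bar> < \<eta>"
      if "\<bar>real k' * h - t\<bar> < 2 * \<eta>4" "real k' * h \<le> T" for k'
      using n(4)[OF h(1) h'(1), of k'] that by (auto simp: \<eta>4_def)
    have C0B: "C0 * h \<le> B * h" "C1 * h \<le> B * h" using B h by (auto intro: mult_right_mono)
    have "tracks c C0 h k"
      using kn[of k] k by simp
    then have "riemannian_dist A g (zR h k) (\<gamma> (real k * h)) \<le> ennreal (L * B * h)"
      using C0B by (intro dist[OF kT k3 _ _ Bh]) (auto simp: tracks_def)
    moreover have "riemannian_dist A g (zS h k) (\<gamma> (real k * h)) \<le> ennreal (L * B * h)"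
    \<comment> \<open>The SHAKE estimate covers iterates with a predecessor; the iterate with index
      0 is \<open>z0\<close>, which equals \<open>\<gamma> 0\<close>.\<close>
    proof (cases k)
      case 0
      have "\<gamma> 0 \<in> dom_of c" using \<eta>3(2)[OF kT k3] 0 by simp
      then show ?thesis using 0 \<gamma>0 dist[OF kT k3 _ _ Bh, of z0] B h by simp
    next
      case (Suc k')
      have k': "real k' * h = real k * h - h" by (simp add: Suc algebra_simps)
      have "tracks c C0 h k' \<and> \<bar>real k' * h - t\<bar> < \<eta>"
        using kn[of k'] k h h' unfolding k' by auto
      moreover have "\<bar>real k * h - t\<bar> < \<eta>" using kn[of k] k by simp
      ultimately have "zS h k \<in> dom_of c \<and> norm (snd c (zS h k) - snd c (\<gamma> (real k * h))) \<le> C1 * h"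
        using C1(3)[of h k'] h h' k unfolding Suc by blast
      then show ?thesis using C0B by (intro dist[OF kT k3 _ _ Bh]) auto
    qed
    ultimately show "riemannian_dist A g (zR h k) (\<gamma> (real k * h)) \<le> ennreal (L * B * h) \<and>
      riemannian_dist A g (zS h k) (\<gamma> (real k * h)) \<le> ennreal (L * B * h)" by blast
  qed
qed

text \<open>The local constants depend on \<open>t\<close>; a finite subcover of
  \<open>{0..T}\<close> allows the maximum of the \<open>C t\<close> and the minimum of the
  \<open>h1 t\<close> to be taken.\<close>

theorem convergence:
  assumes g: "riemannian_metric A g"
  shows "\<exists>C>0. \<exists>h1>0. \<forall>h k. 0 < h \<and> h < h1 \<and> real k * h \<le> T \<longrightarrow>
      riemannian_dist A g (zR h k) (\<gamma> (real k * h)) \<le> ennreal (C * h) \<and>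
      riemannian_dist A g (zS h k) (\<gamma> (real k * h)) \<le> ennreal (C * h)"
proof -
  have "\<exists>C h1 \<eta>. C > 0 \<and> h1 > 0 \<and> \<eta> > 0 \<and> (\<forall>h k. 0 < h \<longrightarrow> h < h1 \<longrightarrow> \<bar>real k * h - t\<bar> < \<eta> \<longrightarrow> real k * h \<le> T \<longrightarrow>
      riemannian_dist A g (zR h k) (\<gamma> (real k * h)) \<le> ennreal (C * h) \<and>
      riemannian_dist A g (zS h k) (\<gamma> (real k * h)) \<le> ennreal (C * h))" if "t \<in> {0..T}" for t
    by (rule convergence_local[OF g that]) blast
  then obtain C h1 \<eta> where loc: "\<And>t. t \<in> {0..T} \<Longrightarrow> C t > 0" "\<And>t. t \<in> {0..T} \<Longrightarrow> h1 t > 0" "\<And>t. t \<in> {0..T} \<Longrightarrow> \<eta> t > 0"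
    "\<And>t h k. t \<in> {0..T} \<Longrightarrow> 0 < h \<Longrightarrow> h < h1 t \<Longrightarrow> \<bar>real k * h - t\<bar> < \<eta> t \<Longrightarrow> real k * h \<le> T \<Longrightarrow>
      riemannian_dist A g (zR h k) (\<gamma> (real k * h)) \<le> ennreal (C t * h) \<and>
      riemannian_dist A g (zS h k) (\<gamma> (real k * h)) \<le> ennreal (C t * h)"
    by (metis (mono_tags))
  have cover: "{0..T} \<subseteq> (\<Union>t\<in>{0..T}. ball t (\<eta> t))" using loc(3) by fastforce
  obtain F where F: "F \<subseteq> {0..T}" "finite F" "{0..T} \<subseteq> (\<Union>t\<in>F. ball t (\<eta> t))"
    by (rule compactE_image[OF compact_Icc _ cover]) auto
  have F0: "F \<noteq> {}" using F(3) T by auto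
  show ?thesis
  proof (intro exI conjI allI impI)
    obtain t0 where t0: "t0 \<in> F" using F0 by blast
    have "0 < C t0" using loc(1) t0 F(1) by blast
    also have "C t0 \<le> Max (C ` F)" using t0 F(2) by simp
    finally show "Max (C ` F) > 0" .
    have "0 < h1 t" if "t \<in> F" for t using loc(2) that F(1) by blast
    then show "Min (h1 ` F) > 0" using F(2) F0 by simp
    fix h k assume hk: "0 < h \<and> h < Min (h1 ` F) \<and> real k * h \<le> T"
    then have "real k * h \<in> {0..T}" by simp
    then obtain t where t: "t \<in> F" "real k * h \<in> ball t (\<eta> t)" using F(3) by blast
    have "Min (h1 ` F) \<le> h1 t" using t F by simp
    then have "h < h1 t" using hk by linarith
    then have "riemannian_dist A g (zR h k) (\<gamma> (real k * h)) \<le> ennreal (C t * h) \<and>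
      riemannian_dist A g (zS h k) (\<gamma> (real k * h)) \<le> ennreal (C t * h)"
      using loc(4)[of t h k] hk t F(1) by (auto simp: dist_real_def abs_minus_commute)
    moreover have "ennreal (C t * h) \<le> ennreal (Max (C ` F) * h)"
      using hk t F by (intro ennreal_leI mult_right_mono) auto
    ultimately show "riemannian_dist A g (zR h k) (\<gamma> (real k * h)) \<le> ennreal (Max (C ` F) * h)"
      "riemannian_dist A g (zS h k) (\<gamma> (real k * h)) \<le> ennreal (Max (C ` F) * h)"
      using order_trans by blast+
  qed
qed

end

theorem proposition4p4:
  fixes A :: "('p::{t2_space, second_countable_topology}, 'e::euclidean_space) chart set"
    and \<omega> g :: "'p \<Rightarrow> 'e \<Rightarrow> 'e \<Rightarrow> real"
    and H :: "'p \<Rightarrow> real"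
    and J :: "'p \<Rightarrow> 'v::real_vector \<Rightarrow> real"
    and M W :: "'p set"
    and I :: "real set"
    and \<phi> :: "real \<Rightarrow> 'p \<Rightarrow> 'p"
    and h0 T :: real
    and \<gamma> :: "real \<Rightarrow> 'p"
    and z0 :: 'p
  assumes "smooth_atlas A" and "symplectic_form A \<omega>" and "smooth_fun A H"
    and "\<exists>B :: 'v set. finite B \<and> span B = UNIV"
    and "smooth_dual_map A J" and "zero_is_regular_value A J"
    and "M = zero_level J" and "coisotropic A \<omega> M"
    and "\<And>z x. z \<in> M \<Longrightarrow> critical_on_fibre A \<omega> M H z x \<Longrightarrow> nondegenerate_on_fibre A \<omega> M H z x"
    and "consistent_method A (hamiltonian_field A \<omega> H) I \<phi>"
    and "openin (top_of_set M) W" and "hidden_constraint A \<omega> M H \<subseteq> W"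
    and "h0 > 0" and "{-h0<..<h0} \<subseteq> I"
    and "shake_rattle_well_defined A \<omega> M H \<phi> W h0"
    and "T \<ge> 0" and "constrained_solution A \<omega> M H T \<gamma>"
    and "\<gamma> 0 = z0" and "z0 \<in> hidden_constraint A \<omega> M H"
    and "riemannian_metric A g"
  shows "\<exists>C>0. \<exists>h1>0. \<forall>h (k::nat). 0 < h \<and> h < h1 \<and> real k * h \<le> T \<longrightarrow>
           riemannian_dist A g ((rattle A \<omega> M H \<phi> W h ^^ k) z0) (\<gamma> (real k * h)) \<le> ennreal (C * h) \<and>
           riemannian_dist A g ((shake A \<omega> M \<phi> W h ^^ k) z0) (\<gamma> (real k * h)) \<le> ennreal (C * h)"
proof -
  interpret shake_rattle_solution A \<omega> M H I \<phi> W h0 T \<gamma> z0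
    by unfold_locales (use assms in auto)
  show ?thesis by (rule convergence[OF assms(20)])
qed

end
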